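(* Let $\mathbb{F}_q$ be a finite field of odd order, and let $f, g\in \mathbb{F}_q[x_1,\dots,x_n]$ be two cubic forms. There exists a deterministic algorithm that decides whether $f$ and $g$ are isomorphic in time $q^{O(n)}$, correctly for all but at most a $\frac{1}{q^{\Omega(n)}}$ fraction of $f$.
   Context: A cubic form is a homogeneous polynomial of degree 3, given as the list of its coefficients. For $A=(a_{i,j})\in\mathrm{GL}(n,\mathbb{F}_q)$, $f\circ A := f(\sum_{j} a_{1,j}x_j, \dots, \sum_{j} a_{n,j}x_j)$; $f$ and $g$ are isomorphic if $f=g\circ A$ for some $A\in\mathrm{GL}(n,\mathbb{F}_q)$. The fraction refers to $f$ drawn uniformly at random, i.e. with the coefficients of all degree-3 monomials independent and uniform in $\mathbb{F}_q$; $g$ is arbitrary. *)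

theory Defs
  imports
    Complex_Main
    "HOL-Library.Landau_Symbols"
    "HOL-Algebra.Indexed_Polynomials"
begin

section \<open>Polynomials in several variables over a ring\<close>

text \<open>
  \<^theory>\<open>HOL-Algebra.Indexed_Polynomials\<close> represents a polynomial by its coefficient function on
  monomials, a monomial being the multiset of its variables, and supplies the set of polynomials,
  the constants, the variables and the sum.  The product is added here.
\<close>

definition mpoly_mult ::
    "('a, 'b) ring_scheme \<Rightarrow> ('c multiset \<Rightarrow> 'a) \<Rightarrow> ('c multiset \<Rightarrow> 'a) \<Rightarrow> 'c multiset \<Rightarrow> 'a" where
  "mpoly_mult R P Q = (\<lambda>m. \<Oplus>\<^bsub>R\<^esub>a\<in>{a. a \<subseteq># m}. P a \<otimes>\<^bsub>R\<^esub> Q (m - a))"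

text \<open>The variables \<open>x\<^sub>1, \<dots>, x\<^sub>n\<close> are indexed by \<open>0, \<dots>, n - 1\<close>.\<close>

definition mpoly_ring :: "('a, 'b) ring_scheme \<Rightarrow> nat \<Rightarrow> (nat multiset \<Rightarrow> 'a) ring" where
  "mpoly_ring R n =
    \<lparr>carrier = ring.indexed_pset R {..<n} (carrier R),
     monoid.mult = mpoly_mult R,
     one = ring.indexed_const R \<one>\<^bsub>R\<^esub>,
     zero = ring.indexed_const R \<zero>\<^bsub>R\<^esub>,
     add = ring.indexed_padd R\<rparr>"

definition cubic_forms :: "('a, 'b) ring_scheme \<Rightarrow> nat \<Rightarrow> (nat multiset \<Rightarrow> 'a) set" where
  "cubic_forms R n =
    {f \<in> carrier (mpoly_ring R n). \<forall>m. f m \<noteq> \<zero>\<^bsub>R\<^esub> \<longrightarrow> size m = 3}"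

definition general_linear :: "('a, 'b) ring_scheme \<Rightarrow> nat \<Rightarrow> (nat \<Rightarrow> nat \<Rightarrow> 'a) set" where
  "general_linear R n =
    {A. (\<forall>i<n. \<forall>j<n. A i j \<in> carrier R) \<and>
        (\<exists>B. (\<forall>i<n. \<forall>j<n. B i j \<in> carrier R) \<and>
             (\<forall>i<n. \<forall>j<n. (\<Oplus>\<^bsub>R\<^esub>k\<in>{..<n}. A i k \<otimes>\<^bsub>R\<^esub> B k j) = (if i = j then \<one>\<^bsub>R\<^esub> else \<zero>\<^bsub>R\<^esub>)) \<and>
             (\<forall>i<n. \<forall>j<n. (\<Oplus>\<^bsub>R\<^esub>k\<in>{..<n}. B i k \<otimes>\<^bsub>R\<^esub> A k j) = (if i = j then \<one>\<^bsub>R\<^esub> else \<zero>\<^bsub>R\<^esub>)))}"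

definition linear_form ::
    "('a, 'b) ring_scheme \<Rightarrow> nat \<Rightarrow> (nat \<Rightarrow> 'a) \<Rightarrow> nat multiset \<Rightarrow> 'a" where
  "linear_form R n a =
    (\<Oplus>\<^bsub>mpoly_ring R n\<^esub>j\<in>{..<n}.
       ring.indexed_const R (a j) \<otimes>\<^bsub>mpoly_ring R n\<^esub> ring.indexed_var R j)"

definition subst_matrix ::
    "('a, 'b) ring_scheme \<Rightarrow> nat \<Rightarrow> (nat multiset \<Rightarrow> 'a) \<Rightarrow> (nat \<Rightarrow> nat \<Rightarrow> 'a) \<Rightarrow> nat multiset \<Rightarrow> 'a" where
  "subst_matrix R n f A =
    (\<Oplus>\<^bsub>mpoly_ring R n\<^esub>m\<in>{m. f m \<noteq> \<zero>\<^bsub>R\<^esub>}.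
       ring.indexed_const R (f m) \<otimes>\<^bsub>mpoly_ring R n\<^esub>
       (\<Otimes>\<^bsub>mpoly_ring R n\<^esub>i\<in>{..<n}. linear_form R n (A i) [^]\<^bsub>mpoly_ring R n\<^esub> count m i))"

definition isomorphic_forms ::
    "('a, 'b) ring_scheme \<Rightarrow> nat \<Rightarrow> (nat multiset \<Rightarrow> 'a) \<Rightarrow> (nat multiset \<Rightarrow> 'a) \<Rightarrow> bool" where
  "isomorphic_forms R n f g \<longleftrightarrow> (\<exists>A\<in>general_linear R n. f = subst_matrix R n g A)"

lemma finite_submultisets [simp]: "finite {a. a \<subseteq># m}"
proof (induction m)
  case (add x m)
  have "{a. a \<subseteq># add_mset x m} \<subseteq> {a. a \<subseteq># m} \<union> add_mset x ` {a. a \<subseteq># m}"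
  proof
    fix a assume "a \<in> {a. a \<subseteq># add_mset x m}"
    then have a: "a \<subseteq># add_mset x m" by simp
    show "a \<in> {a. a \<subseteq># m} \<union> add_mset x ` {a. a \<subseteq># m}"
    proof (cases "x \<in># a")
      case True
      then obtain a' where "a = add_mset x a'" by (metis insert_DiffM)
      with a show ?thesis by simp
    next
      case False
      have "count a y \<le> count m y" for y
        using mset_subset_eq_count[OF a, of y] False by (cases "y = x") (auto simp: not_in_iff)
      then show ?thesis by (simp add: subseteq_mset_def)
    qed
  qed
  then show ?case using add by (auto dest: finite_subset)
qed simp

lemma diff_diff_submultiset: "a \<subseteq># m \<Longrightarrow> m - (m - a) = (a :: 'a multiset)"
  by (simp add: multiset_eq_iff subseteq_mset_def)

context cring
begin

lemma mpoly_mult_const: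
  fixes P :: "'c multiset \<Rightarrow> 'a"
  assumes "carrier_coeff P" "k \<in> carrier R"
  shows "mpoly_mult R P (indexed_const k) = (\<lambda>m. P m \<otimes> k)"
proof
  fix m :: "'c multiset"
  have "mpoly_mult R P (indexed_const k) m = (\<Oplus>a\<in>{a. a \<subseteq># m}. if m = a then P a \<otimes> k else \<zero>)"
    unfolding mpoly_mult_def
  proof (rule finsum_cong')
    fix a assume "a \<in> {a. a \<subseteq># m}"
    then show "P a \<otimes> indexed_const k (m - a) = (if m = a then P a \<otimes> k else \<zero>)"
      using assms by (auto simp: indexed_const_def carrier_coeff_def Diff_eq_empty_iff_mset
          dest: subset_mset.antisym)
  qed (use assms in \<open>auto simp: carrier_coeff_def\<close>)
  also have "\<dots> = P m \<otimes> k"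
    using assms by (subst add.finprod_singleton) (auto simp: carrier_coeff_def)
  finally show "mpoly_mult R P (indexed_const k) m = P m \<otimes> k" .
qed

lemma mpoly_mult_carrier_coeff:
  assumes "carrier_coeff P" "carrier_coeff Q"
  shows "carrier_coeff (mpoly_mult R P Q)"
  using assms unfolding carrier_coeff_def mpoly_mult_def by (auto intro!: finsum_closed)

lemma mpoly_mult_add:
  fixes P :: "'c multiset \<Rightarrow> 'a"
  assumes "carrier_coeff P" "carrier_coeff Q" "carrier_coeff S"
  shows "mpoly_mult R P (indexed_padd Q S) = indexed_padd (mpoly_mult R P Q) (mpoly_mult R P S)"
proof
  fix m :: "'c multiset"
  have "mpoly_mult R P (indexed_padd Q S) m
      = (\<Oplus>a\<in>{a. a \<subseteq># m}. P a \<otimes> Q (m - a) \<oplus> P a \<otimes> S (m - a))"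
    unfolding mpoly_mult_def indexed_padd_def
    using assms by (intro finsum_cong') (auto simp: carrier_coeff_def r_distr)
  also have "\<dots> = indexed_padd (mpoly_mult R P Q) (mpoly_mult R P S) m"
    unfolding mpoly_mult_def indexed_padd_def
    using assms by (intro finsum_addf) (auto simp: carrier_coeff_def)
  finally show "mpoly_mult R P (indexed_padd Q S) m
      = indexed_padd (mpoly_mult R P Q) (mpoly_mult R P S) m" .
qed

lemma mpoly_mult_comm:
  fixes P :: "'c multiset \<Rightarrow> 'a"
  assumes "carrier_coeff P" "carrier_coeff Q"
  shows "mpoly_mult R P Q = mpoly_mult R Q P"
proof
  fix m :: "'c multiset"
  have inj: "inj_on (\<lambda>a. m - a) {a. a \<subseteq># m}"
    by (rule inj_onI) (metis mem_Collect_eq diff_diff_submultiset)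
  have img: "(\<lambda>a. m - a) ` {a. a \<subseteq># m} = {a. a \<subseteq># m}"
  proof (intro equalityI subsetI)
    fix a assume "a \<in> {a. a \<subseteq># m}"
    then have "a = m - (m - a)" "m - a \<subseteq># m"
      by (simp_all add: diff_diff_submultiset)
    then show "a \<in> (\<lambda>a. m - a) ` {a. a \<subseteq># m}" by blast
  qed auto
  have "mpoly_mult R Q P m = (\<Oplus>a\<in>(\<lambda>a. m - a) ` {a. a \<subseteq># m}. Q a \<otimes> P (m - a))"
    unfolding img mpoly_mult_def ..
  also have "\<dots> = (\<Oplus>a\<in>{a. a \<subseteq># m}. Q (m - a) \<otimes> P (m - (m - a)))"
    using assms inj by (subst finsum_reindex) (auto simp: carrier_coeff_def)
  also have "\<dots> = mpoly_mult R P Q m"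
    unfolding mpoly_mult_def
    using assms by (intro finsum_cong') (auto simp: carrier_coeff_def m_comm diff_diff_submultiset)
  finally show "mpoly_mult R P Q m = mpoly_mult R Q P m" ..
qed

lemma mpoly_mult_pmult:
  fixes P :: "'c multiset \<Rightarrow> 'a"
  assumes "carrier_coeff P" "carrier_coeff Q"
  shows "mpoly_mult R P (indexed_pmult Q i) = indexed_pmult (mpoly_mult R P Q) i"
proof
  fix m :: "'c multiset"
  show "mpoly_mult R P (indexed_pmult Q i) m = indexed_pmult (mpoly_mult R P Q) i m"
  proof (cases "i \<in># m")
    case False
    then have "mpoly_mult R P (indexed_pmult Q i) m = (\<Oplus>a\<in>{a. a \<subseteq># m}. \<zero>)"
      unfolding mpoly_mult_def using assms
      by (intro finsum_cong') (auto simp: indexed_pmult_def carrier_coeff_def dest: in_diffD)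
    with False show ?thesis by (simp add: indexed_pmult_def)
  next
    case True
    then obtain m' where m: "m = add_mset i m'" by (metis insert_DiffM)
    have iff: "a \<subseteq># m' \<longleftrightarrow> a \<subseteq># m \<and> i \<in># m - a" for a
    proof
      assume "a \<subseteq># m'"
      then show "a \<subseteq># m \<and> i \<in># m - a"
        by (auto simp: m in_diff_count subset_mset.le_iff_add)
    next
      assume a: "a \<subseteq># m \<and> i \<in># m - a"
      then obtain b where b: "m - a = add_mset i b" by (metis insert_DiffM)
      have "m = a + (m - a)" using a by simp
      then have "add_mset i m' = add_mset i (a + b)" unfolding b by (simp add: m)
      then have "m' = a + b" by simp
      then show "a \<subseteq># m'" by simp
    qed
    have "mpoly_mult R P (indexed_pmult Q i) m = (\<Oplus>a\<in>{a. a \<subseteq># m'}. P a \<otimes> Q (m' - a))"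
      unfolding mpoly_mult_def
    proof (rule add.finprod_mono_neutral_cong_right)
      show "{a. a \<subseteq># m'} \<subseteq> {a. a \<subseteq># m}"
        using iff by blast
      show "P a \<otimes> indexed_pmult Q i (m - a) = \<zero>" if "a \<in> {a. a \<subseteq># m} - {a. a \<subseteq># m'}" for a
        using that assms iff[of a] by (auto simp: indexed_pmult_def carrier_coeff_def)
      show "P a \<otimes> indexed_pmult Q i (m - a) = P a \<otimes> Q (m' - a)" if "a \<in> {a. a \<subseteq># m'}" for a
        using that iff[of a] by (auto simp: indexed_pmult_def m)
    qed (use assms in \<open>auto simp: carrier_coeff_def indexed_pmult_def\<close>)
    with True show ?thesis by (simp add: indexed_pmult_def mpoly_mult_def m)
  qed
qed

lemma mpoly_carrier_coeff: "P \<in> carrier (mpoly_ring R n) \<Longrightarrow> carrier_coeff P"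
  unfolding mpoly_ring_def using indexed_pset_in_carrier[OF subset_refl] by simp

lemma mpoly_mult_closed:
  assumes P: "P \<in> carrier (mpoly_ring R n)" and "Q \<in> carrier (mpoly_ring R n)"
  shows "mpoly_mult R P Q \<in> carrier (mpoly_ring R n)"
proof -
  have scale: "(\<lambda>m. P m \<otimes> k) \<in> indexed_pset {..<n} (carrier R)"
    if "k \<in> carrier R" "P \<in> indexed_pset {..<n} (carrier R)" for k P
    using that(2)
  proof induction
    case (indexed_const c)
    have "(\<lambda>m :: nat multiset. indexed_const c m \<otimes> k) = indexed_const (c \<otimes> k)"
      using that(1) indexed_const by (auto simp: indexed_const_def)
    then show ?case using that(1) indexed_const by (auto intro: indexed_pset.indexed_const)
  next
    case (indexed_padd P Q)
    have "(\<lambda>m. indexed_padd P Q m \<otimes> k) = indexed_padd (\<lambda>m. P m \<otimes> k) (\<lambda>m. Q m \<otimes> k)"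
      using indexed_pset_in_carrier[OF subset_refl indexed_padd.hyps(1)] that(1)
        indexed_pset_in_carrier[OF subset_refl indexed_padd.hyps(2)]
      by (auto simp: indexed_padd_def carrier_coeff_def l_distr)
    then show ?case using indexed_padd.IH by (auto intro: indexed_pset.indexed_padd)
  next
    case (indexed_pmult P i)
    have "(\<lambda>m. indexed_pmult P i m \<otimes> k) = indexed_pmult (\<lambda>m. P m \<otimes> k) i"
      using that(1) by (auto simp: indexed_pmult_def)
    then show ?case using indexed_pmult.IH indexed_pmult.hyps by (auto intro: indexed_pset.indexed_pmult)
  qed
  have "Q \<in> indexed_pset {..<n} (carrier R)" using assms(2) by (simp add: mpoly_ring_def)
  then have "mpoly_mult R P Q \<in> indexed_pset {..<n} (carrier R)"
  proof induction
    case (indexed_const k)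
    then show ?case
      using scale P by (simp add: mpoly_mult_const[OF mpoly_carrier_coeff[OF P]] mpoly_ring_def)
  next
    case (indexed_padd Q S)
    note QS = indexed_padd.hyps[THEN indexed_pset_in_carrier[OF subset_refl]]
    show ?case
      using QS indexed_padd.IH
      by (simp add: mpoly_mult_add[OF mpoly_carrier_coeff[OF P]] indexed_pset.indexed_padd)
  next
    case (indexed_pmult Q i)
    note Q = indexed_pset_in_carrier[OF subset_refl indexed_pmult.hyps(1)]
    show ?case
      using Q indexed_pmult.IH indexed_pmult.hyps(2)
      by (simp add: mpoly_mult_pmult[OF mpoly_carrier_coeff[OF P]] indexed_pset.indexed_pmult)
  qed
  then show ?thesis by (simp add: mpoly_ring_def)
qed

lemma mpoly_mult_assoc:
  assumes P: "P \<in> carrier (mpoly_ring R n)" and Q: "Q \<in> carrier (mpoly_ring R n)"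
    and "S \<in> carrier (mpoly_ring R n)"
  shows "mpoly_mult R (mpoly_mult R P Q) S = mpoly_mult R P (mpoly_mult R Q S)"
proof -
  note PQ = mpoly_carrier_coeff[OF P] mpoly_carrier_coeff[OF Q]
  note PQ' = mpoly_mult_carrier_coeff[OF PQ]
  have "S \<in> indexed_pset {..<n} (carrier R)" using assms(3) by (simp add: mpoly_ring_def)
  then show ?thesis
  proof induction
    case (indexed_const k)
    have "mpoly_mult R P Q m \<otimes> k = mpoly_mult R P (\<lambda>m. Q m \<otimes> k) m" for m
    proof -
      have "mpoly_mult R P Q m \<otimes> k = (\<Oplus>a\<in>{a. a \<subseteq># m}. P a \<otimes> Q (m - a) \<otimes> k)"
        unfolding mpoly_mult_def
        using PQ indexed_const by (intro finsum_ldistr) (auto simp: carrier_coeff_def)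
      also have "\<dots> = mpoly_mult R P (\<lambda>m. Q m \<otimes> k) m"
        unfolding mpoly_mult_def
        using PQ indexed_const by (intro finsum_cong') (auto simp: carrier_coeff_def m_assoc)
      finally show ?thesis .
    qed
    then show ?case
      using PQ PQ' indexed_const by (simp add: mpoly_mult_const)
  next
    case (indexed_padd S T)
    note ST = indexed_padd.hyps[THEN indexed_pset_in_carrier[OF subset_refl]]
    show ?case
      using PQ PQ' ST indexed_padd.IH
      by (simp add: mpoly_mult_add mpoly_mult_carrier_coeff)
  next
    case (indexed_pmult S i)
    note S = indexed_pset_in_carrier[OF subset_refl indexed_pmult.hyps(1)]
    show ?case
      using PQ PQ' S indexed_pmult.IH
      by (simp add: mpoly_mult_pmult mpoly_mult_carrier_coeff)
  qed
qed

lemma cring_mpoly_ring: "cring (mpoly_ring R n)"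
proof (rule cringI)
  note cc = mpoly_carrier_coeff
  have one: "indexed_const \<one> \<in> carrier (mpoly_ring R n)"
    by (simp add: mpoly_ring_def indexed_pset.indexed_const)
  have mone: "indexed_const (\<ominus> \<one>) \<in> carrier (mpoly_ring R n)"
    by (simp add: mpoly_ring_def indexed_pset.indexed_const)
  show "abelian_group (mpoly_ring R n)"
  proof (rule abelian_groupI)
    fix P assume P: "P \<in> carrier (mpoly_ring R n)"
    have "mpoly_mult R P (indexed_const (\<ominus> \<one>)) \<oplus>\<^bsub>mpoly_ring R n\<^esub> P = \<zero>\<^bsub>mpoly_ring R n\<^esub>"
      using cc[OF P] by (simp add: mpoly_mult_const)
        (auto simp: mpoly_ring_def indexed_padd_def indexed_const_def carrier_coeff_def
          r_minus l_neg)
    then show "\<exists>Q\<in>carrier (mpoly_ring R n). Q \<oplus>\<^bsub>mpoly_ring R n\<^esub> P = \<zero>\<^bsub>mpoly_ring R n\<^esub>"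
      using mpoly_mult_closed[OF P mone] by blast
  next
    fix P assume P: "P \<in> carrier (mpoly_ring R n)"
    show "\<zero>\<^bsub>mpoly_ring R n\<^esub> \<oplus>\<^bsub>mpoly_ring R n\<^esub> P = P"
      using indexed_padd_zero(2)[OF cc[OF P]] by (simp add: mpoly_ring_def)
  next
    fix P Q S
    assume "P \<in> carrier (mpoly_ring R n)" "Q \<in> carrier (mpoly_ring R n)"
      "S \<in> carrier (mpoly_ring R n)"
    from this[THEN cc] show "P \<oplus>\<^bsub>mpoly_ring R n\<^esub> Q \<oplus>\<^bsub>mpoly_ring R n\<^esub> S
        = P \<oplus>\<^bsub>mpoly_ring R n\<^esub> (Q \<oplus>\<^bsub>mpoly_ring R n\<^esub> S)"
      by (simp add: mpoly_ring_def indexed_padd_def carrier_coeff_def a_assoc)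
  next
    fix P Q
    assume "P \<in> carrier (mpoly_ring R n)" "Q \<in> carrier (mpoly_ring R n)"
    from this[THEN cc] show "P \<oplus>\<^bsub>mpoly_ring R n\<^esub> Q = Q \<oplus>\<^bsub>mpoly_ring R n\<^esub> P"
      by (simp add: mpoly_ring_def indexed_padd_def carrier_coeff_def a_comm)
  qed (auto simp: mpoly_ring_def indexed_pset.indexed_const indexed_pset.indexed_padd)
  show "Group.comm_monoid (mpoly_ring R n)"
  proof (rule comm_monoidI)
    fix P Q assume PQ: "P \<in> carrier (mpoly_ring R n)" "Q \<in> carrier (mpoly_ring R n)"
    show "P \<otimes>\<^bsub>mpoly_ring R n\<^esub> Q \<in> carrier (mpoly_ring R n)"
      using mpoly_mult_closed[OF PQ] by (simp add: mpoly_ring_def)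
    show "P \<otimes>\<^bsub>mpoly_ring R n\<^esub> Q = Q \<otimes>\<^bsub>mpoly_ring R n\<^esub> P"
      using mpoly_mult_comm[OF PQ[THEN cc]] by (simp add: mpoly_ring_def)
  next
    fix P Q S
    assume "P \<in> carrier (mpoly_ring R n)" "Q \<in> carrier (mpoly_ring R n)"
      "S \<in> carrier (mpoly_ring R n)"
    from mpoly_mult_assoc[OF this] show "P \<otimes>\<^bsub>mpoly_ring R n\<^esub> Q \<otimes>\<^bsub>mpoly_ring R n\<^esub> S
        = P \<otimes>\<^bsub>mpoly_ring R n\<^esub> (Q \<otimes>\<^bsub>mpoly_ring R n\<^esub> S)"
      by (simp add: mpoly_ring_def)
  next
    fix P assume P: "P \<in> carrier (mpoly_ring R n)"
    have "mpoly_mult R P (indexed_const \<one>) = P"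
      using cc[OF P] by (simp add: mpoly_mult_const carrier_coeff_def)
    then show "\<one>\<^bsub>mpoly_ring R n\<^esub> \<otimes>\<^bsub>mpoly_ring R n\<^esub> P = P"
      using mpoly_mult_comm[OF cc[OF P] cc[OF one]] by (simp add: mpoly_ring_def)
  qed (use one in \<open>simp add: mpoly_ring_def\<close>)
  fix P Q S
  assume "P \<in> carrier (mpoly_ring R n)" "Q \<in> carrier (mpoly_ring R n)"
    "S \<in> carrier (mpoly_ring R n)"
  note PQS = this[THEN cc]
  have "mpoly_mult R (indexed_padd P Q) S = indexed_padd (mpoly_mult R P S) (mpoly_mult R Q S)"
    using PQS by (simp add: mpoly_mult_comm[of _ S] mpoly_mult_add indexed_padd_in_carrier)
  then show "(P \<oplus>\<^bsub>mpoly_ring R n\<^esub> Q) \<otimes>\<^bsub>mpoly_ring R n\<^esub> S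
      = P \<otimes>\<^bsub>mpoly_ring R n\<^esub> S \<oplus>\<^bsub>mpoly_ring R n\<^esub> Q \<otimes>\<^bsub>mpoly_ring R n\<^esub> S"
    by (simp add: mpoly_ring_def)
qed

end

section \<open>Deterministic algorithms and their running time\<close>

text \<open>
  Algorithms are programs of the first-order, call-by-value, pure Lisp fragment whose only data are
  binary trees (Jones, Computability and Complexity from a Programming Perspective).  Values are
  shared pointers and every construct does a bounded amount of work on them, so counting evaluated
  subexpressions is, up to a polynomial, running time on a Turing machine or on a random access
  machine with logarithmic cost.  Bounds of the form \<open>q\<close> to the power \<open>O(n)\<close> are insensitive to
  such a polynomial, and likewise to the choice of input encoding below, as long as its length is
  polynomial in \<open>q\<close> and \<open>n\<close>.
\<close>

datatype val = NIL | CONS val val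

datatype expr =
    Var nat
  | Empty
  | Pair expr expr
  | Hd expr
  | Tl expr
  | Cond expr expr expr
  | Call nat "expr list"

text \<open>A program is a list of function bodies; \<open>Var i\<close> is the \<open>i\<close>-th argument of the function
  in which it occurs, and execution starts with function \<open>0\<close>.\<close>

type_synonym program = "expr list"

fun hd_val :: "val \<Rightarrow> val" where
  "hd_val NIL = NIL"
| "hd_val (CONS x y) = x"

fun tl_val :: "val \<Rightarrow> val" where
  "tl_val NIL = NIL"
| "tl_val (CONS x y) = y"

text \<open>\<open>evaluates P xs e v k\<close>: with arguments \<open>xs\<close>, the expression \<open>e\<close> evaluates to \<open>v\<close> in \<open>k\<close> steps.\<close>

inductive evaluates :: "program \<Rightarrow> val list \<Rightarrow> expr \<Rightarrow> val \<Rightarrow> nat \<Rightarrow> bool"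
  and evaluates_list :: "program \<Rightarrow> val list \<Rightarrow> expr list \<Rightarrow> val list \<Rightarrow> nat \<Rightarrow> bool"
  for P :: program where
  Var: "i < length xs \<Longrightarrow> evaluates P xs (Var i) (xs ! i) 1"
| Empty: "evaluates P xs Empty NIL 1"
| Pair: "evaluates P xs e1 v1 k1 \<Longrightarrow> evaluates P xs e2 v2 k2 \<Longrightarrow>
    evaluates P xs (Pair e1 e2) (CONS v1 v2) (1 + k1 + k2)"
| Hd: "evaluates P xs e v k \<Longrightarrow> evaluates P xs (Hd e) (hd_val v) (1 + k)"
| Tl: "evaluates P xs e v k \<Longrightarrow> evaluates P xs (Tl e) (tl_val v) (1 + k)"
| Cond_True: "evaluates P xs e v k \<Longrightarrow> v \<noteq> NIL \<Longrightarrow> evaluates P xs e1 v1 k1 \<Longrightarrow>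
    evaluates P xs (Cond e e1 e2) v1 (1 + k + k1)"
| Cond_False: "evaluates P xs e NIL k \<Longrightarrow> evaluates P xs e2 v2 k2 \<Longrightarrow>
    evaluates P xs (Cond e e1 e2) v2 (1 + k + k2)"
| Call: "evaluates_list P xs es vs k \<Longrightarrow> i < length P \<Longrightarrow> evaluates P vs (P ! i) v l \<Longrightarrow>
    evaluates P xs (Call i es) v (1 + k + l)"
| args_Nil: "evaluates_list P xs [] [] 0"
| args_Cons: "evaluates P xs e v k \<Longrightarrow> evaluates_list P xs es vs l \<Longrightarrow>
    evaluates_list P xs (e # es) (v # vs) (k + l)"

definition run :: "program \<Rightarrow> val list \<Rightarrow> val \<Rightarrow> nat \<Rightarrow> bool" where
  "run P xs v k \<longleftrightarrow> P \<noteq> [] \<and> evaluates P xs (P ! 0) v k"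

definition halts_within :: "program \<Rightarrow> val list \<Rightarrow> nat \<Rightarrow> bool" where
  "halts_within P xs T \<longleftrightarrow> (\<exists>v k. run P xs v k \<and> k \<le> T)"

definition accepts :: "program \<Rightarrow> val list \<Rightarrow> bool" where
  "accepts P xs \<longleftrightarrow> (\<exists>v k. run P xs v k \<and> v \<noteq> NIL)"

inductive_cases evaluates_VarE: "evaluates P xs (Var i) v k"
inductive_cases evaluates_EmptyE: "evaluates P xs Empty v k"
inductive_cases evaluates_PairE: "evaluates P xs (Pair e1 e2) v k"
inductive_cases evaluates_HdE: "evaluates P xs (Hd e) v k"
inductive_cases evaluates_TlE: "evaluates P xs (Tl e) v k"
inductive_cases evaluates_CondE: "evaluates P xs (Cond e e1 e2) v k"
inductive_cases evaluates_CallE: "evaluates P xs (Call i es) v k"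
inductive_cases evaluates_NilE: "evaluates_list P xs [] vs k"
inductive_cases evaluates_ConsE: "evaluates_list P xs (e # es) vs k"

lemma evaluates_deterministic:
  "evaluates P xs e v k \<Longrightarrow> evaluates P xs e v' k' \<Longrightarrow> v' = v \<and> k' = k"
  "evaluates_list P xs es vs l \<Longrightarrow> evaluates_list P xs es vs' l' \<Longrightarrow> vs' = vs \<and> l' = l"
proof (induction arbitrary: v' k' and vs' l' rule: evaluates_evaluates_list.inducts)
  case Var
  show ?case
    by (rule evaluates_VarE[OF Var.prems]) simp
next
  case Empty
  show ?case
    by (rule evaluates_EmptyE[OF Empty.prems]) simp
next
  case Pair
  show ?case
    by (rule evaluates_PairE[OF Pair.prems]) (auto dest!: Pair.IH(2,4))
next
  case Hd
  show ?case
    by (rule evaluates_HdE[OF Hd.prems]) (auto dest!: Hd.IH(2))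
next
  case Tl
  show ?case
    by (rule evaluates_TlE[OF Tl.prems]) (auto dest!: Tl.IH(2))
next
  case Cond_True
  show ?case
    by (rule evaluates_CondE[OF Cond_True.prems])
      (use Cond_True.hyps in \<open>auto dest!: Cond_True.IH(2,4)\<close>)
next
  case Cond_False
  show ?case
    by (rule evaluates_CondE[OF Cond_False.prems]) (auto dest!: Cond_False.IH(2,4))
next
  case Call
  show ?case
    by (rule evaluates_CallE[OF Call.prems]) (auto dest!: Call.IH(2,5))
next
  case args_Nil
  show ?case
    by (rule evaluates_NilE[OF args_Nil.prems]) simp
next
  case args_Cons
  show ?case
    by (rule evaluates_ConsE[OF args_Cons.prems]) (auto dest!: args_Cons.IH(2,4))
qed

corollary run_deterministic: "run P xs v k \<Longrightarrow> run P xs v' k' \<Longrightarrow> v' = v \<and> k' = k"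
  unfolding run_def using evaluates_deterministic(1) by blast

section \<open>Encoding of the input\<close>

text \<open>Numbers are written in unary.  The field with \<open>q\<close> elements is given by its addition and
  multiplication tables, its elements being named \<open>0, \<dots>, q - 1\<close> in an arbitrary way.\<close>

fun enc_nat :: "nat \<Rightarrow> val" where
  "enc_nat 0 = NIL"
| "enc_nat (Suc k) = CONS NIL (enc_nat k)"

fun enc_list :: "val list \<Rightarrow> val" where
  "enc_list [] = NIL"
| "enc_list (v # vs) = CONS v (enc_list vs)"

definition enc_table :: "nat \<Rightarrow> (nat \<Rightarrow> nat \<Rightarrow> nat) \<Rightarrow> val" where
  "enc_table q h = enc_list (map (\<lambda>a. enc_list (map (\<lambda>b. enc_nat (h a b)) [0..<q])) [0..<q])"

definition enc_cubic_form :: "nat \<Rightarrow> (nat multiset \<Rightarrow> nat) \<Rightarrow> val" where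
  "enc_cubic_form n f =
    enc_list [enc_nat (f {#i, j, k#}). i \<leftarrow> [0..<n], j \<leftarrow> [i..<n], k \<leftarrow> [j..<n]]"

definition enc_input ::
    "nat ring \<Rightarrow> nat \<Rightarrow> nat \<Rightarrow> (nat multiset \<Rightarrow> nat) \<Rightarrow> (nat multiset \<Rightarrow> nat) \<Rightarrow> val list" where
  "enc_input R q n f g =
    [enc_nat n, enc_nat q, enc_table q (add R), enc_table q (monoid.mult R),
     enc_cubic_form n f, enc_cubic_form n g]"

end

theory Submission
  imports Defs
begin

text \<open>
  Let \<open>T\<^sub>f\<close> be the polarisation of \<open>f\<close> and let \<open>r = 40\<close>. If \<open>f = g \<circ> A\<close> and \<open>w\<^sub>i = A e\<^sub>i\<close>, then
  \<open>T\<^sub>f(e\<^sub>i, x, y) = T\<^sub>g(w\<^sub>i, A x, A y)\<close>, so the columns of \<open>A\<close> and of minus its inverse solve the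
  linear system \<open>T\<^sub>g(w\<^sub>i, e\<^sub>j, a\<^sub>k) + T\<^sub>f(e\<^sub>i, b\<^sub>j, e\<^sub>k) = 0\<close> (\<open>i \<le> r\<close>; \<open>j, k \<le> n\<close>) in the unknown
  vectors \<open>a\<^sub>k\<close> and \<open>b\<^sub>j\<close>. The algorithm runs through all \<open>w\<^sub>1, \<dots>, w\<^sub>r\<close>, computes a basis of the
  solution space, and tests the matrix of every combination of the first \<open>(4 r + 9) n\<close> basis
  vectors on all points. Acceptance is therefore always correct. A change of variables shows that
  the solution space has at most as many elements as the space of adjoints of \<open>f\<close>, which belongs to
  \<open>g = f\<close> and \<open>w\<^sub>i = e\<^sub>i\<close>; so the answer is correct whenever \<open>f\<close> has at most \<open>q\<close> to the power
  \<open>(4 r + 9) n\<close> adjoints.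

  To bound the expected number of adjoints \<open>(A, D)\<close> of a random \<open>f\<close>, let \<open>t \<le> (n - r) / 4\<close> be
  maximal such that \<open>A\<close> has an invertible \<open>t \<times> t\<close> submatrix whose row and column indices are
  disjoint and larger than \<open>r\<close>. If the bound on \<open>t\<close> is not attained, maximality determines all
  entries of \<open>A\<close> off the diagonal and outside \<open>2 t + r\<close> rows and columns, so there are \<open>q\<close> to the
  power \<open>5 t n + O(n)\<close> such \<open>A\<close>. On the other hand, varying the coefficients of suitable monomials
  \<open>x\<^sub>i x\<^sub>l x\<^sub>p\<close> with \<open>i \<le> r\<close> shows that \<open>(A, D)\<close> is an adjoint of at most a fraction \<open>q\<close> to the
  power \<open>- 10 t n\<close> of all \<open>f\<close>, and the same holds with the transpose of \<open>D\<close> in place of \<open>A\<close>. Hence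
  the expectation is \<open>q\<close> to the power \<open>O(n)\<close>, and Markov's inequality applies.
\<close>

section \<open>One commutative ring for all finite fields\<close>

text \<open>The product of all commutative rings on subsets of \<^typ>\<open>nat\<close> is an instance of
  \<^class>\<open>comm_ring_1\<close>, which makes the type class tools available for calculations in any given ring
  \<open>R\<close>: \<open>proj R\<close> is a homomorphism onto \<open>R\<close>, and \<open>emb R\<close> identifies \<open>R\<close> with an ideal of the
  product.\<close>

typedef prod_ring = "{F :: nat ring \<Rightarrow> nat. \<forall>R. F R \<in> (if cring R then carrier R else {0})}"
proof
  show "(\<lambda>R. if cring R then \<zero>\<^bsub>R\<^esub> else 0)
      \<in> {F :: nat ring \<Rightarrow> nat. \<forall>R. F R \<in> (if cring R then carrier R else {0})}"
    by (auto simp: cring_def ring.ring_simprules(2))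
qed

definition proj :: "nat ring \<Rightarrow> prod_ring \<Rightarrow> nat" where
  "proj R u = Rep_prod_ring u R"

definition tuple :: "(nat ring \<Rightarrow> nat) \<Rightarrow> prod_ring" where
  "tuple F = Abs_prod_ring (\<lambda>R. if cring R then F R else 0)"

lemma proj_tuple:
  assumes "\<And>R. cring R \<Longrightarrow> F R \<in> carrier R"
  shows "proj R (tuple F) = (if cring R then F R else 0)"
  unfolding proj_def tuple_def using assms by (subst Abs_prod_ring_inverse) auto

lemma proj_closed [simp]: "cring R \<Longrightarrow> proj R u \<in> carrier R"
  using Rep_prod_ring[of u] by (auto simp: proj_def split: if_splits)

lemma proj_not_cring: "\<not> cring R \<Longrightarrow> proj R u = 0"
  using Rep_prod_ring[of u] by (auto simp: proj_def split: if_splits dest: spec[of _ R])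

lemma prod_ring_eqI: "(\<And>R. cring R \<Longrightarrow> proj R u = proj R v) \<Longrightarrow> u = v"
  by (metis Rep_prod_ring_inject proj_def proj_not_cring ext)

lemma cring_two:
  "cring \<lparr>carrier = {0, 1}, monoid.mult = (*), one = 1, zero = 0,
     add = \<lambda>a b. (a + b) mod (2 :: nat)\<rparr>"
  by (rule cringI; (rule abelian_groupI comm_monoidI)?) auto

instantiation prod_ring :: comm_ring_1
begin

definition "0 = tuple (\<lambda>R. \<zero>\<^bsub>R\<^esub>)"
definition "1 = tuple (\<lambda>R. \<one>\<^bsub>R\<^esub>)"
definition "u + v = tuple (\<lambda>R. proj R u \<oplus>\<^bsub>R\<^esub> proj R v)"
definition "u * v = tuple (\<lambda>R. proj R u \<otimes>\<^bsub>R\<^esub> proj R v)"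
definition "- u = tuple (\<lambda>R. \<ominus>\<^bsub>R\<^esub> proj R u)"
definition "u - v = u + - (v :: prod_ring)"

lemma proj_hom:
  assumes "cring R"
  shows "proj R 0 = \<zero>\<^bsub>R\<^esub>" "proj R 1 = \<one>\<^bsub>R\<^esub>" "proj R (u + v) = proj R u \<oplus>\<^bsub>R\<^esub> proj R v"
    "proj R (u * v) = proj R u \<otimes>\<^bsub>R\<^esub> proj R v" "proj R (- u) = \<ominus>\<^bsub>R\<^esub> proj R u"
proof -
  note closed = cring.cring_simprules(1-3,5,6)
  show "proj R 0 = \<zero>\<^bsub>R\<^esub>" "proj R 1 = \<one>\<^bsub>R\<^esub>" "proj R (u + v) = proj R u \<oplus>\<^bsub>R\<^esub> proj R v"
    "proj R (u * v) = proj R u \<otimes>\<^bsub>R\<^esub> proj R v" "proj R (- u) = \<ominus>\<^bsub>R\<^esub> proj R u"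
    unfolding zero_prod_ring_def one_prod_ring_def plus_prod_ring_def times_prod_ring_def
      uminus_prod_ring_def
    using assms by (simp_all add: proj_tuple closed)
qed

instance
proof
  fix u v w :: prod_ring
  note ring_laws = cring.cring_simprules(7-14)
  show "u * v * w = u * (v * w)" "u * v = v * u" "1 * u = u" "u + v + w = u + (v + w)"
    "u + v = v + u" "0 + u = u" "- u + u = 0" "(u + v) * w = u * w + v * w"
    by (rule prod_ring_eqI, simp add: proj_hom ring_laws)+
  show "u - v = u + - v"
    by (rule minus_prod_ring_def)
  show "(0 :: prod_ring) \<noteq> 1"
    using proj_hom(1,2)[OF cring_two] by auto
qed

end

lemma proj_sum:
  assumes "cring R" "finite S"
  shows "proj R (\<Sum>s\<in>S. h s) = (\<Oplus>\<^bsub>R\<^esub>s\<in>S. proj R (h s))"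
proof -
  interpret cring R by fact
  show ?thesis
    using assms(2) by (induction S) (simp_all add: proj_hom assms(1))
qed

definition emb :: "nat ring \<Rightarrow> nat \<Rightarrow> prod_ring" where
  "emb R a = tuple (\<lambda>S. if S = R then a else \<zero>\<^bsub>S\<^esub>)"

lemma proj_emb:
  assumes "cring R" "a \<in> carrier R"
  shows "proj S (emb R a) = (if cring S then if S = R then a else \<zero>\<^bsub>S\<^esub> else 0)"
  unfolding emb_def using assms by (subst proj_tuple) (auto intro: cring.cring_simprules(2))

lemma proj_emb_same [simp]: "cring R \<Longrightarrow> a \<in> carrier R \<Longrightarrow> proj R (emb R a) = a"
  by (simp add: proj_emb)

lemma emb_proj: "cring R \<Longrightarrow> u \<in> emb R ` carrier R \<Longrightarrow> emb R (proj R u) = u"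
  by auto

lemma emb_hom:
  assumes "cring R" "a \<in> carrier R" "b \<in> carrier R"
  shows "emb R (a \<oplus>\<^bsub>R\<^esub> b) = emb R a + emb R b" "emb R (a \<otimes>\<^bsub>R\<^esub> b) = emb R a * emb R b"
    "emb R (\<ominus>\<^bsub>R\<^esub> a) = - emb R a"
  using assms by (auto intro!: prod_ring_eqI simp: proj_emb proj_hom cring.cring_simprules)

lemma emb_zero: "cring R \<Longrightarrow> emb R \<zero>\<^bsub>R\<^esub> = 0"
  by (auto intro!: prod_ring_eqI simp: proj_emb proj_hom cring.cring_simprules)

lemma emb_inject: "cring R \<Longrightarrow> a \<in> carrier R \<Longrightarrow> b \<in> carrier R \<Longrightarrow> emb R a = emb R b \<longleftrightarrow> a = b"
  by (metis proj_emb_same)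

lemma emb_finsum:
  assumes "cring R" "finite S" "\<And>s. s \<in> S \<Longrightarrow> a s \<in> carrier R"
  shows "emb R (\<Oplus>\<^bsub>R\<^esub>s\<in>S. a s) = (\<Sum>s\<in>S. emb R (a s))"
proof -
  interpret cring R by fact
  show ?thesis
    using assms(2,3)
    by (induction S) (simp_all add: emb_zero emb_hom assms(1) Pi_def)
qed

text \<open>The unit \<open>e\<close> of the field \<open>K\<close> need not be the unit of the ambient ring.\<close>

locale finite_subfield =
  fixes K :: "'u :: comm_ring_1 set" and e :: 'u
  assumes zero_K [simp]: "0 \<in> K"
    and add_K [simp]: "a \<in> K \<Longrightarrow> b \<in> K \<Longrightarrow> a + b \<in> K"
    and mult_K [simp]: "a \<in> K \<Longrightarrow> b \<in> K \<Longrightarrow> a * b \<in> K"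
    and uminus_K [simp]: "a \<in> K \<Longrightarrow> - a \<in> K"
    and e_K [simp]: "e \<in> K"
    and e_neq_0 [simp]: "e \<noteq> 0"
    and e_mult: "a \<in> K \<Longrightarrow> e * a = a"
    and inverse_ex: "a \<in> K \<Longrightarrow> a \<noteq> 0 \<Longrightarrow> \<exists>b\<in>K. b * a = e"
    and finite_K [simp]: "finite K"
begin

lemma mult_e: "a \<in> K \<Longrightarrow> a * e = a"
  by (metis e_mult mult.commute)

lemma diff_K [simp]: "a \<in> K \<Longrightarrow> b \<in> K \<Longrightarrow> a - b \<in> K"
  using add_K[of a "- b"] by simp

lemma sum_K [simp]: "(\<And>i. i \<in> S \<Longrightarrow> h i \<in> K) \<Longrightarrow> sum h S \<in> K"
  by (induction S rule: infinite_finite_induct) auto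

lemma mult_eq_0_K:
  assumes "a \<in> K" "b \<in> K" "a * b = 0" "a \<noteq> 0"
  shows "b = 0"
proof -
  obtain c where "c \<in> K" "c * a = e" using inverse_ex assms by blast
  then have "b = c * a * b" using e_mult[OF assms(2)] by simp
  also have "\<dots> = 0" using assms(3) by (simp add: mult.assoc)
  finally show ?thesis .
qed

definition q :: nat where "q = card K"

lemma q_ge_2: "2 \<le> q"
proof -
  have "card {0, e} \<le> card K" by (rule card_mono) auto
  moreover have "card {0, e} = 2" using e_neq_0 by (metis card_2_iff)
  ultimately show ?thesis by (simp add: q_def)
qed

end

locale odd_subfield = finite_subfield +
  assumes odd_q: "odd q"
begin

text \<open>Translation by \<open>e\<close> permutes \<open>K\<close>, hence \<open>q e = 0\<close>.\<close>

lemma two_e_neq_0: "e + e \<noteq> 0"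
proof
  assume double_e: "e + e = 0"
  have "(\<Sum>k\<in>K. k + e) = (\<Sum>k\<in>(\<lambda>k. k + e) ` K. k)"
    by (subst sum.reindex) (auto simp: inj_on_def)
  also have "(\<lambda>k. k + e) ` K = K"
    by (rule card_subset_eq) (auto simp: card_image inj_on_def)
  finally have "of_nat q * e = 0" by (simp add: sum.distrib q_def)
  moreover obtain j where "q = 2 * j + 1" using odd_q by (elim oddE)
  moreover have "of_nat (2 * j) * e = of_nat j * (e + e)" by (simp add: algebra_simps)
  ultimately show False using double_e by (simp add: distrib_right)
qed

lemma double_eq_0: "a \<in> K \<Longrightarrow> a + a = 0 \<Longrightarrow> a = 0"
  using mult_eq_0_K[of "e + e" a] two_e_neq_0 add_K[OF e_K e_K] e_mult[of a]
  by (metis distrib_right)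

end

lemma card_emb: "cring R \<Longrightarrow> card (emb R ` carrier R) = card (carrier R)"
  by (rule card_image) (auto simp: inj_on_def emb_inject)

lemma finite_subfield_emb:
  assumes "field R" "finite (carrier R)"
  shows "finite_subfield (emb R ` carrier R) (emb R \<one>\<^bsub>R\<^esub>)"
proof -
  interpret R: field R by fact
  note cring = R.is_cring
  note hom = emb_hom[OF cring, symmetric]
  show ?thesis
  proof
    show "0 \<in> emb R ` carrier R"
      using emb_zero[OF cring] by (metis R.zero_closed image_eqI)
  next
    fix a b assume "a \<in> emb R ` carrier R" "b \<in> emb R ` carrier R"
    then show "a + b \<in> emb R ` carrier R" "a * b \<in> emb R ` carrier R"
      by (auto simp: hom)
  next
    fix a assume a: "a \<in> emb R ` carrier R"
    then show "- a \<in> emb R ` carrier R" "emb R \<one>\<^bsub>R\<^esub> * a = a" by (auto simp: hom)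
    assume "a \<noteq> 0"
    with a obtain x where "a = emb R x" "x \<in> carrier R" "x \<noteq> \<zero>\<^bsub>R\<^esub>"
      using emb_zero[OF cring] by auto
    moreover from this have "inv\<^bsub>R\<^esub> x \<in> carrier R" "inv\<^bsub>R\<^esub> x \<otimes>\<^bsub>R\<^esub> x = \<one>\<^bsub>R\<^esub>"
      using R.field_Units by auto
    ultimately show "\<exists>b\<in>emb R ` carrier R. b * a = emb R \<one>\<^bsub>R\<^esub>"
      by (metis hom(2) imageI)
  next
    show "emb R \<one>\<^bsub>R\<^esub> \<noteq> 0"
      using emb_zero[OF cring] emb_inject[OF cring]
      by (metis R.one_closed R.one_not_zero R.zero_closed)
  qed (use assms in auto)
qed

lemma odd_subfield_emb:
  assumes "field R" "odd (card (carrier R))"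
  shows "odd_subfield (emb R ` carrier R) (emb R \<one>\<^bsub>R\<^esub>)"
proof -
  have "finite (carrier R)" using assms(2) card.infinite by fastforce
  then interpret finite_subfield "emb R ` carrier R" "emb R \<one>\<^bsub>R\<^esub>"
    by (rule finite_subfield_emb[OF assms(1)])
  have "cring R" using assms(1) by (simp add: field_def domain_def)
  then show ?thesis using assms(2) by unfold_locales (simp add: q_def card_emb)
qed

section \<open>Most cubic forms have few adjoints\<close>

text \<open>\<open>polar_coeff c i j k\<close> is the value of the polarisation of the form with coefficients \<open>c\<close> at
  the unit vectors \<open>i\<close>, \<open>j\<close>, \<open>k\<close>.\<close>

definition perm_factor :: "nat \<Rightarrow> nat \<Rightarrow> nat \<Rightarrow> 'u :: comm_ring_1" where
  "perm_factor i j k = (if i = j \<and> j = k then 6 else if i = j \<or> j = k \<or> i = k then 2 else 1)"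

definition polar_coeff :: "(nat multiset \<Rightarrow> 'u) \<Rightarrow> nat \<Rightarrow> nat \<Rightarrow> nat \<Rightarrow> 'u :: comm_ring_1" where
  "polar_coeff c i j k = perm_factor i j k * c {#i, j, k#}"

lemma polar_coeff_commute: "polar_coeff c i j k = polar_coeff c i k j"
  unfolding polar_coeff_def perm_factor_def by (auto simp: add_mset_commute)

lemma polar_coeff_add: "polar_coeff (\<lambda>m. c m + d m) i j k
    = polar_coeff c i j k + polar_coeff d i j k"
  by (simp add: polar_coeff_def distrib_left)

text \<open>With the symmetric matrices \<open>T\<^sub>i = (polar_coeff c i j k)\<^sub>j\<^sub>,\<^sub>k\<close>, this is the \<open>(j, k)\<close> entry of
  \<open>T\<^sub>i A + D T\<^sub>i\<close>.\<close>

definition adjoint_residual ::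
    "nat \<Rightarrow> (nat multiset \<Rightarrow> 'u) \<Rightarrow> (nat \<times> nat \<Rightarrow> 'u) \<Rightarrow> (nat \<times> nat \<Rightarrow> 'u) \<Rightarrow> nat \<Rightarrow> nat \<Rightarrow> nat
      \<Rightarrow> 'u :: comm_ring_1" where
  "adjoint_residual n c A D i j k =
    (\<Sum>p<n. A (p, k) * polar_coeff c i j p) + (\<Sum>p<n. D (j, p) * polar_coeff c i p k)"

lemma adjoint_residual_add:
  "adjoint_residual n (\<lambda>m. c m + d m) A D i j k
    = adjoint_residual n c A D i j k + adjoint_residual n d A D i j k"
  by (simp add: adjoint_residual_def polar_coeff_add distrib_left sum.distrib)

definition transp :: "(nat \<times> nat \<Rightarrow> 'u) \<Rightarrow> nat \<times> nat \<Rightarrow> 'u" where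
  "transp A = (\<lambda>(i, j). A (j, i))"

lemma transp_transp [simp]: "transp (transp A) = A"
  by (auto simp: transp_def)

lemma adjoint_residual_transp:
  "adjoint_residual n c (transp D) (transp A) i j k = adjoint_residual n c A D i k j"
  by (simp add: adjoint_residual_def transp_def polar_coeff_commute[of c i j]
      polar_coeff_commute[of c i _ k] add.commute)

definition cubic_monomials :: "nat \<Rightarrow> nat multiset set" where
  "cubic_monomials n = {m. size m = 3 \<and> set_mset m \<subseteq> {..<n}}"

lemma finite_cubic_monomials [simp]: "finite (cubic_monomials n)"
proof -
  have "cubic_monomials n \<subseteq> mset ` {xs. set xs \<subseteq> {..<n} \<and> length xs = 3}"
  proof
    fix m assume "m \<in> cubic_monomials n"
    moreover obtain xs where "mset xs = m" using ex_mset by blast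
    ultimately show "m \<in> mset ` {xs. set xs \<subseteq> {..<n} \<and> length xs = 3}"
      by (auto simp: cubic_monomials_def)
  qed
  then show ?thesis by (rule finite_subset) (simp add: finite_lists_length_eq)
qed

lemma sum_delta3:
  assumes "finite A" "finite B" "finite C" "a \<in> A" "b \<in> B" "c \<in> C"
  shows "(\<Sum>i\<in>A. \<Sum>j\<in>B. \<Sum>k\<in>C. if a = i \<and> b = j \<and> c = k then h i j k else 0)
    = (h a b c :: 'u :: comm_monoid_add)"
proof -
  have "(\<Sum>i\<in>A. \<Sum>j\<in>B. \<Sum>k\<in>C. if a = i \<and> b = j \<and> c = k then h i j k else 0)
      = (\<Sum>i\<in>A. if a = i then \<Sum>j\<in>B. if b = j then \<Sum>k\<in>C. if c = k then h i j k else 0 else 0 else 0)"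
    by (intro sum.cong refl) (auto intro!: sum.cong sum.neutral)
  then show ?thesis using assms by simp
qed

context finite_subfield
begin

lemma q_power_mono: "a \<le> b \<Longrightarrow> q ^ a \<le> q ^ b"
  using q_ge_2 by (intro power_increasing) auto

lemma card_funcset_K: "finite S \<Longrightarrow> card (S \<rightarrow>\<^sub>E K) = q ^ card S"
  by (simp add: card_funcsetE q_def)

definition mats :: "nat \<Rightarrow> (nat \<times> nat \<Rightarrow> 'u) set" where
  "mats n = {..<n} \<times> {..<n} \<rightarrow>\<^sub>E K"

lemma finite_mats [simp]: "finite (mats n)"
  unfolding mats_def by (intro finite_PiE) auto

lemma card_mats: "card (mats n) = q ^ (n * n)"
  by (simp add: mats_def card_funcset_K card_cartesian_product)

lemma mats_K [simp]: "A \<in> mats n \<Longrightarrow> i < n \<Longrightarrow> j < n \<Longrightarrow> A (i, j) \<in> K"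
  by (auto simp: mats_def)

lemma transp_mats: "A \<in> mats n \<Longrightarrow> transp A \<in> mats n"
  by (auto simp: mats_def transp_def PiE_def extensional_def)

definition cubics :: "nat \<Rightarrow> (nat multiset \<Rightarrow> 'u) set" where
  "cubics n = {c. (\<forall>m. c m \<in> K) \<and> (\<forall>m. m \<notin> cubic_monomials n \<longrightarrow> c m = 0)}"

lemma finite_cubics [simp]: "finite (cubics n)"
proof -
  have "cubics n \<subseteq> {c. \<forall>m. (m \<in> cubic_monomials n \<longrightarrow> c m \<in> K) \<and> (m \<notin> cubic_monomials n \<longrightarrow> c m = 0)}"
    by (auto simp: cubics_def)
  then show ?thesis by (rule finite_subset) (rule finite_set_of_finite_funs; simp)
qed

lemma cubics_add: "c \<in> cubics n \<Longrightarrow> d \<in> cubics n \<Longrightarrow> (\<lambda>m. c m + d m) \<in> cubics n"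
  by (auto simp: cubics_def)

definition adjoints ::
    "nat \<Rightarrow> nat \<Rightarrow> (nat multiset \<Rightarrow> 'u) \<Rightarrow> ((nat \<times> nat \<Rightarrow> 'u) \<times> (nat \<times> nat \<Rightarrow> 'u)) set" where
  "adjoints n r c = {(A, D). A \<in> mats n \<and> D \<in> mats n \<and>
     (\<forall>i<r. \<forall>j<n. \<forall>k<n. adjoint_residual n c A D i j k = 0)}"

lemma finite_adjoints [simp]: "finite (adjoints n r c)"
  by (rule finite_subset[of _ "mats n \<times> mats n"]) (auto simp: adjoints_def)

lemma adjoints_transp: "(A, D) \<in> adjoints n r c \<longleftrightarrow> (transp D, transp A) \<in> adjoints n r c"
proof -
  have "A \<in> mats n \<longleftrightarrow> transp A \<in> mats n" for A
    by (metis transp_mats transp_transp)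
  then show ?thesis unfolding adjoints_def mem_Collect_eq prod.case adjoint_residual_transp by blast
qed

definition cubics_with_adjoint ::
    "nat \<Rightarrow> nat \<Rightarrow> (nat \<times> nat \<Rightarrow> 'u) \<Rightarrow> (nat \<times> nat \<Rightarrow> 'u) \<Rightarrow> (nat multiset \<Rightarrow> 'u) set" where
  "cubics_with_adjoint n r A D = {c \<in> cubics n. (A, D) \<in> adjoints n r c}"

lemma cubics_with_adjoint_transp:
  "cubics_with_adjoint n r (transp D) (transp A) = cubics_with_adjoint n r A D"
  unfolding cubics_with_adjoint_def using adjoints_transp by blast

subsection \<open>Forms with a given adjoint\<close>

text \<open>\<open>C\<close> inverts the submatrix of \<open>A\<close> with rows \<open>I\<close> and columns \<open>J\<close>. Only disjoint index sets are
  considered, so that nothing is said about the diagonal: diagonal matrices are too few to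
  matter.\<close>

definition minor_inverse ::
    "nat \<Rightarrow> nat \<Rightarrow> (nat \<times> nat \<Rightarrow> 'u) \<Rightarrow> nat set \<Rightarrow> nat set \<Rightarrow> (nat \<times> nat \<Rightarrow> 'u) \<Rightarrow> bool" where
  "minor_inverse r n A I J C \<longleftrightarrow> I \<subseteq> {r..<n} \<and> J \<subseteq> {r..<n} \<and> I \<inter> J = {} \<and> card I = card J \<and>
     C \<in> J \<times> I \<rightarrow>\<^sub>E K \<and> (\<forall>k\<in>J. \<forall>j\<in>J. (\<Sum>p\<in>I. C (k, p) * A (p, j)) = (if k = j then e else 0))"

lemma minor_inverse_finite: "minor_inverse r n A I J C \<Longrightarrow> finite I \<and> finite J"
  by (auto simp: minor_inverse_def dest: finite_subset)

lemma minor_inverse_K: "minor_inverse r n A I J C \<Longrightarrow> k \<in> J \<Longrightarrow> p \<in> I \<Longrightarrow> C (k, p) \<in> K"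
  by (auto simp: minor_inverse_def)

definition perturbation ::
    "nat \<Rightarrow> nat set \<Rightarrow> nat set \<Rightarrow> nat set \<Rightarrow> (nat \<times> nat \<Rightarrow> 'u) \<Rightarrow> (nat \<times> nat \<times> nat \<Rightarrow> 'u)
      \<Rightarrow> nat multiset \<Rightarrow> 'u" where
  "perturbation r I J L C \<alpha> m = (\<Sum>i<r. \<Sum>l\<in>L. \<Sum>p\<in>I.
     if m = {#i, l, p#} then \<Sum>k\<in>J. C (k, p) * \<alpha> (i, k, l) else 0)"

context
  fixes r n I J L C A
  assumes inv: "minor_inverse r n A I J C" and L_eq: "L = {r..<n} - (I \<union> J)"
begin

lemma index_sets:
  "finite I" "finite J" "finite L" "I \<inter> L = {}" "J \<inter> L = {}" "I \<inter> J = {}"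
  "I \<subseteq> {r..<n}" "J \<subseteq> {r..<n}" "L \<subseteq> {r..<n}"
  using inv L_eq by (auto simp: minor_inverse_def dest: finite_subset)

lemma perturbation_cubics:
  assumes \<alpha>_params: "\<alpha> \<in> {..<r} \<times> J \<times> L \<rightarrow>\<^sub>E K" and "r \<le> n"
  shows "perturbation r I J L C \<alpha> \<in> cubics n"
  unfolding cubics_def
proof (intro CollectI conjI allI impI)
  fix m
  show "perturbation r I J L C \<alpha> m \<in> K"
    unfolding perturbation_def using inv \<alpha>_params
    by (auto simp: minor_inverse_def intro!: sum_K mult_K)
  show "perturbation r I J L C \<alpha> m = 0" if "m \<notin> cubic_monomials n"
    unfolding perturbation_def
  proof (intro sum.neutral ballI)
    fix i l p assume "i \<in> {..<r}" "l \<in> L" "p \<in> I"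
    then have "{#i, l, p#} \<in> cubic_monomials n" using index_sets(7,9) \<open>r \<le> n\<close>
      by (force simp: cubic_monomials_def)
    with that show "(if m = {#i, l, p#} then \<Sum>k\<in>J. C (k, p) * \<alpha> (i, k, l) else 0) = 0" by auto
  qed
qed

lemma perturbation_eq:
  assumes "i < r" "l \<in> L" "p \<in> I"
  shows "perturbation r I J L C \<alpha> {#i, l, p#} = (\<Sum>k\<in>J. C (k, p) * \<alpha> (i, k, l))"
proof -
  have monomial_eq: "{#i, l, p#} = {#i', l', p'#} \<longleftrightarrow> i = i' \<and> l = l' \<and> p = p'"
    if "i' \<in> {..<r}" "l' \<in> L" "p' \<in> I" for i' l' p'
  proof
    assume "{#i, l, p#} = {#i', l', p'#}"
    then have "set_mset {#i, l, p#} = set_mset {#i', l', p'#}" by (rule arg_cong)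
    then have "i' \<in> {i, l, p}" "l' \<in> {i, l, p}" "p' \<in> {i, l, p}" by auto
    moreover have "i' \<noteq> l" "i' \<noteq> p" "l' \<noteq> i" "l' \<noteq> p" "p' \<noteq> i" "p' \<noteq> l"
      using assms that index_sets(4,7,9) by force+
    ultimately show "i = i' \<and> l = l' \<and> p = p'" by simp
  qed simp
  have "perturbation r I J L C \<alpha> {#i, l, p#} = (\<Sum>i'<r. \<Sum>l'\<in>L. \<Sum>p'\<in>I.
      if i = i' \<and> l = l' \<and> p = p' then \<Sum>k\<in>J. C (k, p') * \<alpha> (i', k, l') else 0)"
    unfolding perturbation_def by (intro sum.cong refl) (simp add: monomial_eq)
  also have "\<dots> = (\<Sum>k\<in>J. C (k, p) * \<alpha> (i, k, l))"
    using assms index_sets(1,3) by (intro sum_delta3) auto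
  finally show ?thesis .
qed

lemma perturbation_eq_0:
  assumes "set_mset m \<inter> I = {} \<or> j \<in># m \<and> j \<in> J"
  shows "perturbation r I J L C \<alpha> m = 0"
  unfolding perturbation_def
proof (intro sum.neutral ballI)
  fix i l p assume "i \<in> {..<r}" "l \<in> L" "p \<in> I"
  then have "m \<noteq> {#i, l, p#}" using assms index_sets by force
  then show "(if m = {#i, l, p#} then \<Sum>k\<in>J. C (k, p) * \<alpha> (i, k, l) else 0) = 0" by simp
qed

lemma adjoint_residual_perturbation:
  assumes \<alpha>_params: "\<alpha> \<in> {..<r} \<times> J \<times> L \<rightarrow>\<^sub>E K" and "i < r" "l \<in> L" "j \<in> J"
  shows "adjoint_residual n (perturbation r I J L C \<alpha>) A D i l j = \<alpha> (i, j, l)"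
proof -
  let ?c = "perturbation r I J L C \<alpha>"
  have coeff: "polar_coeff ?c i l p = (if p \<in> I then \<Sum>k\<in>J. C (k, p) * \<alpha> (i, k, l) else 0)" for p
  proof (cases "p \<in> I")
    case True
    then have "i \<noteq> l" "l \<noteq> p" "i \<noteq> p" using assms index_sets by fastforce+
    then show ?thesis
      using True assms by (simp add: polar_coeff_def perm_factor_def perturbation_eq)
  next
    case False
    have "{i, l, p} \<inter> I = {}" using False assms index_sets by fastforce
    then show ?thesis using False by (simp add: polar_coeff_def perturbation_eq_0)
  qed
  have "polar_coeff ?c i p j = 0" for p
    using assms by (simp add: polar_coeff_def perturbation_eq_0[of _ j])
  then have "adjoint_residual n ?c A D i l j
      = (\<Sum>p<n. if p \<in> I then A (p, j) * (\<Sum>k\<in>J. C (k, p) * \<alpha> (i, k, l)) else 0)"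
    by (auto simp: adjoint_residual_def coeff intro!: sum.cong)
  also have "\<dots> = (\<Sum>p\<in>I. A (p, j) * (\<Sum>k\<in>J. C (k, p) * \<alpha> (i, k, l)))"
    using index_sets(1,7) by (subst sum.inter_restrict[symmetric]) (auto intro!: sum.cong)
  also have "\<dots> = (\<Sum>k\<in>J. \<alpha> (i, k, l) * (\<Sum>p\<in>I. C (k, p) * A (p, j)))"
    unfolding sum_distrib_left by (subst sum.swap) (simp add: mult_ac)
  also have "\<dots> = (\<Sum>k\<in>J. if k = j then \<alpha> (i, k, l) * e else 0)"
    using inv assms by (intro sum.cong refl) (auto simp: minor_inverse_def)
  also have "\<dots> = \<alpha> (i, j, l)"
    using assms index_sets(2) mult_e[of "\<alpha> (i, j, l)"] PiE_mem[OF \<alpha>_params, of "(i, j, l)"]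
    by simp
  finally show ?thesis .
qed

end

text \<open>Adding a perturbation to a form changes its adjoint equations by the parameter \<open>\<alpha>\<close>, hence
  the translates of the space of forms with adjoint \<open>(A, D)\<close> by all perturbations are disjoint.\<close>

lemma inj_on_add_perturbation:
  assumes inv: "minor_inverse r n A I J C" and L_eq: "L = {r..<n} - (I \<union> J)"
  shows "inj_on (\<lambda>(c, \<alpha>) m. c m + perturbation r I J L C \<alpha> m)
    (cubics_with_adjoint n r A D \<times> ({..<r} \<times> J \<times> L \<rightarrow>\<^sub>E K))"
proof (intro inj_onI, clarify)
  fix c \<alpha> c' \<alpha>'
  let ?d = "perturbation r I J L C"
  assume c_adjoint: "c \<in> cubics_with_adjoint n r A D" "\<alpha> \<in> {..<r} \<times> J \<times> L \<rightarrow>\<^sub>E K"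
    and c'_adjoint: "c' \<in> cubics_with_adjoint n r A D" "\<alpha>' \<in> {..<r} \<times> J \<times> L \<rightarrow>\<^sub>E K"
    and eq: "(\<lambda>m. c m + ?d \<alpha> m) = (\<lambda>m. c' m + ?d \<alpha>' m)"
  have residual: "adjoint_residual n (\<lambda>m. b m + ?d \<beta> m) A D i l j = \<beta> (i, j, l)"
    if "b \<in> cubics_with_adjoint n r A D" "\<beta> \<in> {..<r} \<times> J \<times> L \<rightarrow>\<^sub>E K"
      "i < r" "j \<in> J" "l \<in> L" for b \<beta> i j l
  proof -
    have "l < n" "j < n" using that inv L_eq by (auto simp: minor_inverse_def)
    then have "adjoint_residual n b A D i l j = 0"
      using that by (auto simp: cubics_with_adjoint_def adjoints_def)
    then show ?thesis
      using adjoint_residual_perturbation[OF inv L_eq that(2,3,5,4)]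
      by (simp add: adjoint_residual_add)
  qed
  have "\<alpha> (i, j, l) = \<alpha>' (i, j, l)" if "i < r" "j \<in> J" "l \<in> L" for i j l
    using residual[OF c_adjoint that] residual[OF c'_adjoint that] unfolding eq by simp
  then have "\<alpha> = \<alpha>'"
    using c_adjoint(2) c'_adjoint(2) by (intro PiE_ext) auto
  with eq show "c = c' \<and> \<alpha> = \<alpha>'" by (auto simp: fun_eq_iff)
qed

lemma card_cubics_with_adjoint:
  assumes inv: "minor_inverse r n A I J C" and "r \<le> n"
  shows "card (cubics_with_adjoint n r A D) * q ^ (r * (card J * card ({r..<n} - (I \<union> J))))
    \<le> card (cubics n)"
proof -
  define L where "L = {r..<n} - (I \<union> J)"
  let ?H = "cubics_with_adjoint n r A D" and ?P = "{..<r} \<times> J \<times> L \<rightarrow>\<^sub>E K"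
  have "(\<lambda>(c, \<alpha>) m. c m + perturbation r I J L C \<alpha> m) ` (?H \<times> ?P) \<subseteq> cubics n"
    using perturbation_cubics[OF inv L_def _ \<open>r \<le> n\<close>]
    by (auto simp: cubics_with_adjoint_def intro!: cubics_add)
  then have "card (?H \<times> ?P) \<le> card (cubics n)"
    by (intro card_inj_on_le[OF inj_on_add_perturbation[OF inv L_def]]) auto
  moreover have "finite J" "finite L"
    using minor_inverse_finite[OF inv] by (auto simp: L_def)
  then have "card ?P = q ^ (r * (card J * card L))"
    by (simp add: card_funcset_K card_cartesian_product)
  ultimately show ?thesis by (simp add: card_cartesian_product L_def)
qed

subsection \<open>Matrices with a given maximal minor\<close>

definition schur_entry ::
    "(nat \<times> nat \<Rightarrow> 'u) \<Rightarrow> nat set \<Rightarrow> nat set \<Rightarrow> (nat \<times> nat \<Rightarrow> 'u) \<Rightarrow> nat \<Rightarrow> nat \<Rightarrow> 'u" where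
  "schur_entry A I J C i j = A (i, j) - (\<Sum>k\<in>J. A (i, k) * (\<Sum>p\<in>I. C (k, p) * A (p, j)))"

text \<open>Rows of the inverse of the minor bordered by row \<open>i\<close> and column \<open>j\<close>, where \<open>s\<close> is the inverse
  of the Schur complement.\<close>

definition border_row ::
    "(nat \<times> nat \<Rightarrow> 'u) \<Rightarrow> nat set \<Rightarrow> (nat \<times> nat \<Rightarrow> 'u) \<Rightarrow> nat \<Rightarrow> 'u \<Rightarrow> nat \<Rightarrow> 'u" where
  "border_row A J C i s p = (if p = i then s else - s * (\<Sum>k\<in>J. A (i, k) * C (k, p)))"

definition border_inverse ::
    "(nat \<times> nat \<Rightarrow> 'u) \<Rightarrow> nat set \<Rightarrow> nat set \<Rightarrow> (nat \<times> nat \<Rightarrow> 'u) \<Rightarrow> nat \<Rightarrow> nat \<Rightarrow> 'u \<Rightarrow> nat \<times> nat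
      \<Rightarrow> 'u" where
  "border_inverse A I J C i j s =
    restrict (\<lambda>(k, p). if k = j then border_row A J C i s p
      else (if p = i then 0 else C (k, p)) - (\<Sum>t\<in>I. C (k, t) * A (t, j)) * border_row A J C i s p)
    (insert j J \<times> insert i I)"

lemma border_row_mult:
  assumes inv: "minor_inverse r n A I J C" and i_notin: "i \<notin> I"
  shows "(\<Sum>p\<in>insert i I. border_row A J C i s p * A (p, b)) = s * schur_entry A I J C i b"
proof -
  have "(\<Sum>p\<in>I. border_row A J C i s p * A (p, b))
      = (\<Sum>p\<in>I. - s * (\<Sum>k\<in>J. A (i, k) * C (k, p) * A (p, b)))"
    using i_notin by (intro sum.cong refl) (auto simp: border_row_def sum_distrib_right mult.assoc)
  also have "\<dots> = - s * (\<Sum>k\<in>J. A (i, k) * (\<Sum>p\<in>I. C (k, p) * A (p, b)))"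
    unfolding sum_distrib_left[symmetric]
    by (subst sum.swap) (simp add: sum_distrib_left mult.assoc)
  finally show ?thesis
    using i_notin minor_inverse_finite[OF inv]
    by (simp add: border_row_def schur_entry_def algebra_simps)
qed

lemma schur_entry_eq_0:
  assumes inv: "minor_inverse r n A I J C" and b_mem: "b \<in> J" and "A (i, b) \<in> K"
  shows "schur_entry A I J C i b = 0"
proof -
  have "(\<Sum>k\<in>J. A (i, k) * (\<Sum>p\<in>I. C (k, p) * A (p, b))) = (\<Sum>k\<in>J. if k = b then A (i, b) * e else 0)"
    using b_mem inv by (intro sum.cong refl) (simp add: minor_inverse_def)
  also have "\<dots> = A (i, b)"
    using b_mem minor_inverse_finite[OF inv] mult_e[OF \<open>A (i, b) \<in> K\<close>] by simp
  finally show ?thesis by (simp add: schur_entry_def)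
qed

context
  fixes r n A I J C i j s
  assumes inv: "minor_inverse r n A I J C" and A_mats: "A \<in> mats n"
    and i_index: "i \<in> {r..<n} - (I \<union> J)" and j_index: "j \<in> {r..<n} - (I \<union> J)" and "i \<noteq> j"
    and s_K: "s \<in> K" "s * schur_entry A I J C i j = e"
begin

lemma border_entries_K: "a \<in> insert i I \<Longrightarrow> b \<in> insert j J \<Longrightarrow> A (a, b) \<in> K"
  using inv i_index j_index A_mats by (intro mats_K) (auto simp: minor_inverse_def)



lemma border_row_K: "p \<in> insert i I \<Longrightarrow> border_row A J C i s p \<in> K"
  using s_K(1) border_entries_K minor_inverse_K[OF inv]
  by (auto simp: border_row_def intro!: mult_K sum_K)

lemma border_row_inverse:
  assumes "b \<in> insert j J"
  shows "(\<Sum>p\<in>insert i I. border_row A J C i s p * A (p, b)) = (if b = j then e else 0)"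
proof -
  have "i \<notin> I" "b \<in> J \<Longrightarrow> schur_entry A I J C i b = 0"
    using i_index by (auto intro: schur_entry_eq_0[OF inv] border_entries_K)
  then show ?thesis using assms s_K(2) j_index by (auto simp: border_row_mult[OF inv])
qed

lemma border_inverse_mult:
  assumes k_mem: "k \<in> insert j J" and b_mem: "b \<in> insert j J"
  shows "(\<Sum>p\<in>insert i I. border_inverse A I J C i j s (k, p) * A (p, b)) = (if k = b then e else 0)"
proof (cases "k = j")
  case True
  then have "(\<Sum>p\<in>insert i I. border_inverse A I J C i j s (k, p) * A (p, b))
      = (\<Sum>p\<in>insert i I. border_row A J C i s p * A (p, b))"
    by (intro sum.cong refl) (auto simp: border_inverse_def)
  then show ?thesis using True border_row_inverse[OF b_mem] by auto
next
  case False
  then have k_in_J: "k \<in> J" using k_mem by simp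
  let ?z = "\<Sum>t\<in>I. C (k, t) * A (t, j)"
  have z_K: "?z \<in> K"
    using k_in_J border_entries_K minor_inverse_K[OF inv] by (auto intro!: sum_K mult_K)
  have "(\<Sum>p\<in>insert i I. border_inverse A I J C i j s (k, p) * A (p, b))
      = (\<Sum>p\<in>insert i I. (if p = i then 0 else C (k, p)) * A (p, b)
          - ?z * (border_row A J C i s p * A (p, b)))"
    using k_in_J False by (intro sum.cong refl) (auto simp: border_inverse_def algebra_simps)
  also have "\<dots> = (\<Sum>p\<in>insert i I. (if p = i then 0 else C (k, p)) * A (p, b))
      - ?z * (if b = j then e else 0)"
    by (simp only: sum_subtractf sum_distrib_left[symmetric] border_row_inverse[OF b_mem])
  also have "(\<Sum>p\<in>insert i I. (if p = i then 0 else C (k, p)) * A (p, b))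
      = (\<Sum>p\<in>I. C (k, p) * A (p, b))"
    using minor_inverse_finite[OF inv] i_index by (auto intro!: sum.cong)
  also have "\<dots> - ?z * (if b = j then e else 0) = (if k = b then e else 0)"
    using False k_in_J b_mem inv mult_e[OF z_K] by (auto simp: minor_inverse_def)
  finally show ?thesis .
qed

lemma minor_inverse_border:
  "minor_inverse r n A (insert i I) (insert j J) (border_inverse A I J C i j s)"
proof -
  have "(\<Sum>t\<in>I. C (k, t) * A (t, j)) \<in> K" if "k \<in> J" for k
    using that border_entries_K minor_inverse_K[OF inv] by (auto intro!: sum_K mult_K)
  then have "border_inverse A I J C i j s \<in> insert j J \<times> insert i I \<rightarrow>\<^sub>E K"
    using border_row_K minor_inverse_K[OF inv] by (auto simp: border_inverse_def)
  then show ?thesis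
    using inv i_index j_index \<open>i \<noteq> j\<close> border_inverse_mult minor_inverse_finite[OF inv]
    by (auto simp: minor_inverse_def)
qed

end

definition schur_vanishes ::
    "nat \<Rightarrow> nat \<Rightarrow> (nat \<times> nat \<Rightarrow> 'u) \<Rightarrow> nat set \<Rightarrow> nat set \<Rightarrow> (nat \<times> nat \<Rightarrow> 'u) \<Rightarrow> bool" where
  "schur_vanishes r n A I J C \<longleftrightarrow> (\<forall>i\<in>{r..<n} - (I \<union> J). \<forall>j\<in>{r..<n} - (I \<union> J). i \<noteq> j \<longrightarrow>
     schur_entry A I J C i j = 0)"

lemma schur_vanishes_or_extend:
  assumes inv: "minor_inverse r n A I J C" and A_mats: "A \<in> mats n"
  shows "schur_vanishes r n A I J C \<or>
    (\<exists>I' J' C'. minor_inverse r n A I' J' C' \<and> card J' = Suc (card J))"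
proof (cases "schur_vanishes r n A I J C")
  case False
  then obtain i j where i_index: "i \<in> {r..<n} - (I \<union> J)"
    and j_index: "j \<in> {r..<n} - (I \<union> J)" and "i \<noteq> j"
    and "schur_entry A I J C i j \<noteq> 0"
    unfolding schur_vanishes_def by blast
  moreover have "schur_entry A I J C i j \<in> K"
    using inv A_mats i_index j_index
    by (auto simp: minor_inverse_def schur_entry_def subset_iff intro!: diff_K sum_K mult_K)
  ultimately obtain s where "s \<in> K" "s * schur_entry A I J C i j = e"
    using inverse_ex by blast
  from minor_inverse_border[OF inv A_mats i_index j_index \<open>i \<noteq> j\<close> this]
  have "minor_inverse r n A (insert i I) (insert j J) (border_inverse A I J C i j s)" .
  moreover have "card (insert j J) = Suc (card J)"
    using j_index minor_inverse_finite[OF inv] by simp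
  ultimately show ?thesis by blast
qed simp

definition minor_size :: "nat \<Rightarrow> nat \<Rightarrow> (nat \<times> nat \<Rightarrow> 'u) \<Rightarrow> nat" where
  "minor_size r n A
    = (GREATEST t. 4 * t \<le> n - r \<and> (\<exists>I J C. minor_inverse r n A I J C \<and> card J = t))"

lemma maximal_minor:
  assumes A_mats: "A \<in> mats n"
  obtains I J C where "minor_inverse r n A I J C" "card J = minor_size r n A"
    "4 * minor_size r n A \<le> n - r"
    "n - r < 4 * minor_size r n A + 4 \<or> schur_vanishes r n A I J C"
proof -
  define P where "P t \<longleftrightarrow> 4 * t \<le> n - r \<and> (\<exists>I J C. minor_inverse r n A I J C \<and> card J = t)" for t
  have bound: "t \<le> n" if "P t" for t using that by (auto simp: P_def)
  have size: "minor_size r n A = Greatest P" by (simp only: minor_size_def P_def[abs_def])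
  have "P 0"
    unfolding P_def minor_inverse_def by (intro conjI exI[of _ "{}"] exI[of _ "\<lambda>_. undefined"]) auto
  then have "P (minor_size r n A)" unfolding size using bound by (rule GreatestI_nat)
  then obtain I J C where inv: "minor_inverse r n A I J C" "card J = minor_size r n A"
    "4 * minor_size r n A \<le> n - r"
    by (auto simp: P_def)
  have "\<not> P (Suc (minor_size r n A))"
    unfolding size using Greatest_le_nat[of P "Suc (Greatest P)"] bound by auto
  then have "n - r < 4 * minor_size r n A + 4 \<or> schur_vanishes r n A I J C"
    using schur_vanishes_or_extend[OF inv(1) A_mats] inv(2) by (auto simp: P_def)
  with inv show thesis by (rule that)
qed

text \<open>If the Schur complement vanishes off the diagonal, these entries determine the matrix.\<close>

definition free_entries :: "nat \<Rightarrow> nat \<Rightarrow> nat set \<Rightarrow> nat set \<Rightarrow> (nat \<times> nat) set" where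
  "free_entries r n I J = {..<n} \<times> {..<n} -
    {(i, j). i \<in> {r..<n} - (I \<union> J) \<and> j \<in> {r..<n} - (I \<union> J) \<and> i \<noteq> j}"

lemma finite_free_entries [simp]: "finite (free_entries r n I J)"
  by (simp add: free_entries_def)

lemma schur_vanishes_eqI:
  assumes A_mats: "A \<in> mats n" "schur_vanishes r n A I J C"
    and B_mats: "B \<in> mats n" "schur_vanishes r n B I J C"
    and index_subsets: "I \<subseteq> {r..<n}" "J \<subseteq> {r..<n}"
    and eq: "\<And>x. x \<in> free_entries r n I J \<Longrightarrow> A x = B x"
  shows "A = B"
proof (rule PiE_ext[OF A_mats(1)[unfolded mats_def] B_mats(1)[unfolded mats_def]])
  fix x :: "nat \<times> nat" assume "x \<in> {..<n} \<times> {..<n}"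
  then obtain i j where x_eq: "x = (i, j)" "i < n" "j < n" by auto
  show "A x = B x"
  proof (cases "x \<in> free_entries r n I J")
    case False
    then have ij: "i \<in> {r..<n} - (I \<union> J)" "j \<in> {r..<n} - (I \<union> J)" "i \<noteq> j"
      using x_eq by (auto simp: free_entries_def)
    have "(i, k) \<in> free_entries r n I J" if "k \<in> J" for k
      using ij that index_subsets by (auto simp: free_entries_def)
    moreover have "(p, j) \<in> free_entries r n I J" if "p \<in> I" for p
      using ij that index_subsets by (auto simp: free_entries_def)
    ultimately have "(\<Sum>k\<in>J. A (i, k) * (\<Sum>p\<in>I. C (k, p) * A (p, j)))
        = (\<Sum>k\<in>J. B (i, k) * (\<Sum>p\<in>I. C (k, p) * B (p, j)))"
      by (intro sum.cong refl arg_cong2[where f = "(*)"]) (auto intro: eq)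
    moreover have "schur_entry A I J C i j = 0" "schur_entry B I J C i j = 0"
      using A_mats(2) B_mats(2) ij by (auto simp: schur_vanishes_def)
    ultimately show ?thesis by (simp add: schur_entry_def x_eq)
  qed (rule eq)
qed

lemma card_free_entries:
  assumes "I \<subseteq> {r..<n}" "J \<subseteq> {r..<n}" "card I = t" "card J = t"
  shows "card (free_entries r n I J) \<le> n * (2 * r + 4 * t + 1)"
proof -
  define M where "M = {..<n} - ({r..<n} - (I \<union> J))"
  have fin: "finite I" "finite J" using assms(1,2) by (auto dest: finite_subset)
  have "card M \<le> card ({..<r} \<union> (I \<union> J))"
    using fin by (intro card_mono) (auto simp: M_def)
  also have "\<dots> \<le> r + (t + t)" using assms(3,4)
    by (metis card_Un_le card_lessThan add_left_mono order.trans)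
  finally have card_M: "card M \<le> r + 2 * t" by simp
  have "free_entries r n I J \<subseteq> M \<times> {..<n} \<union> {..<n} \<times> M \<union> (\<lambda>i. (i, i)) ` {..<n}"
    by (auto simp: free_entries_def M_def)
  then have "card (free_entries r n I J) \<le> card (M \<times> {..<n} \<union> {..<n} \<times> M \<union> (\<lambda>i. (i, i)) ` {..<n})"
    by (intro card_mono) (auto simp: M_def)
  also have "\<dots> \<le> card M * n + n * card M + n"
    by (intro order.trans[OF card_Un_le] add_mono)
      (auto simp: card_cartesian_product intro: order.trans[OF card_image_le])
  also have "\<dots> \<le> (r + 2 * t) * n + n * (r + 2 * t) + n"
    using card_M by (intro add_mono mult_mono) auto
  finally show ?thesis by (simp add: algebra_simps)
qed

lemma card_schur_vanishes:
  assumes index_subsets: "I \<subseteq> {r..<n}" "J \<subseteq> {r..<n}" "card I = t" "card J = t"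
  shows "card {A \<in> mats n. schur_vanishes r n A I J C} \<le> q ^ (n * (2 * r + 4 * t + 1))"
proof -
  let ?X = "{A \<in> mats n. schur_vanishes r n A I J C}" and ?S = "free_entries r n I J"
  have "inj_on (\<lambda>A. restrict A ?S) ?X"
  proof (rule inj_onI)
    fix A B assume "A \<in> ?X" "B \<in> ?X" and eq: "restrict A ?S = restrict B ?S"
    moreover have "A x = B x" if "x \<in> ?S" for x using eq that by (metis restrict_apply')
    ultimately show "A = B" using schur_vanishes_eqI[OF _ _ _ _ index_subsets(1,2)] by blast
  qed
  moreover have "(\<lambda>A. restrict A ?S) ` ?X \<subseteq> ?S \<rightarrow>\<^sub>E K"
    by (rule image_subsetI) (auto simp: free_entries_def)
  ultimately have "card ?X \<le> card (?S \<rightarrow>\<^sub>E K)"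
    by (rule card_inj_on_le) (simp add: finite_PiE)
  also have "\<dots> \<le> q ^ (n * (2 * r + 4 * t + 1))"
    unfolding card_funcset_K[OF finite_free_entries]
    using index_subsets by (intro q_power_mono card_free_entries)
  finally show ?thesis .
qed

definition minor_data :: "nat \<Rightarrow> nat \<Rightarrow> nat \<Rightarrow> ((nat set \<times> nat set) \<times> (nat \<times> nat \<Rightarrow> 'u)) set" where
  "minor_data r n t =
    (SIGMA IJ : {IJ \<in> Pow {r..<n} \<times> Pow {r..<n}. card (fst IJ) = t \<and> card (snd IJ) = t}.
      snd IJ \<times> fst IJ \<rightarrow>\<^sub>E K)"

lemma card_minor_data:
  assumes "t \<le> n"
  shows "finite (minor_data r n t)" "card (minor_data r n t) \<le> q ^ (n * (t + 2))"
proof -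
  let ?P = "{IJ \<in> Pow {r..<n} \<times> Pow {r..<n}. card (fst IJ) = t \<and> card (snd IJ) = t}"
  have sub: "?P \<subseteq> Pow {r..<n} \<times> Pow {r..<n}" by auto
  then have fin: "finite ?P" by (rule finite_subset) simp
  have fin_fiber: "finite (snd IJ \<times> fst IJ)" if "IJ \<in> ?P" for IJ
    using that by (intro finite_cartesian_product) (auto dest: finite_subset)
  have fin_funcset: "finite (snd IJ \<times> fst IJ \<rightarrow>\<^sub>E K)" if "IJ \<in> ?P" for IJ
    using fin_fiber[OF that] by (rule finite_PiE) simp
  then show "finite (minor_data r n t)"
    unfolding minor_data_def using fin by (intro finite_SigmaI)
  have "card (minor_data r n t) = (\<Sum>IJ\<in>?P. card (snd IJ \<times> fst IJ \<rightarrow>\<^sub>E K))"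
    unfolding minor_data_def using fin fin_funcset by (intro card_SigmaI ballI)
  also have "\<dots> = (\<Sum>IJ\<in>?P. q ^ (t * t))"
    using fin_fiber by (intro sum.cong refl) (auto simp: card_funcset_K card_cartesian_product)
  also have "\<dots> = card ?P * q ^ (t * t)" by simp
  also have "\<dots> \<le> (q ^ n * q ^ n) * q ^ (n * t)"
  proof (intro mult_mono q_power_mono)
    have "card ?P \<le> 2 ^ (n - r) * 2 ^ (n - r)"
      using card_mono[OF _ sub] by (simp add: card_cartesian_product card_Pow)
    also have "\<dots> \<le> q ^ n * q ^ n"
    proof -
      have "2 ^ (n - r) \<le> q ^ (n - r)" using q_ge_2 by (rule power_mono) simp
      also have "\<dots> \<le> q ^ n" by (rule q_power_mono) simp
      finally show ?thesis by (intro mult_mono) auto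
    qed
    finally show "card ?P \<le> q ^ n * q ^ n" .
  qed (use assms in auto)
  also have "\<dots> = q ^ (n * (t + 2))" by (simp add: algebra_simps flip: power_add)
  finally show "card (minor_data r n t) \<le> q ^ (n * (t + 2))" .
qed

lemma card_minor_size: "card {A \<in> mats n. minor_size r n A = t} \<le> q ^ (n * (2 * r + 5 * t + 3))"
proof (cases "n - r < 4 * t + 4 \<or> n < t")
  case True
  have "card {A \<in> mats n. minor_size r n A = t} \<le> card (mats n)" by (intro card_mono) auto
  also have "\<dots> \<le> q ^ (n * (2 * r + 5 * t + 3))"
    unfolding card_mats using True by (intro q_power_mono mult_left_mono) auto
  finally show ?thesis .
next
  case False
  let ?X = "\<lambda>((I, J), C). {A \<in> mats n. schur_vanishes r n A I J C}"
  have "{A \<in> mats n. minor_size r n A = t} \<subseteq> (\<Union>x\<in>minor_data r n t. ?X x)"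
  proof
    fix A assume "A \<in> {A \<in> mats n. minor_size r n A = t}"
    then have A_mats: "A \<in> mats n" "minor_size r n A = t" by auto
    obtain I J C where "minor_inverse r n A I J C" "card J = t" "schur_vanishes r n A I J C"
      using maximal_minor[OF A_mats(1), of r] False A_mats(2) by (metis (no_types, lifting))
    then show "A \<in> (\<Union>x\<in>minor_data r n t. ?X x)"
      using A_mats by (auto simp: minor_inverse_def minor_data_def intro!: bexI[of _ "((I, J), C)"])
  qed
  then have "card {A \<in> mats n. minor_size r n A = t} \<le> card (\<Union>x\<in>minor_data r n t. ?X x)"
    using card_minor_data(1)[of t n r] False by (intro card_mono) auto
  also have "\<dots> \<le> (\<Sum>x\<in>minor_data r n t. card (?X x))"
    using card_minor_data(1) False by (intro card_UN_le) auto
  also have "\<dots> \<le> (\<Sum>x\<in>minor_data r n t. q ^ (n * (2 * r + 4 * t + 1)))"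
  proof (rule sum_mono)
    fix x assume "x \<in> minor_data r n t"
    then obtain I J C where "x = ((I, J), C)" "I \<subseteq> {r..<n}" "J \<subseteq> {r..<n}" "card I = t" "card J = t"
      by (auto simp: minor_data_def)
    then show "card (?X x) \<le> q ^ (n * (2 * r + 4 * t + 1))" using card_schur_vanishes by simp
  qed
  also have "\<dots> = card (minor_data r n t) * q ^ (n * (2 * r + 4 * t + 1))" by simp
  also have "\<dots> \<le> q ^ (n * (t + 2)) * q ^ (n * (2 * r + 4 * t + 1))"
    using card_minor_data(2) False by (intro mult_right_mono) auto
  also have "\<dots> = q ^ (n * (2 * r + 5 * t + 3))" by (simp add: algebra_simps flip: power_add)
  finally show ?thesis .
qed

subsection \<open>The expected number of adjoints\<close>

lemma sum_minor_size:
  "(\<Sum>A\<in>mats n. 1 / real q ^ (5 * n * minor_size r n A)) \<le> real (n + 1) * real q ^ (n * (2 * r + 3))"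
proof -
  have q_pos: "real q > 0" using q_ge_2 by simp
  have "minor_size r n A \<in> {..n}" if "A \<in> mats n" for A
    by (rule maximal_minor[OF that, of r]) auto
  then have "(\<Sum>A\<in>mats n. 1 / real q ^ (5 * n * minor_size r n A))
      = (\<Sum>t\<in>{..n}. \<Sum>A\<in>{A \<in> mats n. minor_size r n A = t}. 1 / real q ^ (5 * n * minor_size r n A))"
    by (intro sum.group[symmetric]) auto
  also have "\<dots> = (\<Sum>t\<in>{..n}. card {A \<in> mats n. minor_size r n A = t} * (1 / real q ^ (5 * n * t)))"
    by (intro sum.cong refl) simp
  also have "\<dots> \<le> (\<Sum>t\<in>{..n}. real q ^ (n * (2 * r + 3)))"
  proof (intro sum_mono)
    fix t
    have "real (card {A \<in> mats n. minor_size r n A = t}) \<le> real (q ^ (n * (2 * r + 5 * t + 3)))"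
      using card_minor_size by (rule of_nat_mono)
    also have "\<dots> = real q ^ (n * (2 * r + 3)) * real q ^ (5 * n * t)"
      unfolding of_nat_power power_add[symmetric] by (simp add: algebra_simps)
    finally show "card {A \<in> mats n. minor_size r n A = t} * (1 / real q ^ (5 * n * t))
        \<le> real q ^ (n * (2 * r + 3))"
      using q_pos by (simp add: field_simps)
  qed
  finally show ?thesis by simp
qed

lemma card_cubics_with_adjoint_minor_size:
  assumes r_ge: "40 \<le> r" "2 * r \<le> n" and A_mats: "A \<in> mats n"
  shows "card (cubics_with_adjoint n r A D) * q ^ (10 * n * minor_size r n A) \<le> card (cubics n)"
proof -
  define t where "t = minor_size r n A"
  obtain I J C where inv: "minor_inverse r n A I J C" and card_J: "card J = t" "4 * t \<le> n - r"
    using maximal_minor[OF A_mats, of r] by (metis t_def)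
  then have "I \<union> J \<subseteq> {r..<n}" "I \<inter> J = {}" "card I = t"
    by (auto simp: minor_inverse_def)
  then have "card ({r..<n} - (I \<union> J)) = n - r - 2 * t"
    using card_J minor_inverse_finite[OF inv]
    by (subst card_Diff_subset) (auto simp: card_Un_disjoint)
  moreover have "10 * n * t \<le> r * (t * (n - r - 2 * t))"
  proof -
    have "10 * n \<le> 40 * (n - r - 2 * t)" using card_J(2) r_ge(2) by simp
    also have "\<dots> \<le> r * (n - r - 2 * t)" using r_ge(1) by (rule mult_right_mono) simp
    finally have "t * (10 * n) \<le> t * (r * (n - r - 2 * t))" by (rule mult_left_mono) simp
    then show ?thesis by (simp add: mult_ac)
  qed
  ultimately have "q ^ (10 * n * t) \<le> q ^ (r * (card J * card ({r..<n} - (I \<union> J))))"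
    unfolding card_J(1) by (intro q_power_mono) simp
  then have "card (cubics_with_adjoint n r A D) * q ^ (10 * n * t)
      \<le> card (cubics_with_adjoint n r A D) * q ^ (r * (card J * card ({r..<n} - (I \<union> J))))"
    by (rule mult_left_mono) simp
  also have "\<dots> \<le> card (cubics n)"
    using r_ge by (intro card_cubics_with_adjoint[OF inv]) auto
  finally show ?thesis by (simp add: t_def)
qed

lemma card_cubics_with_adjoint_le:
  assumes r_ge: "40 \<le> r" "2 * r \<le> n" and AD: "A \<in> mats n" "D \<in> mats n"
  shows "real (card (cubics_with_adjoint n r A D)) \<le> card (cubics n) *
    (1 / real q ^ (5 * n * minor_size r n A)) * (1 / real q ^ (5 * n * minor_size r n (transp D)))"
proof -
  let ?H = "cubics_with_adjoint n r A D"
  let ?a = "5 * n * minor_size r n A" and ?b = "5 * n * minor_size r n (transp D)"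
  have "card ?H * q ^ (2 * ?a) \<le> card (cubics n)"
    using card_cubics_with_adjoint_minor_size[OF r_ge AD(1), of D] by (simp add: mult.assoc)
  moreover have "card ?H * q ^ (2 * ?b) \<le> card (cubics n)"
    using card_cubics_with_adjoint_minor_size[OF r_ge transp_mats[OF AD(2)], of "transp A"]
    by (simp add: mult.assoc cubics_with_adjoint_transp)
  moreover have "q ^ (?a + ?b) \<le> q ^ (2 * ?a) \<or> q ^ (?a + ?b) \<le> q ^ (2 * ?b)"
    using q_power_mono[of "?a + ?b" "2 * ?a"] q_power_mono[of "?a + ?b" "2 * ?b"] by linarith
  ultimately have "card ?H * q ^ (?a + ?b) \<le> card (cubics n)"
    by (meson mult_left_mono order.trans zero_le)
  then have "real (card ?H * q ^ (?a + ?b)) \<le> real (card (cubics n))" by (rule of_nat_mono)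
  then show ?thesis using q_ge_2 by (simp add: field_simps power_add)
qed

lemma sum_card_adjoints_swap:
  "(\<Sum>c\<in>cubics n. card (adjoints n r c))
    = (\<Sum>A\<in>mats n. \<Sum>D\<in>mats n. card (cubics_with_adjoint n r A D))"
proof -
  have "(\<Sum>c\<in>cubics n. card (adjoints n r c))
      = (\<Sum>c\<in>cubics n. \<Sum>AD\<in>mats n \<times> mats n. if AD \<in> adjoints n r c then 1 else 0)"
    by (intro sum.cong refl, subst sum.inter_filter[symmetric])
      (auto simp: adjoints_def intro!: arg_cong[where f = card])
  also have "\<dots> = (\<Sum>AD\<in>mats n \<times> mats n. card (cubics_with_adjoint n r (fst AD) (snd AD)))"
    unfolding cubics_with_adjoint_def
    by (subst sum.swap, intro sum.cong refl, subst sum.inter_filter[symmetric]) auto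
  also have "\<dots> = (\<Sum>A\<in>mats n. \<Sum>D\<in>mats n. card (cubics_with_adjoint n r A D))"
    by (simp add: sum.cartesian_product case_prod_unfold)
  finally show ?thesis .
qed

lemma sum_card_adjoints:
  assumes r_ge: "40 \<le> r" "2 * r \<le> n"
  shows "(\<Sum>c\<in>cubics n. card (adjoints n r c)) \<le> card (cubics n) * q ^ ((4 * r + 8) * n)"
proof -
  let ?w = "\<lambda>A. 1 / real q ^ (5 * n * minor_size r n A)"
  let ?b = "real (n + 1) * real q ^ (n * (2 * r + 3))"
  have "real (\<Sum>c\<in>cubics n. card (adjoints n r c))
      = (\<Sum>A\<in>mats n. \<Sum>D\<in>mats n. real (card (cubics_with_adjoint n r A D)))"
    by (simp add: sum_card_adjoints_swap)
  also have "\<dots> \<le> (\<Sum>A\<in>mats n. \<Sum>D\<in>mats n. card (cubics n) * ?w A * ?w (transp D))"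
    by (intro sum_mono card_cubics_with_adjoint_le[OF r_ge])
  also have "\<dots> = card (cubics n) * (\<Sum>A\<in>mats n. ?w A) * (\<Sum>D\<in>mats n. ?w (transp D))"
    unfolding sum_distrib_left sum_distrib_right by (rule sum.swap)
  also have "(\<Sum>D\<in>mats n. ?w (transp D)) = (\<Sum>D\<in>mats n. ?w D)"
    by (intro sum.reindex_bij_witness[of _ transp transp]) (auto simp: transp_mats)
  also have "card (cubics n) * (\<Sum>A\<in>mats n. ?w A) * (\<Sum>D\<in>mats n. ?w D) \<le> card (cubics n) * ?b * ?b"
    using sum_minor_size[of n r]
    by (intro mult_mono mult_left_mono) (auto intro!: sum_nonneg mult_nonneg_nonneg)
  also have "\<dots> \<le> card (cubics n) * (real q ^ n * real q ^ (n * (2 * r + 3)))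
      * (real q ^ n * real q ^ (n * (2 * r + 3)))"
  proof -
    have "n + 1 \<le> 2 ^ n" by (metis Suc_eq_plus1 Suc_leI less_exp)
    also have "\<dots> \<le> q ^ n" using q_ge_2 by (intro power_mono) auto
    finally have "real (n + 1) \<le> real (q ^ n)" by (rule of_nat_mono)
    then show ?thesis by (intro mult_mono mult_left_mono) auto
  qed
  also have "\<dots> = card (cubics n) * real q ^ (n + n * (2 * r + 3) + (n + n * (2 * r + 3)))"
    by (simp only: power_add mult.assoc)
  also have "n + n * (2 * r + 3) + (n + n * (2 * r + 3)) = (4 * r + 8) * n"
    by (simp add: algebra_simps)
  also have "card (cubics n) * real q ^ ((4 * r + 8) * n)
      = real (card (cubics n) * q ^ ((4 * r + 8) * n))"
    by simp
  finally show ?thesis by linarith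
qed

lemma card_many_adjoints:
  assumes "40 \<le> r" "2 * r \<le> n"
  shows "card {c \<in> cubics n. card (adjoints n r c) > q ^ ((4 * r + 9) * n)} * q ^ n
      \<le> card (cubics n)"
proof -
  define B where "B = {c \<in> cubics n. card (adjoints n r c) > q ^ ((4 * r + 9) * n)}"
  have "(4 * r + 9) * n = n + (4 * r + 8) * n" by (simp add: algebra_simps)
  then have "card B * q ^ n * q ^ ((4 * r + 8) * n) = card B * q ^ ((4 * r + 9) * n)"
    by (simp only: power_add mult.assoc)
  also have "\<dots> = (\<Sum>c\<in>B. q ^ ((4 * r + 9) * n))" by simp
  also have "\<dots> \<le> (\<Sum>c\<in>B. card (adjoints n r c))" by (intro sum_mono) (auto simp: B_def)
  also have "\<dots> \<le> (\<Sum>c\<in>cubics n. card (adjoints n r c))"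
    by (intro sum_mono2) (auto simp: B_def)
  also have "\<dots> \<le> card (cubics n) * q ^ ((4 * r + 8) * n)" by (rule sum_card_adjoints[OF assms])
  finally have "card B * q ^ n \<le> card (cubics n)" using q_ge_2 by simp
  then show ?thesis by (simp add: B_def)
qed

end

section \<open>The program\<close>

definition wp :: "program \<Rightarrow> val list \<Rightarrow> expr \<Rightarrow> (val \<Rightarrow> nat \<Rightarrow> bool) \<Rightarrow> bool" where
  "wp P xs ex Q \<longleftrightarrow> (\<exists>v k. evaluates P xs ex v k \<and> Q v k)"

definition wp_list :: "program \<Rightarrow> val list \<Rightarrow> expr list \<Rightarrow> (val list \<Rightarrow> nat \<Rightarrow> bool) \<Rightarrow> bool" where
  "wp_list P xs es Q \<longleftrightarrow> (\<exists>vs k. evaluates_list P xs es vs k \<and> Q vs k)"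

definition wp_call :: "program \<Rightarrow> nat \<Rightarrow> val list \<Rightarrow> (val \<Rightarrow> nat \<Rightarrow> bool) \<Rightarrow> bool" where
  "wp_call P i xs Q \<longleftrightarrow> i < length P \<and> wp P xs (P ! i) Q"

lemma wp_simps [simp]:
  "wp P xs (Var i) Q \<longleftrightarrow> i < length xs \<and> Q (xs ! i) 1"
  "wp P xs Empty Q \<longleftrightarrow> Q NIL 1"
  "wp P xs (Pair a b) Q \<longleftrightarrow> wp P xs a (\<lambda>v k. wp P xs b (\<lambda>w l. Q (CONS v w) (1 + k + l)))"
  "wp P xs (Hd a) Q \<longleftrightarrow> wp P xs a (\<lambda>v k. Q (hd_val v) (1 + k))"
  "wp P xs (Tl a) Q \<longleftrightarrow> wp P xs a (\<lambda>v k. Q (tl_val v) (1 + k))"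
  "wp P xs (Cond c a b) Q \<longleftrightarrow> wp P xs c (\<lambda>v k. if v = NIL then wp P xs b (\<lambda>w l. Q w (1 + k + l))
     else wp P xs a (\<lambda>w l. Q w (1 + k + l)))"
  "wp P xs (Call i es) Q \<longleftrightarrow> wp_list P xs es (\<lambda>vs k. wp_call P i vs (\<lambda>v l. Q v (1 + k + l)))"
  "wp_list P xs [] R \<longleftrightarrow> R [] 0"
  "wp_list P xs (a # es) R \<longleftrightarrow> wp P xs a (\<lambda>v k. wp_list P xs es (\<lambda>vs l. R (v # vs) (k + l)))"
  unfolding wp_def wp_list_def wp_call_def
  by (fastforce intro: evaluates_evaluates_list.intros
      elim: evaluates_VarE evaluates_EmptyE evaluates_PairE evaluates_HdE evaluates_TlE
        evaluates_CondE evaluates_CallE evaluates_NilE evaluates_ConsE split: if_splits)+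

fun unary :: "nat \<Rightarrow> expr" where
  "unary 0 = Empty"
| "unary (Suc k) = Pair Empty (unary k)"

lemma wp_unary [simp]: "wp P xs (unary k) Q \<longleftrightarrow> Q (enc_nat k) (2 * k + 1)"
  by (induction k arbitrary: Q) simp_all

text \<open>The numbers \<open>r\<close> and \<open>4 r + 9\<close> of the introduction.\<close>

definition num_images :: nat where "num_images = 40"
definition rank_factor :: nat where "rank_factor = 169"

abbreviation (input) "fn_main \<equiv> 0 :: nat"
abbreviation (input) "fn_elements \<equiv> 1 :: nat"
abbreviation (input) "fn_find_zero \<equiv> 2 :: nat"
abbreviation (input) "fn_find_one \<equiv> 3 :: nat"
abbreviation (input) "fn_search \<equiv> 4 :: nat"
abbreviation (input) "fn_equal \<equiv> 5 :: nat"
abbreviation (input) "fn_nth \<equiv> 6 :: nat"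
abbreviation (input) "fn_find \<equiv> 7 :: nat"
abbreviation (input) "fn_append \<equiv> 8 :: nat"
abbreviation (input) "fn_drop \<equiv> 9 :: nat"
abbreviation (input) "fn_times \<equiv> 10 :: nat"
abbreviation (input) "fn_extend_one \<equiv> 11 :: nat"
abbreviation (input) "fn_extend \<equiv> 12 :: nat"
abbreviation (input) "fn_tuples \<equiv> 13 :: nat"
abbreviation (input) "fn_cons_all \<equiv> 14 :: nat"
abbreviation (input) "fn_zeros \<equiv> 15 :: nat"
abbreviation (input) "fn_units \<equiv> 16 :: nat"
abbreviation (input) "fn_add \<equiv> 17 :: nat"
abbreviation (input) "fn_scale \<equiv> 18 :: nat"
abbreviation (input) "fn_dot \<equiv> 19 :: nat"
abbreviation (input) "fn_pairs \<equiv> 20 :: nat"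
abbreviation (input) "fn_triples \<equiv> 21 :: nat"
abbreviation (input) "fn_value \<equiv> 22 :: nat"
abbreviation (input) "fn_polar \<equiv> 23 :: nat"
abbreviation (input) "fn_polar_row \<equiv> 24 :: nat"
abbreviation (input) "fn_outer \<equiv> 25 :: nat"
abbreviation (input) "fn_row_equations \<equiv> 26 :: nat"
abbreviation (input) "fn_image_equations \<equiv> 27 :: nat"
abbreviation (input) "fn_equations \<equiv> 28 :: nat"
abbreviation (input) "fn_eliminate \<equiv> 29 :: nat"
abbreviation (input) "fn_restrict \<equiv> 30 :: nat"
abbreviation (input) "fn_kernel \<equiv> 31 :: nat"
abbreviation (input) "fn_lincomb \<equiv> 32 :: nat"
abbreviation (input) "fn_apply \<equiv> 33 :: nat"
abbreviation (input) "fn_test_point \<equiv> 34 :: nat"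
abbreviation (input) "fn_test_points \<equiv> 35 :: nat"
abbreviation (input) "fn_test_combinations \<equiv> 36 :: nat"
abbreviation (input) "fn_test_system \<equiv> 37 :: nat"
abbreviation (input) "fn_test_images \<equiv> 38 :: nat"

text \<open>Most functions receive as argument \<open>0\<close> the list of the field elements, the two tables and
  the names of zero and one.\<close>

abbreviation (input) "elements_of E \<equiv> Hd E"
abbreviation (input) "add_table_of E \<equiv> Hd (Tl E)"
abbreviation (input) "mult_table_of E \<equiv> Hd (Tl (Tl E))"
abbreviation (input) "zero_of E \<equiv> Hd (Tl (Tl (Tl E)))"
abbreviation (input) "one_of E \<equiv> Hd (Tl (Tl (Tl (Tl E))))"
abbreviation (input) "field_add E a b \<equiv> Call fn_nth [Call fn_nth [add_table_of E, a], b]"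
abbreviation (input) "field_mult E a b \<equiv> Call fn_nth [Call fn_nth [mult_table_of E, a], b]"
abbreviation (input) "field_neg E a \<equiv> Call fn_find [elements_of E, add_table_of E, a, zero_of E]"

definition body_main :: expr where
  "body_main =
    Call fn_find_zero [Var 0, Call fn_elements [Var 1], Var 2, Var 3, Var 4, Var 5]"

definition body_elements :: expr where
  "body_elements =
    Cond (Var 0) (Pair (Tl (Var 0)) (Call fn_elements [Tl (Var 0)])) Empty"

text \<open>The zero element is the solution of \<open>y + x = x\<close>, where \<open>x\<close> is the element named \<open>0\<close>.\<close>

definition body_find_zero :: expr where
  "body_find_zero =
    Call fn_find_one [Var 0, Var 1, Var 2, Var 3, Var 4, Var 5,
      Call fn_find [Var 1, Var 2, Empty, Empty]]"

text \<open>Either \<open>0\<close> or \<open>1\<close> is the name of a nonzero element \<open>x\<close>; the unit is the solution of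
  \<open>y x = x\<close>.\<close>

definition body_find_one :: expr where
  "body_find_one =
    Call fn_search [
      Pair (Var 1)
        (Pair (Var 2)
          (Pair (Var 3)
            (Pair (Var 6)
              (Pair
                (Call fn_find [Var 1, Var 3, Cond (Var 6) Empty (Pair Empty Empty),
                  Cond (Var 6) Empty (Pair Empty Empty)])
                Empty)))), Var 0, Var 4, Var 5]"

definition body_search :: expr where
  "body_search =
    Call fn_test_images [Var 0, Var 2, Var 3, Call fn_units [Var 0, Var 1],
      Call fn_tuples [Var 1, elements_of (Var 0)],
      Call fn_tuples [Call fn_times [unary rank_factor, Var 1], elements_of (Var 0)],
      Call fn_zeros [Var 0, Var 1],
      Call fn_tuples [unary num_images, Call fn_tuples [Var 1, elements_of (Var 0)]]]"

definition body_equal :: expr where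
  "body_equal =
    Cond (Var 0)
      (Cond (Var 1)
        (Cond (Call fn_equal [Hd (Var 0), Hd (Var 1)])
          (Call fn_equal [Tl (Var 0), Tl (Var 1)]) Empty)
        Empty)
      (Cond (Var 1) Empty (Pair Empty Empty))"

definition body_nth :: expr where
  "body_nth =
    Cond (Var 1) (Call fn_nth [Tl (Var 0), Tl (Var 1)]) (Hd (Var 0))"

definition body_find :: expr where
  "body_find =
    Cond (Var 0)
      (Cond
        (Call fn_equal [Call fn_nth [Call fn_nth [Var 1, Hd (Var 0)], Var 2], Var 3])
        (Hd (Var 0))
        (Call fn_find [Tl (Var 0), Var 1, Var 2, Var 3]))
      Empty"

definition body_append :: expr where
  "body_append =
    Cond (Var 0) (Pair (Hd (Var 0)) (Call fn_append [Tl (Var 0), Var 1])) (Var 1)"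

definition body_drop :: expr where
  "body_drop =
    Cond (Var 0) (Call fn_drop [Tl (Var 0), Tl (Var 1)]) (Var 1)"

definition body_times :: expr where
  "body_times =
    Cond (Var 0) (Call fn_append [Var 1, Call fn_times [Tl (Var 0), Var 1]]) Empty"

definition body_extend_one :: expr where
  "body_extend_one =
    Cond (Var 0) (Pair (Pair (Hd (Var 0)) (Var 1)) (Call fn_extend_one [Tl (Var 0), Var 1])) Empty"

definition body_extend :: expr where
  "body_extend =
    Cond (Var 1)
      (Call fn_append [Call fn_extend_one [Var 0, Hd (Var 1)], Call fn_extend [Var 0, Tl (Var 1)]])
      Empty"

definition body_tuples :: expr where
  "body_tuples =
    Cond (Var 0) (Call fn_extend [Var 1, Call fn_tuples [Tl (Var 0), Var 1]]) (Pair Empty Empty)"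

definition body_cons_all :: expr where
  "body_cons_all =
    Cond (Var 1) (Pair (Pair (Var 0) (Hd (Var 1))) (Call fn_cons_all [Var 0, Tl (Var 1)])) Empty"

definition body_zeros :: expr where
  "body_zeros =
    Cond (Var 1) (Pair (zero_of (Var 0)) (Call fn_zeros [Var 0, Tl (Var 1)])) Empty"

definition body_units :: expr where
  "body_units =
    Cond (Var 1)
      (Pair
        (Pair (one_of (Var 0)) (Call fn_zeros [Var 0, Tl (Var 1)]))
        (Call fn_cons_all [zero_of (Var 0), Call fn_units [Var 0, Tl (Var 1)]]))
      Empty"

definition body_add :: expr where
  "body_add =
    Cond (Var 1)
      (Cond (Var 2)
        (Pair
          (field_add (Var 0) (Hd (Var 1)) (Hd (Var 2)))
          (Call fn_add [Var 0, Tl (Var 1), Tl (Var 2)]))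
        Empty)
      Empty"

definition body_scale :: expr where
  "body_scale =
    Cond (Var 2)
      (Pair
        (field_mult (Var 0) (Var 1) (Hd (Var 2)))
        (Call fn_scale [Var 0, Var 1, Tl (Var 2)]))
      Empty"

definition body_dot :: expr where
  "body_dot =
    Cond (Var 1)
      (Cond (Var 2)
        (field_add (Var 0)
          (field_mult (Var 0) (Hd (Var 1)) (Hd (Var 2)))
          (Call fn_dot [Var 0, Tl (Var 1), Tl (Var 2)]))
        (zero_of (Var 0)))
      (zero_of (Var 0))"

definition body_pairs :: expr where
  "body_pairs =
    Cond (Var 1)
      (Call fn_append [Call fn_scale [Var 0, Hd (Var 1), Var 1], Call fn_pairs [Var 0, Tl (Var 1)]])
      Empty"

definition body_triples :: expr where
  "body_triples =
    Cond (Var 1)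
      (Call fn_append [Call fn_scale [Var 0, Hd (Var 1), Call fn_pairs [Var 0, Var 1]],
        Call fn_triples [Var 0, Tl (Var 1)]])
      Empty"

definition body_value :: expr where
  "body_value =
    Call fn_dot [Var 0, Var 1, Call fn_triples [Var 0, Var 2]]"

definition body_polar :: expr where
  "body_polar =
    field_add (Var 0)
      (field_add (Var 0)
        (field_add (Var 0)
          (Call fn_value [Var 0, Var 1,
            Call fn_add [Var 0, Call fn_add [Var 0, Var 2, Var 3], Var 4]])
          (Call fn_value [Var 0, Var 1, Var 2]))
        (field_add (Var 0)
          (Call fn_value [Var 0, Var 1, Var 3])
          (Call fn_value [Var 0, Var 1, Var 4])))
      (field_neg (Var 0)
        (field_add (Var 0)
          (field_add (Var 0)
            (Call fn_value [Var 0, Var 1, Call fn_add [Var 0, Var 2, Var 3]])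
            (Call fn_value [Var 0, Var 1, Call fn_add [Var 0, Var 2, Var 4]]))
          (Call fn_value [Var 0, Var 1, Call fn_add [Var 0, Var 3, Var 4]])))"

definition body_polar_row :: expr where
  "body_polar_row =
    Cond (Var 4)
      (Pair
        (Call fn_polar [Var 0, Var 1, Var 2, Var 3, Hd (Var 4)])
        (Call fn_polar_row [Var 0, Var 1, Var 2, Var 3, Tl (Var 4)]))
      Empty"

definition body_outer :: expr where
  "body_outer =
    Cond (Var 1)
      (Call fn_append [Call fn_scale [Var 0, Hd (Var 1), Var 2],
        Call fn_outer [Var 0, Tl (Var 1), Var 2]])
      Empty"

text \<open>The linear system has one equation for each vector \<open>w\<close> and each pair of unit vectors \<open>ej\<close>,
  \<open>ek\<close>.\<close>

definition body_row_equations :: expr where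
  "body_row_equations =
    Cond (Var 5)
      (Pair
        (Call fn_append [Call fn_outer [Var 0, Hd (Var 5), Var 4],
          Call fn_outer [Var 0, Var 3, Call fn_polar_row [Var 0, Var 1, Var 2, Hd (Var 5), Var 6]]])
        (Call fn_row_equations [Var 0, Var 1, Var 2, Var 3, Var 4, Tl (Var 5), Var 6]))
      Empty"

definition body_image_equations :: expr where
  "body_image_equations =
    Cond (Var 5)
      (Call fn_append [
        Call fn_row_equations [Var 0, Var 1, Var 3, Hd (Var 5),
          Call fn_polar_row [Var 0, Var 2, Var 4, Hd (Var 5), Var 6], Var 6, Var 6],
        Call fn_image_equations [Var 0, Var 1, Var 2, Var 3, Var 4, Tl (Var 5), Var 6]])
      Empty"

definition body_equations :: expr where
  "body_equations =
    Cond (Var 3)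
      (Cond (Var 4)
        (Call fn_append [
          Call fn_image_equations [Var 0, Var 1, Var 2, Hd (Var 3), Hd (Var 4), Var 5, Var 5],
          Call fn_equations [Var 0, Var 1, Var 2, Tl (Var 3), Tl (Var 4), Var 5]])
        Empty)
      Empty"

definition body_eliminate :: expr where
  "body_eliminate =
    Cond (Var 4)
      (Pair
        (Call fn_add [Var 0, Call fn_scale [Var 0, Var 3, Hd (Var 4)],
          Call fn_scale [Var 0, field_neg (Var 0) (Call fn_dot [Var 0, Var 1, Hd (Var 4)]),
            Var 2]])
        (Call fn_eliminate [Var 0, Var 1, Var 2, Var 3, Tl (Var 4)]))
      Empty"

definition body_restrict :: expr where
  "body_restrict =
    Cond (Var 2)
      (Cond
        (Call fn_equal [Call fn_dot [Var 0, Var 1, Hd (Var 2)], zero_of (Var 0)])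
        (Pair (Hd (Var 2)) (Call fn_restrict [Var 0, Var 1, Tl (Var 2)]))
        (Call fn_eliminate [Var 0, Var 1, Hd (Var 2), Call fn_dot [Var 0, Var 1, Hd (Var 2)],
          Tl (Var 2)]))
      Empty"

definition body_kernel :: expr where
  "body_kernel =
    Cond (Var 1)
      (Call fn_kernel [Var 0, Tl (Var 1), Call fn_restrict [Var 0, Hd (Var 1), Var 2]])
      (Var 2)"

definition body_lincomb :: expr where
  "body_lincomb =
    Cond (Var 1)
      (Cond (Var 2)
        (Call fn_lincomb [Var 0, Tl (Var 1), Tl (Var 2),
          Call fn_add [Var 0, Var 3, Call fn_scale [Var 0, Hd (Var 1), Hd (Var 2)]]])
        (Var 3))
      (Var 3)"

text \<open>The product of the matrix with columns stored consecutively in \<open>Var 2\<close> and the vector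
  \<open>Var 1\<close>; \<open>add\<close> truncates to the length of the accumulator \<open>Var 3\<close>, so that the columns need not
  be cut out.\<close>

definition body_apply :: expr where
  "body_apply =
    Cond (Var 1)
      (Call fn_apply [Var 0, Tl (Var 1), Call fn_drop [Var 3, Var 2],
        Call fn_add [Var 0, Var 3, Call fn_scale [Var 0, Hd (Var 1), Var 2]]])
      (Var 3)"

definition body_test_point :: expr where
  "body_test_point =
    Cond
      (Call fn_equal [Call fn_value [Var 0, Var 1, Var 3], Call fn_value [Var 0, Var 2, Var 4]])
      (Cond (Call fn_equal [Var 4, Var 5]) (Call fn_equal [Var 3, Var 5]) (Pair Empty Empty))
      Empty"

definition body_test_points :: expr where
  "body_test_points =
    Cond (Var 4)
      (Cond
        (Call fn_test_point [Var 0, Var 1, Var 2, Hd (Var 4),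
          Call fn_apply [Var 0, Hd (Var 4), Var 3, Var 5], Var 5])
        (Call fn_test_points [Var 0, Var 1, Var 2, Var 3, Tl (Var 4), Var 5])
        Empty)
      (Pair Empty Empty)"

definition body_test_combinations :: expr where
  "body_test_combinations =
    Cond (Var 5)
      (Cond
        (Call fn_test_points [Var 0, Var 1, Var 2,
          Call fn_lincomb [Var 0, Hd (Var 5), Var 6, Var 7], Var 3, Var 4])
        (Pair Empty Empty)
        (Call fn_test_combinations [Var 0, Var 1, Var 2, Var 3, Var 4, Tl (Var 5), Var 6, Var 7]))
      Empty"

definition body_test_system :: expr where
  "body_test_system =
    Call fn_test_combinations [Var 0, Var 1, Var 2, Var 3, Var 5, Var 4,
      Call fn_kernel [Var 0, Var 6, Call fn_units [Var 0, Hd (Var 6)]],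
      Call fn_zeros [Var 0, Hd (Var 6)]]"

definition body_test_images :: expr where
  "body_test_images =
    Cond (Var 7)
      (Cond
        (Call fn_test_system [Var 0, Var 1, Var 2, Var 4, Var 5, Var 6,
          Call fn_equations [Var 0, Var 1, Var 2, Var 3, Hd (Var 7), Var 3]])
        (Pair Empty Empty)
        (Call fn_test_images [Var 0, Var 1, Var 2, Var 3, Var 4, Var 5, Var 6, Tl (Var 7)]))
      Empty"

definition iso_program :: program where
  "iso_program =
   [body_main, body_elements, body_find_zero, body_find_one, body_search, body_equal, body_nth,
    body_find, body_append, body_drop, body_times, body_extend_one, body_extend, body_tuples,
    body_cons_all, body_zeros, body_units, body_add, body_scale, body_dot, body_pairs,
    body_triples, body_value, body_polar, body_polar_row, body_outer, body_row_equations,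
    body_image_equations, body_equations, body_eliminate, body_restrict, body_kernel,
    body_lincomb, body_apply, body_test_point, body_test_points, body_test_combinations,
    body_test_system, body_test_images]"

lemma length_iso_program: "length iso_program = 39"
  by (simp add: iso_program_def)

lemma nth_iso_program:
  "iso_program ! fn_main = body_main"
  "iso_program ! fn_elements = body_elements"
  "iso_program ! fn_find_zero = body_find_zero"
  "iso_program ! fn_find_one = body_find_one"
  "iso_program ! fn_search = body_search"
  "iso_program ! fn_equal = body_equal"
  "iso_program ! fn_nth = body_nth"
  "iso_program ! fn_find = body_find"
  "iso_program ! fn_append = body_append"
  "iso_program ! fn_drop = body_drop"
  "iso_program ! fn_times = body_times"
  "iso_program ! fn_extend_one = body_extend_one"
  "iso_program ! fn_extend = body_extend"
  "iso_program ! fn_tuples = body_tuples"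
  "iso_program ! fn_cons_all = body_cons_all"
  "iso_program ! fn_zeros = body_zeros"
  "iso_program ! fn_units = body_units"
  "iso_program ! fn_add = body_add"
  "iso_program ! fn_scale = body_scale"
  "iso_program ! fn_dot = body_dot"
  "iso_program ! fn_pairs = body_pairs"
  "iso_program ! fn_triples = body_triples"
  "iso_program ! fn_value = body_value"
  "iso_program ! fn_polar = body_polar"
  "iso_program ! fn_polar_row = body_polar_row"
  "iso_program ! fn_outer = body_outer"
  "iso_program ! fn_row_equations = body_row_equations"
  "iso_program ! fn_image_equations = body_image_equations"
  "iso_program ! fn_equations = body_equations"
  "iso_program ! fn_eliminate = body_eliminate"
  "iso_program ! fn_restrict = body_restrict"
  "iso_program ! fn_kernel = body_kernel"
  "iso_program ! fn_lincomb = body_lincomb"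
  "iso_program ! fn_apply = body_apply"
  "iso_program ! fn_test_point = body_test_point"
  "iso_program ! fn_test_points = body_test_points"
  "iso_program ! fn_test_combinations = body_test_combinations"
  "iso_program ! fn_test_system = body_test_system"
  "iso_program ! fn_test_images = body_test_images"
  by (simp_all add: iso_program_def)
definition computes :: "nat \<Rightarrow> val list \<Rightarrow> val \<Rightarrow> nat \<Rightarrow> bool" where
  "computes i vs v T \<longleftrightarrow> wp_call iso_program i vs (\<lambda>w k. w = v \<and> k \<le> T)"

lemma computesI:
  "wp iso_program vs (iso_program ! i) (\<lambda>w k. w = v \<and> k \<le> T) \<Longrightarrow> i < 39 \<Longrightarrow> computes i vs v T"
  by (simp add: computes_def wp_call_def length_iso_program)

lemma wp_callI: "computes i vs v T \<Longrightarrow> (\<And>k. k \<le> T \<Longrightarrow> Q v k) \<Longrightarrow> wp_call iso_program i vs Q"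
  unfolding computes_def wp_call_def wp_def by blast

lemma computes_mono: "computes i vs v T \<Longrightarrow> T \<le> T' \<Longrightarrow> computes i vs v T'"
  unfolding computes_def wp_call_def wp_def by (blast intro: order.trans)

section \<open>The functions computed by the program\<close>

definition enc_map :: "('a \<Rightarrow> val) \<Rightarrow> 'a list \<Rightarrow> val" where
  "enc_map c xs = enc_list (map c xs)"

lemma enc_map_simps [simp]:
  "enc_map c [] = NIL" "enc_map c (x # xs) = CONS (c x) (enc_map c xs)"
  by (simp_all add: enc_map_def)

lemma enc_map_eq_NIL [simp]: "enc_map c xs = NIL \<longleftrightarrow> xs = []"
  by (cases xs) simp_all

lemma enc_map_inject: "inj_on c (set xs \<union> set ys) \<Longrightarrow> enc_map c xs = enc_map c ys \<longleftrightarrow> xs = ys"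
proof (induction xs arbitrary: ys)
  case (Cons x xs)
  show ?case
  proof (cases ys)
    case (Cons y ys')
    then show ?thesis using Cons.IH[of ys'] Cons.prems by (auto simp: inj_on_def)
  qed simp
qed (metis enc_map_simps(1) enc_map_eq_NIL)

lemma tl_enc_map: "tl_val (enc_map c xs) = enc_map c (tl xs)"
  by (cases xs) simp_all

lemma enc_nat_eq_NIL [simp]: "enc_nat k = NIL \<longleftrightarrow> k = 0"
  by (cases k) simp_all

lemma enc_nat_inject [simp]: "enc_nat a = enc_nat b \<longleftrightarrow> a = b"
proof (induction a arbitrary: b)
  case (Suc a) then show ?case by (cases b) simp_all
qed (metis enc_nat_eq_NIL enc_nat.simps(1))



lemma enc_nat_conv_enc_map: "enc_nat k = enc_map (\<lambda>_. NIL) (replicate k ())"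
  by (induction k) simp_all

definition enc_bool :: "bool \<Rightarrow> val" where
  "enc_bool b = (if b then CONS NIL NIL else NIL)"

lemma enc_bool_simps [simp]:
  "enc_bool b = NIL \<longleftrightarrow> \<not> b" "enc_bool True = CONS NIL NIL" "enc_bool False = NIL"
  by (auto simp: enc_bool_def)

fun vsize :: "val \<Rightarrow> nat" where
  "vsize NIL = 1"
| "vsize (CONS v w) = 1 + vsize v + vsize w"

lemma vsize_enc_nat [simp]: "vsize (enc_nat k) = 2 * k + 1"
  by (induction k) simp_all

lemma vsize_enc_map:
  "(\<And>x. x \<in> set xs \<Longrightarrow> vsize (c x) \<le> B) \<Longrightarrow> vsize (enc_map c xs) \<le> 1 + length xs * (B + 1)"
  by (induction xs) force+

definition vec_add :: "'u :: comm_ring_1 list \<Rightarrow> 'u list \<Rightarrow> 'u list" where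
  "vec_add u v = map2 (+) u v"

definition vec_scale :: "'u :: comm_ring_1 \<Rightarrow> 'u list \<Rightarrow> 'u list" where
  "vec_scale c v = map ((*) c) v"

definition vec_dot :: "'u :: comm_ring_1 list \<Rightarrow> 'u list \<Rightarrow> 'u" where
  "vec_dot u v = sum_list (map2 (*) u v)"

lemma vec_simps [simp]:
  "vec_add [] v = []" "vec_add u [] = []" "vec_add (a # u) (b # v) = (a + b) # vec_add u v"
  "vec_scale c [] = []" "vec_scale c (a # u) = c * a # vec_scale c u"
  "vec_dot [] v = 0" "vec_dot u [] = 0" "vec_dot (a # u) (b # v) = a * b + vec_dot u v"
  "length (vec_add u v) = min (length u) (length v)" "length (vec_scale c v) = length v"
  by (simp_all add: vec_add_def vec_scale_def vec_dot_def)

fun pair_products :: "'u :: comm_ring_1 list \<Rightarrow> 'u list" where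
  "pair_products [] = []"
| "pair_products (y # ys) = vec_scale y (y # ys) @ pair_products ys"

fun triple_products :: "'u :: comm_ring_1 list \<Rightarrow> 'u list" where
  "triple_products [] = []"
| "triple_products (x # xs) = vec_scale x (pair_products (x # xs)) @ triple_products xs"

lemma length_pair_products: "length (pair_products v) \<le> length v * length v"
  by (induction v) auto

definition form_value :: "'u :: comm_ring_1 list \<Rightarrow> 'u list \<Rightarrow> 'u" where
  "form_value h x = vec_dot h (triple_products x)"

definition polar_value :: "'u :: comm_ring_1 list \<Rightarrow> 'u list \<Rightarrow> 'u list \<Rightarrow> 'u list \<Rightarrow> 'u" where
  "polar_value h x y z =
    form_value h (vec_add (vec_add x y) z) + form_value h x + (form_value h y + form_value h z)
    + - (form_value h (vec_add x y) + form_value h (vec_add x z) + form_value h (vec_add y z))"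

definition outer_product :: "'u :: comm_ring_1 list \<Rightarrow> 'u list \<Rightarrow> 'u list" where
  "outer_product u v = concat (map (\<lambda>a. vec_scale a v) u)"

lemma length_outer_product [simp]: "length (outer_product u v) = length u * length v"
  by (induction u) (auto simp: outer_product_def)

definition row_equations ::
    "'u :: comm_ring_1 list \<Rightarrow> 'u list \<Rightarrow> 'u list \<Rightarrow> 'u list \<Rightarrow> 'u list list \<Rightarrow> 'u list list
      \<Rightarrow> 'u list list"
  where "row_equations f x ej row Ks Es =
    map (\<lambda>ek. outer_product ek row @ outer_product ej (map (polar_value f x ek) Es)) Ks"

definition image_equations ::
    "'u :: comm_ring_1 list \<Rightarrow> 'u list \<Rightarrow> 'u list \<Rightarrow> 'u list \<Rightarrow> 'u list list \<Rightarrow> 'u list list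
      \<Rightarrow> 'u list list"
  where "image_equations f g x w Js Es =
    concat (map (\<lambda>ej. row_equations f x ej (map (polar_value g w ej) Es) Es Es) Js)"

definition equations ::
    "'u :: comm_ring_1 list \<Rightarrow> 'u list \<Rightarrow> 'u list list \<Rightarrow> 'u list list \<Rightarrow> 'u list list \<Rightarrow> 'u list list"
  where "equations f g xs ws Es = concat (map (\<lambda>(x, w). image_equations f g x w Es Es) (zip xs ws))"

lemma length_image_equations: "length (image_equations f g x w Js Es) = length Js * length Es"
  by (induction Js) (auto simp: image_equations_def row_equations_def)

lemma length_equations: "length (equations f g xs ws Es) \<le> length ws * (length Es * length Es)"
proof (induction ws arbitrary: xs)
  case (Cons w ws)
  then show ?case by (cases xs) (auto simp: equations_def length_image_equations)
qed (simp add: equations_def)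

lemma length_equation:
  assumes "\<forall>z\<in>set Es. length z = length Es" "l \<in> set (equations f g Es ws Es)"
  shows "length l = 2 * (length Es * length Es)"
  using assms
  by (auto simp: equations_def image_equations_def row_equations_def dest!: set_zip_leftD)

lemma equations_take: "equations f g xs ws Es = equations f g xs (take (length xs) ws) Es"
proof -
  have "zip xs ys = zip xs (take (length xs) ys)" for xs ys :: "'b list"
  proof (induction xs arbitrary: ys)
    case (Cons x xs)
    show ?case using Cons.IH by (cases ys) auto
  qed simp
  then show ?thesis unfolding equations_def by (metis (no_types))
qed

definition unit_vecs :: "'u :: comm_ring_1 \<Rightarrow> nat \<Rightarrow> 'u list list" where
  "unit_vecs a k = map (\<lambda>i. map (\<lambda>j. if j = i then a else 0) [0..<k]) [0..<k]"

lemma unit_vecs_0 [simp]: "unit_vecs a 0 = []"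
  by (simp add: unit_vecs_def)

lemma unit_vecs_Suc: "unit_vecs a (Suc k) = (a # replicate k 0) # map ((#) 0) (unit_vecs a k)"
  unfolding unit_vecs_def
  by (simp add: upt_conv_Cons map_Suc_upt[symmetric] map_replicate_const comp_def del: upt_Suc)

lemma length_unit_vecs [simp]: "length (unit_vecs a k) = k"
  by (simp add: unit_vecs_def)

lemma length_unit_vec: "\<forall>c\<in>set (unit_vecs a k). length c = k"
  by (simp add: unit_vecs_def)

definition eliminate :: "'u :: comm_ring_1 list \<Rightarrow> 'u list \<Rightarrow> 'u \<Rightarrow> 'u list list \<Rightarrow> 'u list list" where
  "eliminate l p s cs = map (\<lambda>c. vec_add (vec_scale s c) (vec_scale (- vec_dot l c) p)) cs"

lemma length_eliminate [simp]: "length (eliminate l p s cs) = length cs"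
  by (simp add: eliminate_def)

lemma length_eliminated:
  "c \<in> set (eliminate l p s cs) \<Longrightarrow> length p = N \<Longrightarrow> \<forall>c\<in>set cs. length c = N \<Longrightarrow> length c = N"
  by (auto simp: eliminate_def)

text \<open>The parameter \<open>Z\<close> is the test for zero.\<close>

fun restrict_basis ::
    "('u \<Rightarrow> bool) \<Rightarrow> 'u :: comm_ring_1 list \<Rightarrow> 'u list list \<Rightarrow> 'u list list" where
  "restrict_basis Z l [] = []"
| "restrict_basis Z l (c # cs) =
    (if Z (vec_dot l c) then c # restrict_basis Z l cs else eliminate l c (vec_dot l c) cs)"

fun kernel_basis ::
    "('u \<Rightarrow> bool) \<Rightarrow> 'u :: comm_ring_1 list list \<Rightarrow> 'u list list \<Rightarrow> 'u list list" where
  "kernel_basis Z [] bs = bs"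
| "kernel_basis Z (l # ls) bs = kernel_basis Z ls (restrict_basis Z l bs)"

lemma length_restrict_basis: "length (restrict_basis Z l bs) \<le> length bs"
  by (induction bs) auto

lemma length_restricted:
  "\<forall>c\<in>set bs. length c = N \<Longrightarrow> \<forall>c\<in>set (restrict_basis Z l bs). length c = N"
  by (induction bs) (auto simp: length_eliminated)

lemma length_kernel_vec:
  "\<forall>c\<in>set bs. length c = N \<Longrightarrow> \<forall>c\<in>set (kernel_basis Z ls bs). length c = N"
proof (induction ls arbitrary: bs)
  case (Cons l ls)
  show ?case using Cons.IH[OF length_restricted[OF Cons.prems]] by simp
qed simp

fun add_lincomb :: "'u :: comm_ring_1 list \<Rightarrow> 'u list list \<Rightarrow> 'u list \<Rightarrow> 'u list" where
  "add_lincomb (c # cs) (b # bs) acc = add_lincomb cs bs (vec_add acc (vec_scale c b))"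
| "add_lincomb _ _ acc = acc"

lemma length_add_lincomb: "length (add_lincomb cs bs acc) \<le> length acc"
  by (induction cs bs acc rule: add_lincomb.induct) auto

fun add_columns :: "'u :: comm_ring_1 list \<Rightarrow> 'u list \<Rightarrow> 'u list \<Rightarrow> 'u list" where
  "add_columns [] u acc = acc"
| "add_columns (x # xs) u acc = add_columns xs (drop (length acc) u) (vec_add acc (vec_scale x u))"

lemma length_add_columns: "length (add_columns xs u acc) \<le> length acc"
  by (induction xs u acc rule: add_columns.induct) auto

definition cubic_coeffs :: "nat \<Rightarrow> (nat multiset \<Rightarrow> 'a) \<Rightarrow> 'a list" where
  "cubic_coeffs n f = [f {#i, j, k#}. i \<leftarrow> [0..<n], j \<leftarrow> [i..<n], k \<leftarrow> [j..<n]]"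

lemma length_cubic_coeffs: "length (cubic_coeffs n f) \<le> n * (n * n)"
proof -
  have "length (cubic_coeffs n f) = (\<Sum>i\<leftarrow>[0..<n]. \<Sum>j\<leftarrow>[i..<n]. n - j)"
    by (simp add: cubic_coeffs_def length_concat comp_def)
  also have "\<dots> \<le> (\<Sum>i\<leftarrow>[0..<n]. n * n)"
  proof (rule sum_list_mono)
    fix i assume "i \<in> set [0..<n]"
    have "(\<Sum>j\<leftarrow>[i..<n]. n - j) \<le> (\<Sum>j\<leftarrow>[i..<n]. n)" by (rule sum_list_mono) simp
    also have "\<dots> = (n - i) * n" by (simp add: sum_list_triv)
    also have "\<dots> \<le> n * n" by (intro mult_right_mono) auto
    finally show "(\<Sum>j\<leftarrow>[i..<n]. n - j) \<le> n * n" .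
  qed
  also have "\<dots> = n * (n * n)" by (simp add: sum_list_triv)
  finally show ?thesis .
qed

lemma map_cubic_coeffs: "map c (cubic_coeffs n f) = cubic_coeffs n (\<lambda>m. c (f m))"
  by (simp add: cubic_coeffs_def map_concat comp_def)

definition emb_form :: "nat ring \<Rightarrow> (nat multiset \<Rightarrow> nat) \<Rightarrow> nat multiset \<Rightarrow> prod_ring" where
  "emb_form R f m = emb R (f m)"

section \<open>Running time\<close>

lemma computes_nth:
  "i < length vs \<Longrightarrow> computes fn_nth [enc_list vs, enc_nat i] (vs ! i) (10 * (i + 1))"
proof (induction vs arbitrary: i)
  case (Cons v vs)
  show ?case
  proof (cases i)
    case 0
    then show ?thesis by (intro computesI) (simp_all add: nth_iso_program body_nth_def)
  next
    case (Suc j)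
    show ?thesis using Cons.prems unfolding Suc
      by (intro computesI)
        (auto simp: nth_iso_program body_nth_def intro!: wp_callI[OF Cons.IH[of j]])
  qed
qed simp

lemma computes_equal: "computes fn_equal [v, w] (enc_bool (v = w)) (20 * vsize v)"
proof (induction v arbitrary: w)
  case NIL
  show ?case by (cases w; intro computesI) (simp_all add: nth_iso_program body_equal_def)
next
  case (CONS v1 v2)
  show ?case
    by (cases w; intro computesI) (auto simp: nth_iso_program body_equal_def
        intro!: wp_callI[OF CONS.IH(1)] wp_callI[OF CONS.IH(2)])
qed

lemma computes_elements: "computes fn_elements [enc_nat k]
    (enc_map enc_nat (rev [0..<k])) (20 * (k + 1))"
proof (induction k)
  case (Suc k)
  show ?case
    by (intro computesI) (auto simp: nth_iso_program body_elements_def simp del: One_nat_def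
        intro!: wp_callI[OF Suc.IH])
qed (intro computesI; simp add: nth_iso_program[simplified] body_elements_def)

locale iso_run =
  fixes R :: "nat ring" and q n :: nat
  assumes field_R: "field R" and carrier_R: "carrier R = {..<q}"
begin

lemma cring_R: "cring R"
  using field_R by (simp add: field_def domain_def)

lemma two_le_q: "2 \<le> q"
proof -
  interpret field R by (rule field_R)
  have "\<zero>\<^bsub>R\<^esub> < q" "\<one>\<^bsub>R\<^esub> < q" "\<one>\<^bsub>R\<^esub> \<noteq> \<zero>\<^bsub>R\<^esub>"
    using zero_closed one_closed one_not_zero by (auto simp: carrier_R)
  then show ?thesis by linarith
qed

text \<open>\<open>M\<close> exceeds the length of all lists that occur in the computation; running times are bounded
  by powers of \<open>M\<close>.\<close>

definition M :: nat where "M = q ^ (200 * (n + 1))"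

lemma q_power_less_M: "a < 200 * (n + 1) \<Longrightarrow> q ^ a < M"
  unfolding M_def using two_le_q by (intro power_strict_increasing) auto

lemma q_less_M: "q < M"
  using q_power_less_M[of 1] by simp

lemma M_ge: "1000 \<le> M"
proof -
  have "1000 \<le> (2 :: nat) ^ 10" by simp
  also have "\<dots> \<le> q ^ 10" using two_le_q by (rule power_mono) simp
  also have "\<dots> < M" by (rule q_power_less_M) simp
  finally show ?thesis by simp
qed

lemma n_less_M: "200 * (n + 1) ^ 3 < M"
proof -
  have "n + 1 \<le> 2 ^ n" by (metis Suc_eq_plus1 Suc_leI less_exp)
  then have "200 * (n + 1) ^ 3 \<le> 2 ^ 8 * (2 ^ n) ^ 3" by (intro mult_mono power_mono) simp_all
  also have "\<dots> = 2 ^ (8 + n * 3)" by (simp only: power_add power_mult)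
  also have "\<dots> \<le> q ^ (8 + n * 3)" using two_le_q by (rule power_mono) simp
  also have "\<dots> < M" by (rule q_power_less_M) simp
  finally show ?thesis .
qed

subsection \<open>Cost bounds\<close>

lemma M_power_ge: "0 < d \<Longrightarrow> 1000 \<le> M ^ d"
  using M_ge self_le_power[of M d] by simp

lemma call_within:
  assumes "computes i vs v (M ^ a)" "a \<le> d" "\<And>k. k \<le> M ^ d \<Longrightarrow> Q v k"
  shows "wp_call iso_program i vs Q"
proof (rule wp_callI[OF assms(1)])
  fix k assume "k \<le> M ^ a"
  also have "\<dots> \<le> M ^ d" using M_ge assms(2) by (intro power_increasing) auto
  finally show "Q v k" by (rule assms(3))
qed

text \<open>Every function body makes fewer than 900 calls and other steps. A recursive function that
  runs \<open>l + 1\<close> times through its body and whose other calls take time \<open>M ^ d\<close> takes time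
  \<open>loop_cost d l\<close>.\<close>

abbreviation loop_cost :: "nat \<Rightarrow> nat \<Rightarrow> nat" where
  "loop_cost d l \<equiv> (l + 1) * (900 * M ^ d)"

lemma loop_bound:
  assumes "computes i vs v (loop_cost d l)" "l < M" "D = d + 2"
  shows "computes i vs v (M ^ D)"
proof (rule computes_mono[OF assms(1)])
  have "loop_cost d l \<le> M * (M * M ^ d)"
    using M_ge assms(2) by (intro mult_mono) auto
  then show "loop_cost d l \<le> M ^ D" by (simp add: assms(3))
qed

lemma straight_bound:
  assumes "computes i vs v (900 * M ^ d)" "D = d + 1"
  shows "computes i vs v (M ^ D)"
  using assms(1) by (rule computes_mono) (use M_ge assms(2) in simp)

lemma short_loop_bound:
  assumes "computes i vs v (20 * (l + 1))" "l < M"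
  shows "computes i vs v (M ^ 2)"
  using assms(1) by (rule computes_mono)
    (use assms(2) M_ge mult_mono[of 20 M "l + 1" M] in \<open>simp add: power2_eq_square\<close>)

lemma n_bounds:
  "n < M" "n * n < M" "2 * (n * n) < M" "n * n * n < M" "num_images * (n * n) < M"
  "rank_factor * n < M"
proof -
  have "(n + 1) ^ 3 = n * n * n + 3 * (n * n) + 3 * n + 1"
    by (simp add: power3_eq_cube algebra_simps)
  moreover have "n \<le> n * n" "n * n \<le> n * n * n" by (cases n; simp)+
  ultimately show "n < M" "n * n < M" "2 * (n * n) < M" "n * n * n < M" "num_images * (n * n) < M"
    "rank_factor * n < M"
    unfolding num_images_def rank_factor_def using n_less_M by linarith+
qed

subsection \<open>Lists\<close>

lemma computes_append:
  "length xs < M \<Longrightarrow> computes fn_append [enc_map c xs, enc_map c ys] (enc_map c (xs @ ys)) (M ^ 2)"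
proof (rule short_loop_bound)
  show "computes fn_append [enc_map c xs, enc_map c ys]
      (enc_map c (xs @ ys)) (20 * (length xs + 1))"
  proof (induction xs)
    case (Cons x xs)
    show ?case
      by (intro computesI) (auto simp: nth_iso_program body_append_def intro!: wp_callI[OF Cons.IH])
  qed (intro computesI; simp add: nth_iso_program body_append_def)
qed

lemma computes_drop:
  "length xs < M \<Longrightarrow> computes fn_drop [enc_map c xs, enc_map d u]
    (enc_map d (drop (length xs) u)) (M ^ 2)"
proof (rule short_loop_bound)
  show "computes fn_drop [enc_map c xs, enc_map d u]
      (enc_map d (drop (length xs) u)) (20 * (length xs + 1))"
  proof (induction xs arbitrary: u)
    case (Cons x xs)
    show ?case
      by (intro computesI) (auto simp: nth_iso_program body_drop_def tl_enc_map drop_Suc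
          intro!: wp_callI[OF Cons.IH])
  qed (intro computesI; simp add: nth_iso_program body_drop_def)
qed

lemma computes_times:
  assumes "k < M" "m < M"
  shows "computes fn_times [enc_nat k, enc_nat m] (enc_nat (k * m)) (M ^ 4)"
proof (rule loop_bound)
  have append: "computes fn_append [enc_nat m, enc_nat j] (enc_nat (m + j)) (M ^ 2)" for j
    using computes_append[of "replicate m ()" "\<lambda>_. NIL" "replicate j ()"] assms(2)
    by (simp add: enc_nat_conv_enc_map replicate_add)
  show "computes fn_times [enc_nat k, enc_nat m] (enc_nat (k * m)) (loop_cost 2 k)"
  proof (induction k)
    case (Suc k)
    show ?case using M_power_ge[of 2]
      by (intro computesI) (auto simp: nth_iso_program body_times_def
          intro!: wp_callI[OF Suc.IH] wp_callI[OF append])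
  qed (use M_power_ge[of 2] in \<open>intro computesI; simp add: nth_iso_program body_times_def\<close>)
qed (use assms in simp_all)

lemma computes_extend_one:
  "length L < M \<Longrightarrow> computes fn_extend_one [enc_map c L, enc_map c ys]
    (enc_map (enc_map c) (map (\<lambda>y. y # ys) L)) (M ^ 2)"
proof (rule short_loop_bound)
  show "computes fn_extend_one [enc_map c L, enc_map c ys]
    (enc_map (enc_map c) (map (\<lambda>y. y # ys) L)) (20 * (length L + 1))"
  proof (induction L)
    case (Cons x L)
    show ?case
      by (intro computesI)
        (auto simp: nth_iso_program body_extend_one_def intro!: wp_callI[OF Cons.IH])
  qed (intro computesI; simp add: nth_iso_program body_extend_one_def)
qed

lemma computes_extend:
  assumes "length L < M" "length Ys < M"
  shows "computes fn_extend [enc_map c L, enc_map (enc_map c) Ys]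
    (enc_map (enc_map c) (concat (map (\<lambda>ys. map (\<lambda>y. y # ys) L) Ys))) (M ^ 4)"
proof (rule loop_bound)
  note call = call_within[where d = 2]
  show "computes fn_extend [enc_map c L, enc_map (enc_map c) Ys]
    (enc_map (enc_map c) (concat (map (\<lambda>ys. map (\<lambda>y. y # ys) L) Ys))) (loop_cost 2 (length Ys))"
  proof (induction Ys)
    case (Cons y Ys)
    show ?case using M_power_ge[of 2] assms(1)
      by (intro computesI) (auto simp: nth_iso_program body_extend_def
          intro!: wp_callI[OF Cons.IH] call[OF computes_extend_one] call[OF computes_append])
  qed (use M_power_ge[of 2] in \<open>intro computesI; simp add: nth_iso_program body_extend_def\<close>)
qed (use assms in simp_all)

lemma computes_tuples:
  assumes "L \<noteq> []" "length L < M" "k < M" "length L ^ k < M"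
  shows "computes fn_tuples [enc_nat k, enc_map c L]
      (enc_map (enc_map c) (List.n_lists k L)) (M ^ 6)"
proof (rule loop_bound)
  show "computes fn_tuples [enc_nat k, enc_map c L]
      (enc_map (enc_map c) (List.n_lists k L)) (loop_cost 4 k)"
    using assms(4)
  proof (induction k)
    case (Suc k)
    have less: "length L ^ k < M"
      using Suc.prems assms(1)
      by (intro le_less_trans[OF power_increasing[of k "Suc k"]]) (auto simp: Suc_le_eq)
    show ?case using M_power_ge[of 4] assms(2) less
      by (intro computesI) (auto simp: nth_iso_program body_tuples_def length_n_lists
          intro!: wp_callI[OF Suc.IH[OF less]] wp_callI[OF computes_extend])
  qed (use M_power_ge[of 4] in \<open>intro computesI; simp add: nth_iso_program body_tuples_def\<close>)
qed (use assms in simp_all)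

lemma computes_cons_all:
  "length xs < M \<Longrightarrow> computes fn_cons_all [c a, enc_map (enc_map c) xs]
    (enc_map (enc_map c) (map ((#) a) xs)) (M ^ 2)"
proof (rule short_loop_bound)
  show "computes fn_cons_all [c a, enc_map (enc_map c) xs]
    (enc_map (enc_map c) (map ((#) a) xs)) (20 * (length xs + 1))"
  proof (induction xs)
    case (Cons x xs)
    show ?case
      by (intro computesI)
        (auto simp: nth_iso_program body_cons_all_def intro!: wp_callI[OF Cons.IH])
  qed (intro computesI; simp add: nth_iso_program body_cons_all_def)
qed

subsection \<open>Field operations\<close>

definition enc_elem :: "prod_ring \<Rightarrow> val" where
  "enc_elem a = enc_nat (proj R a)"

abbreviation enc_vec :: "prod_ring list \<Rightarrow> val" where
  "enc_vec \<equiv> enc_map enc_elem"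

abbreviation enc_vecs :: "prod_ring list list \<Rightarrow> val" where
  "enc_vecs \<equiv> enc_map enc_vec"

abbreviation unit_elem :: prod_ring where
  "unit_elem \<equiv> emb R \<one>\<^bsub>R\<^esub>"

definition field_elems :: "prod_ring list" where
  "field_elems = map (emb R) (rev [0..<q])"

definition field_env :: val where
  "field_env = CONS (enc_vec field_elems) (CONS (enc_table q (add R))
     (CONS (enc_table q (monoid.mult R)) (CONS (enc_elem 0) (CONS (enc_elem unit_elem) NIL))))"

lemma field_env_simps [simp]:
  "hd_val field_env = enc_vec field_elems"
  "hd_val (tl_val field_env) = enc_table q (add R)"
  "hd_val (tl_val (tl_val field_env)) = enc_table q (monoid.mult R)"
  "hd_val (tl_val (tl_val (tl_val field_env))) = enc_elem 0"
  "hd_val (tl_val (tl_val (tl_val (tl_val field_env)))) = enc_elem unit_elem"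
  by (simp_all add: field_env_def)

lemma length_field_elems: "length field_elems = q"
  by (simp add: field_elems_def)

lemma enc_field_elems: "enc_vec field_elems = enc_map enc_nat (rev [0..<q])"
  by (auto simp: enc_map_def field_elems_def enc_elem_def cring_R carrier_R
      intro!: arg_cong[where f = enc_list])

lemma proj_less: "proj R a < q"
  using proj_closed[OF cring_R, of a] by (simp add: carrier_R)

lemma computes_nth_within:
  "i < q \<Longrightarrow> i < length vs \<Longrightarrow> computes fn_nth [enc_list vs, enc_nat i] (vs ! i) (M ^ 2)"
  using q_less_M M_ge mult_mono[of 10 M "i + 1" M]
  by (intro computes_mono[OF computes_nth]) (simp_all add: power2_eq_square)

definition table_row :: "(nat \<Rightarrow> nat \<Rightarrow> nat) \<Rightarrow> nat \<Rightarrow> val" where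
  "table_row h a = enc_list (map (\<lambda>b. enc_nat (h a b)) [0..<q])"

lemma computes_table_row:
  "a < q \<Longrightarrow> computes fn_nth [enc_table q h, enc_nat a] (table_row h a) (M ^ 2)"
  using computes_nth_within[of a "map (\<lambda>a. table_row h a) [0..<q]"]
  by (simp add: enc_table_def table_row_def)

lemma computes_table_entry:
  "b < q \<Longrightarrow> computes fn_nth [table_row h a, enc_nat b] (enc_nat (h a b)) (M ^ 2)"
  using computes_nth_within[of b "map (\<lambda>b. enc_nat (h a b)) [0..<q]"] by (simp add: table_row_def)

lemma computes_row: "computes fn_nth [enc_table q h, enc_elem a] (table_row h (proj R a)) (M ^ 2)"
  unfolding enc_elem_def by (rule computes_table_row[OF proj_less])

lemma computes_add_entry:
  "computes fn_nth [table_row (add R) (proj R a), enc_elem b] (enc_elem (a + b)) (M ^ 2)"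
  unfolding enc_elem_def proj_hom(3)[OF cring_R] by (rule computes_table_entry[OF proj_less])

lemma computes_mult_entry:
  "computes fn_nth [table_row (monoid.mult R) (proj R a), enc_elem b] (enc_elem (a * b)) (M ^ 2)"
  unfolding enc_elem_def proj_hom(4)[OF cring_R] by (rule computes_table_entry[OF proj_less])

lemma computes_equal_elem: "computes fn_equal [enc_elem a, v] (enc_bool (enc_elem a = v)) (M ^ 2)"
proof (rule computes_mono[OF computes_equal])
  have "20 * (2 * proj R a + 1) \<le> 60 * M" using proj_less[of a] q_less_M by simp
  also have "\<dots> \<le> M * M" using M_ge by (intro mult_mono) auto
  finally show "20 * vsize (enc_elem a) \<le> M ^ 2" by (simp add: enc_elem_def power2_eq_square)
qed

lemma computes_equal_vec:
  assumes "length x \<le> n"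
  shows "computes fn_equal [enc_vec x, v] (enc_bool (enc_vec x = v)) (M ^ 3)"
proof (rule computes_mono[OF computes_equal])
  have "vsize (enc_elem a) \<le> 2 * M" for a using proj_less[of a] q_less_M by (simp add: enc_elem_def)
  then have "vsize (enc_vec x) \<le> 1 + length x * (2 * M + 1)" by (intro vsize_enc_map) auto
  also have "\<dots> \<le> 1 + M * (3 * M)" using assms n_bounds(1) M_ge by (intro add_mono mult_mono) auto
  also have "\<dots> \<le> M * (4 * M)" using M_ge by (simp add: algebra_simps)
  finally have "20 * vsize (enc_vec x) \<le> 80 * (M * M)" by simp
  also have "\<dots> \<le> M * (M * M)" using M_ge by (intro mult_mono) auto
  finally show "20 * vsize (enc_vec x) \<le> M ^ 3" by (simp add: power3_eq_cube)
qed

lemma computes_find: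
  assumes h_less: "\<And>s. s < q \<Longrightarrow> h s a < q" and a_less: "a < q"
    and s_less: "s < q" "h s a = b" "\<And>s'. s' < q \<Longrightarrow> h s' a = b \<Longrightarrow> s' = s"
  shows "computes fn_find [enc_vec field_elems, enc_table q h, enc_nat a, enc_nat b]
      (enc_nat s) (M ^ 4)"
proof (rule loop_bound)
  note call = call_within[where d = 2]
  have equal: "computes fn_equal [enc_nat (h s' a), v] (enc_bool (enc_nat (h s' a) = v)) (M ^ 2)"
    if "s' < q" for s' v
    using computes_equal_elem[of "emb R (h s' a)" v] h_less[OF that]
    by (simp add: enc_elem_def cring_R carrier_R)
  have "computes fn_find [enc_map enc_nat ss, enc_table q h, enc_nat a, enc_nat b] (enc_nat s)
      (loop_cost 2 (length ss))" if "set ss \<subseteq> {..<q}" "s \<in> set ss" for ss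
    using that
  proof (induction ss)
    case (Cons s' ss)
    have hit: "h s' a = b \<longleftrightarrow> s' = s" using Cons.prems(1) s_less(2) s_less(3)[of s'] by auto
    have IH: "computes fn_find [enc_map enc_nat ss, enc_table q h, enc_nat a, enc_nat b] (enc_nat s)
        (loop_cost 2 (length ss))" if "s' \<noteq> s" using Cons that by auto
    show ?case using M_power_ge[of 2] Cons.prems(1) a_less hit
      by (cases "s' = s"; intro computesI) (auto simp: nth_iso_program body_find_def
          intro!: wp_callI[OF IH] call[OF computes_table_row] call[OF computes_table_entry]
            call[OF equal])
  qed simp
  from this[of "rev [0..<q]"] s_less(1)
  have "computes fn_find [enc_map enc_nat (rev [0..<q]), enc_table q h, enc_nat a, enc_nat b]
      (enc_nat s) (loop_cost 2 q)" by (simp add: atLeast0LessThan)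
  then show "computes fn_find [enc_vec field_elems, enc_table q h, enc_nat a, enc_nat b]
      (enc_nat s) (loop_cost 2 q)" by (simp add: enc_field_elems)
qed (use q_less_M in simp_all)

lemma computes_neg:
  "computes fn_find [enc_vec field_elems, enc_table q (add R), enc_elem a, enc_elem 0]
    (enc_elem (- a)) (M ^ 4)"
proof -
  interpret cring R by (rule cring_R)
  show ?thesis
    unfolding enc_elem_def[of a] enc_elem_def[of 0] enc_elem_def[of "- a"]
  proof (rule computes_find)
    show "proj R (- a) \<oplus>\<^bsub>R\<^esub> proj R a = proj R 0"
      by (simp flip: proj_hom(3)[OF cring_R])
    fix s assume "s < q" "s \<oplus>\<^bsub>R\<^esub> proj R a = proj R 0"
    then show "s = proj R (- a)"
      using minus_equality[of "s" "proj R a"] proj_closed[OF cring_R]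
      by (simp add: proj_hom[OF cring_R] carrier_R)
  qed (use proj_less a_closed in \<open>auto simp: carrier_R\<close>)
qed

subsection \<open>Vectors\<close>

lemma computes_zeros:
  "length xs < M \<Longrightarrow> computes fn_zeros [field_env, enc_map c xs]
    (enc_vec (replicate (length xs) 0)) (M ^ 2)"
proof (rule short_loop_bound)
  show "computes fn_zeros [field_env, enc_map c xs]
      (enc_vec (replicate (length xs) 0)) (20 * (length xs + 1))"
  proof (induction xs)
    case (Cons x xs)
    show ?case
      by (intro computesI) (auto simp: nth_iso_program body_zeros_def intro!: wp_callI[OF Cons.IH])
  qed (intro computesI; simp add: nth_iso_program body_zeros_def)
qed

lemma computes_units:
  assumes "length xs < M"
  shows "computes fn_units [field_env, enc_map c xs]
      (enc_vecs (unit_vecs unit_elem (length xs))) (M ^ 4)"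
proof (rule loop_bound)
  note call = call_within[where d = 2]
  show "computes fn_units [field_env, enc_map c xs] (enc_vecs (unit_vecs unit_elem (length xs)))
      (loop_cost 2 (length xs))"
    using assms
  proof (induction xs)
    case (Cons x xs)
    show ?case using M_power_ge[of 2] Cons.prems
      by (intro computesI) (auto simp: nth_iso_program body_units_def unit_vecs_Suc
          intro!: wp_callI[OF Cons.IH] call[OF computes_zeros] call[OF computes_cons_all])
  qed (use M_power_ge[of 2] in \<open>intro computesI; simp add: nth_iso_program body_units_def\<close>)
qed (use assms in simp_all)

lemma computes_add:
  assumes "length u < M"
  shows "computes fn_add [field_env, enc_vec u, enc_vec v] (enc_vec (vec_add u v)) (M ^ 4)"
proof (rule loop_bound)
  note call = call_within[where d = 2]
  show "computes fn_add [field_env, enc_vec u, enc_vec v]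
      (enc_vec (vec_add u v)) (loop_cost 2 (length u))"
  proof (induction u arbitrary: v)
    case (Cons a u)
    show ?case using M_power_ge[of 2]
      by (cases v; intro computesI) (auto simp: nth_iso_program body_add_def
          intro!: wp_callI[OF Cons.IH] call[OF computes_row] call[OF computes_add_entry])
  qed (use M_power_ge[of 2] in \<open>intro computesI; simp add: nth_iso_program body_add_def\<close>)
qed (use assms in simp_all)

lemma computes_scale:
  assumes "length v < M"
  shows "computes fn_scale [field_env, enc_elem c, enc_vec v] (enc_vec (vec_scale c v)) (M ^ 4)"
proof (rule loop_bound)
  note call = call_within[where d = 2]
  show "computes fn_scale [field_env, enc_elem c, enc_vec v]
      (enc_vec (vec_scale c v)) (loop_cost 2 (length v))"
  proof (induction v)
    case (Cons a v)
    show ?case using M_power_ge[of 2]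
      by (intro computesI) (auto simp: nth_iso_program body_scale_def
          intro!: wp_callI[OF Cons.IH] call[OF computes_row] call[OF computes_mult_entry])
  qed (use M_power_ge[of 2] in \<open>intro computesI; simp add: nth_iso_program body_scale_def\<close>)
qed (use assms in simp_all)

lemma computes_dot:
  assumes "length u < M"
  shows "computes fn_dot [field_env, enc_vec u, enc_vec v] (enc_elem (vec_dot u v)) (M ^ 4)"
proof (rule loop_bound)
  note call = call_within[where d = 2]
  show "computes fn_dot [field_env, enc_vec u, enc_vec v]
      (enc_elem (vec_dot u v)) (loop_cost 2 (length u))"
  proof (induction u arbitrary: v)
    case (Cons a u)
    show ?case using M_power_ge[of 2]
      by (cases v; intro computesI)
        (auto simp: nth_iso_program body_dot_def intro!: wp_callI[OF Cons.IH]
          call[OF computes_row] call[OF computes_add_entry] call[OF computes_mult_entry])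
  qed (use M_power_ge[of 2] in \<open>intro computesI; simp add: nth_iso_program body_dot_def\<close>)
qed (use assms in simp_all)

lemma computes_lincomb:
  assumes "\<forall>b\<in>set bs. length b < M" "length acc < M" "length cs < M"
  shows "computes fn_lincomb [field_env, enc_vec cs, enc_vecs bs, enc_vec acc]
    (enc_vec (add_lincomb cs bs acc)) (M ^ 6)"
proof (rule loop_bound)
  note call = call_within[where d = 4]
  show "computes fn_lincomb [field_env, enc_vec cs, enc_vecs bs, enc_vec acc]
      (enc_vec (add_lincomb cs bs acc)) (loop_cost 4 (length cs))"
    using assms(1,2)
  proof (induction cs arbitrary: bs acc)
    case (Cons c cs)
    show ?case
    proof (cases bs)
      case Nil
      then show ?thesis using M_power_ge[of 4]
        by (intro computesI) (simp_all add: nth_iso_program body_lincomb_def)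
    next
      case (Cons b bs')
      have IH: "computes fn_lincomb
          [field_env, enc_vec cs, enc_vecs bs', enc_vec (vec_add acc (vec_scale c b))]
          (enc_vec (add_lincomb cs bs' (vec_add acc (vec_scale c b)))) (loop_cost 4 (length cs))"
        using Cons.prems Cons by (intro Cons.IH) auto
      show ?thesis using M_power_ge[of 4] Cons.prems Cons
        by (intro computesI) (auto simp: nth_iso_program body_lincomb_def
            intro!: wp_callI[OF IH] call[OF computes_add] call[OF computes_scale])
    qed
  qed (use M_power_ge[of 4] in \<open>intro computesI; simp add: nth_iso_program body_lincomb_def\<close>)
qed (use assms in simp_all)

lemma computes_apply:
  assumes "length u < M" "length acc < M" "length xs < M"
  shows "computes fn_apply [field_env, enc_vec xs, enc_vec u, enc_vec acc]
    (enc_vec (add_columns xs u acc)) (M ^ 6)"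
proof (rule loop_bound)
  note call = call_within[where d = 4]
  show "computes fn_apply [field_env, enc_vec xs, enc_vec u, enc_vec acc]
      (enc_vec (add_columns xs u acc)) (loop_cost 4 (length xs))"
    using assms(1,2)
  proof (induction xs arbitrary: u acc)
    case (Cons x xs)
    have IH: "computes fn_apply
        [field_env, enc_vec xs, enc_vec (drop (length acc) u),
         enc_vec (vec_add acc (vec_scale x u))]
        (enc_vec (add_columns xs (drop (length acc) u) (vec_add acc (vec_scale x u))))
        (loop_cost 4 (length xs))"
      using Cons.prems by (intro Cons.IH) auto
    show ?case using M_power_ge[of 4] Cons.prems
      by (intro computesI) (auto simp: nth_iso_program body_apply_def
          intro!: wp_callI[OF IH] call[OF computes_add] call[OF computes_scale]
            call[OF computes_drop])
  qed (use M_power_ge[of 4] in \<open>intro computesI; simp add: nth_iso_program body_apply_def\<close>)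
qed (use assms in simp_all)

subsection \<open>Values of forms\<close>

lemma computes_pairs:
  assumes "length v \<le> n"
  shows "computes fn_pairs [field_env, enc_vec v] (enc_vec (pair_products v)) (M ^ 6)"
proof (rule loop_bound)
  note call = call_within[where d = 4]
  show "computes fn_pairs [field_env, enc_vec v]
      (enc_vec (pair_products v)) (loop_cost 4 (length v))"
    using assms
  proof (induction v)
    case (Cons a v)
    have scale: "computes fn_scale [field_env, enc_elem a, CONS (enc_elem a) (enc_vec v)]
        (enc_vec (vec_scale a (a # v))) (M ^ 4)"
      using computes_scale[of "a # v" a] Cons.prems n_bounds(1) by simp
    show ?case using M_power_ge[of 4] Cons.prems n_bounds(1)
      by (intro computesI) (auto simp: nth_iso_program body_pairs_def simp del: vec_simps(5)
          intro!: wp_callI[OF Cons.IH] call[OF scale] call[OF computes_append])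
  qed (use M_power_ge[of 4] in \<open>intro computesI; simp add: nth_iso_program body_pairs_def\<close>)
qed (use assms n_bounds(1) in simp_all)

lemma length_pair_products_less: "length v \<le> n \<Longrightarrow> length (pair_products v) < M"
  using length_pair_products[of v] mult_mono[of "length v" n "length v" n] n_bounds(2) by simp

lemma computes_triples:
  assumes "length v \<le> n"
  shows "computes fn_triples [field_env, enc_vec v] (enc_vec (triple_products v)) (M ^ 8)"
proof (rule loop_bound)
  note call = call_within[where d = 6]
  show "computes fn_triples [field_env, enc_vec v]
      (enc_vec (triple_products v)) (loop_cost 6 (length v))"
    using assms
  proof (induction v)
    case (Cons a v)
    have pairs: "computes fn_pairs [field_env, CONS (enc_elem a) (enc_vec v)]
        (enc_vec (pair_products (a # v))) (M ^ 6)"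
      using computes_pairs[of "a # v"] Cons.prems by simp
    show ?case using M_power_ge[of 6] Cons.prems length_pair_products_less[OF Cons.prems]
      by (intro computesI)
        (auto simp: nth_iso_program body_triples_def simp del: pair_products.simps
          intro!: wp_callI[OF Cons.IH] call[OF pairs] call[OF computes_append]
            call[OF computes_scale])
  qed (use M_power_ge[of 6] in \<open>intro computesI; simp add: nth_iso_program body_triples_def\<close>)
qed (use assms n_bounds(1) in simp_all)

lemma computes_value:
  assumes "length h < M" "length x \<le> n"
  shows "computes fn_value [field_env, enc_vec h, enc_vec x] (enc_elem (form_value h x)) (M ^ 9)"
proof (rule straight_bound)
  note call = call_within[where d = 8]
  show "computes fn_value [field_env, enc_vec h, enc_vec x]
      (enc_elem (form_value h x)) (900 * M ^ 8)"
    using M_power_ge[of 8] assms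
    by (intro computesI) (auto simp: nth_iso_program body_value_def form_value_def
        intro!: call[OF computes_dot] call[OF computes_triples])
qed simp

lemma computes_polar:
  assumes "length h < M" "length x = n" "length y = n" "length z = n"
  shows "computes fn_polar [field_env, enc_vec h, enc_vec x, enc_vec y, enc_vec z]
    (enc_elem (polar_value h x y z)) (M ^ 10)"
proof (rule straight_bound)
  note call = call_within[where d = 9]
  show "computes fn_polar [field_env, enc_vec h, enc_vec x, enc_vec y, enc_vec z]
      (enc_elem (polar_value h x y z)) (900 * M ^ 9)"
    using M_power_ge[of 9] assms n_bounds(1)
    by (intro computesI) (auto simp: nth_iso_program body_polar_def polar_value_def
        intro!: call[OF computes_value] call[OF computes_add] call[OF computes_neg]
          call[OF computes_row] call[OF computes_add_entry])
qed simp

subsection \<open>The linear system\<close>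

lemma computes_polar_row:
  assumes "length h < M" "length x = n" "length y = n" "\<forall>z\<in>set Es. length z = n" "length Es < M"
  shows "computes fn_polar_row [field_env, enc_vec h, enc_vec x, enc_vec y, enc_vecs Es]
    (enc_vec (map (polar_value h x y) Es)) (M ^ 12)"
proof (rule loop_bound)
  show "computes fn_polar_row [field_env, enc_vec h, enc_vec x, enc_vec y, enc_vecs Es]
      (enc_vec (map (polar_value h x y) Es)) (loop_cost 10 (length Es))"
    using assms(4)
  proof (induction Es)
    case (Cons z Es)
    show ?case using M_power_ge[of 10] Cons.prems assms(1-3)
      by (intro computesI) (auto simp: nth_iso_program body_polar_row_def
          intro!: wp_callI[OF Cons.IH] wp_callI[OF computes_polar])
  qed (use M_power_ge[of 10] in \<open>intro computesI; simp add: nth_iso_program body_polar_row_def\<close>)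
qed (use assms in simp_all)

lemma computes_outer:
  assumes "length u < M" "length v < M"
  shows "computes fn_outer [field_env, enc_vec u, enc_vec v] (enc_vec (outer_product u v)) (M ^ 6)"
proof (rule loop_bound)
  note call = call_within[where d = 4]
  show "computes fn_outer [field_env, enc_vec u, enc_vec v] (enc_vec (outer_product u v))
      (loop_cost 4 (length u))"
  proof (induction u)
    case (Cons a u)
    show ?case using M_power_ge[of 4] assms(2)
      by (intro computesI) (auto simp: nth_iso_program body_outer_def outer_product_def
          intro!: wp_callI[OF Cons.IH[unfolded outer_product_def]] call[OF computes_scale]
            call[OF computes_append])
  qed (use M_power_ge[of 4] in
      \<open>intro computesI; simp add: nth_iso_program body_outer_def outer_product_def\<close>)
qed (use assms in simp_all)

lemma computes_row_equations:
  assumes "length f < M" "length x = n" "length ej = n" "length row = n"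
    "\<forall>z\<in>set Es. length z = n" "length Es = n" "\<forall>z\<in>set Ks. length z = n" "length Ks < M"
  shows "computes fn_row_equations
    [field_env, enc_vec f, enc_vec x, enc_vec ej, enc_vec row, enc_vecs Ks, enc_vecs Es]
    (enc_vecs (row_equations f x ej row Ks Es)) (M ^ 14)"
proof (rule loop_bound)
  note call = call_within[where d = 12]
  show "computes fn_row_equations
      [field_env, enc_vec f, enc_vec x, enc_vec ej, enc_vec row, enc_vecs Ks, enc_vecs Es]
      (enc_vecs (row_equations f x ej row Ks Es)) (loop_cost 12 (length Ks))"
    using assms(7)
  proof (induction Ks)
    case (Cons z Ks)
    show ?case using M_power_ge[of 12] Cons.prems assms(1-6) n_bounds(1,2)
      by (intro computesI) (auto simp: nth_iso_program body_row_equations_def row_equations_def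
          intro!: wp_callI[OF Cons.IH[unfolded row_equations_def]] call[OF computes_polar_row]
            call[OF computes_outer] call[OF computes_append])
  qed (use M_power_ge[of 12] in
      \<open>intro computesI; simp add: nth_iso_program body_row_equations_def row_equations_def\<close>)
qed (use assms in simp_all)

lemma computes_image_equations:
  assumes "length f < M" "length g < M" "length x = n" "length w = n"
    "\<forall>z\<in>set Es. length z = n" "length Es = n" "\<forall>z\<in>set Js. length z = n" "length Js < M"
  shows "computes fn_image_equations
    [field_env, enc_vec f, enc_vec g, enc_vec x, enc_vec w, enc_vecs Js, enc_vecs Es]
    (enc_vecs (image_equations f g x w Js Es)) (M ^ 16)"
proof (rule loop_bound)
  note call = call_within[where d = 14]
  show "computes fn_image_equations
      [field_env, enc_vec f, enc_vec g, enc_vec x, enc_vec w, enc_vecs Js, enc_vecs Es]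
      (enc_vecs (image_equations f g x w Js Es)) (loop_cost 14 (length Js))"
    using assms(7)
  proof (induction Js)
    case (Cons z Js)
    have "length (row_equations f x ej row Es Es) < M" for ej row
      using assms(6) n_bounds(1) by (simp add: row_equations_def)
    then show ?case using M_power_ge[of 14] Cons.prems assms(1-6) n_bounds(1)
      by (intro computesI) (auto simp: nth_iso_program body_image_equations_def image_equations_def
          intro!: wp_callI[OF Cons.IH[unfolded image_equations_def]] call[OF computes_row_equations]
            call[OF computes_polar_row] call[OF computes_append])
  qed (use M_power_ge[of 14] in
      \<open>intro computesI; simp add: nth_iso_program body_image_equations_def image_equations_def\<close>)
qed (use assms in simp_all)

lemma computes_equations:
  assumes "length f < M" "length g < M" "\<forall>z\<in>set Es. length z = n" "length Es = n"
    "\<forall>z\<in>set xs. length z = n" "\<forall>z\<in>set ws. length z = n" "length xs < M"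
  shows "computes fn_equations
    [field_env, enc_vec f, enc_vec g, enc_vecs xs, enc_vecs ws, enc_vecs Es]
    (enc_vecs (equations f g xs ws Es)) (M ^ 18)"
proof (rule loop_bound)
  note call = call_within[where d = 16]
  show "computes fn_equations
      [field_env, enc_vec f, enc_vec g, enc_vecs xs, enc_vecs ws, enc_vecs Es]
      (enc_vecs (equations f g xs ws Es)) (loop_cost 16 (length xs))"
    using assms(5,6)
  proof (induction xs arbitrary: ws)
    case (Cons x xs)
    show ?case
    proof (cases ws)
      case Nil
      then show ?thesis using M_power_ge[of 16]
        by (intro computesI) (simp_all add: nth_iso_program body_equations_def equations_def)
    next
      case (Cons w ws')
      have IH: "computes fn_equations
          [field_env, enc_vec f, enc_vec g, enc_vecs xs, enc_vecs ws', enc_vecs Es]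
          (enc_vecs (equations f g xs ws' Es)) (loop_cost 16 (length xs))"
        using Cons.IH[of ws'] Cons.prems Cons by simp
      have "length (image_equations f g x w Es Es) < M"
        using assms(4) n_bounds(2) by (simp add: length_image_equations)
      then show ?thesis using M_power_ge[of 16] Cons.prems assms(1-4) n_bounds(1) Cons
        by (intro computesI) (auto simp: nth_iso_program body_equations_def equations_def
            intro!: wp_callI[OF IH[unfolded equations_def]] call[OF computes_image_equations]
              call[OF computes_append])
    qed
  qed (use M_power_ge[of 16] in
      \<open>intro computesI; simp add: nth_iso_program body_equations_def equations_def\<close>)
qed (use assms in simp_all)

lemma computes_eliminate:
  assumes "length l < M" "length p < M" "\<forall>c\<in>set cs. length c < M" "length cs < M"
  shows "computes fn_eliminate [field_env, enc_vec l, enc_vec p, enc_elem s, enc_vecs cs]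
    (enc_vecs (eliminate l p s cs)) (M ^ 6)"
proof (rule loop_bound)
  note call = call_within[where d = 4]
  show "computes fn_eliminate [field_env, enc_vec l, enc_vec p, enc_elem s, enc_vecs cs]
      (enc_vecs (eliminate l p s cs)) (loop_cost 4 (length cs))"
    using assms(3)
  proof (induction cs)
    case (Cons c cs)
    show ?case using M_power_ge[of 4] Cons.prems assms(1,2)
      by (intro computesI) (auto simp: nth_iso_program body_eliminate_def eliminate_def
          intro!: wp_callI[OF Cons.IH[unfolded eliminate_def]] call[OF computes_add]
            call[OF computes_scale] call[OF computes_dot] call[OF computes_neg])
  qed (use M_power_ge[of 4] in
      \<open>intro computesI; simp add: nth_iso_program body_eliminate_def eliminate_def\<close>)
qed (use assms in simp_all)

abbreviation (input) is_zero :: "prod_ring \<Rightarrow> bool" where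
  "is_zero a \<equiv> enc_elem a = enc_elem 0"

lemma computes_restrict:
  assumes "length l < M" "\<forall>c\<in>set bs. length c < M" "length bs < M"
  shows "computes fn_restrict [field_env, enc_vec l, enc_vecs bs]
    (enc_vecs (restrict_basis is_zero l bs)) (M ^ 8)"
proof (rule loop_bound)
  note call = call_within[where d = 6]
  show "computes fn_restrict [field_env, enc_vec l, enc_vecs bs]
      (enc_vecs (restrict_basis is_zero l bs)) (loop_cost 6 (length bs))"
    using assms(2,3)
  proof (induction bs)
    case (Cons b bs)
    show ?case using M_power_ge[of 6] Cons.prems assms(1)
      by (intro computesI) (auto simp: nth_iso_program body_restrict_def
          intro!: wp_callI[OF Cons.IH] call[OF computes_eliminate] call[OF computes_dot]
            call[OF computes_equal_elem])
  qed (use M_power_ge[of 6] in \<open>intro computesI; simp add: nth_iso_program body_restrict_def\<close>)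
qed (use assms in simp_all)

lemma computes_kernel:
  assumes "\<forall>l\<in>set ls. length l < M" "\<forall>c\<in>set bs. length c = N" "N < M"
    "length bs < M" "length ls < M"
  shows "computes fn_kernel [field_env, enc_vecs ls, enc_vecs bs]
    (enc_vecs (kernel_basis is_zero ls bs)) (M ^ 10)"
proof (rule loop_bound)
  show "computes fn_kernel [field_env, enc_vecs ls, enc_vecs bs]
      (enc_vecs (kernel_basis is_zero ls bs)) (loop_cost 8 (length ls))"
    using assms(1,2,4)
  proof (induction ls arbitrary: bs)
    case (Cons l ls)
    let ?bs = "restrict_basis is_zero l bs"
    have "computes fn_kernel [field_env, enc_vecs ls, enc_vecs ?bs]
        (enc_vecs (kernel_basis is_zero ls ?bs)) (loop_cost 8 (length ls))"
      using Cons.prems length_restricted[of bs N] le_less_trans[OF length_restrict_basis]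
      by (intro Cons.IH) auto
    then show ?case using M_power_ge[of 8] Cons.prems assms(3)
      by (intro computesI) (auto simp: nth_iso_program body_kernel_def
          intro!: wp_callI[of fn_kernel] wp_callI[OF computes_restrict])
  qed (use M_power_ge[of 8] in \<open>intro computesI; simp add: nth_iso_program body_kernel_def\<close>)
qed (use assms in simp_all)

subsection \<open>The search for an isomorphism\<close>

definition point_ok ::
    "prod_ring list \<Rightarrow> prod_ring list \<Rightarrow> prod_ring list \<Rightarrow> prod_ring list \<Rightarrow> prod_ring list
      \<Rightarrow> bool" where
  "point_ok f g x y origin \<longleftrightarrow> enc_elem (form_value f x) = enc_elem (form_value g y) \<and>
    (enc_vec y = enc_vec origin \<longrightarrow> enc_vec x = enc_vec origin)"

definition matrix_ok ::
    "prod_ring list \<Rightarrow> prod_ring list \<Rightarrow> prod_ring list \<Rightarrow> prod_ring list list \<Rightarrow> prod_ring list \<Rightarrow> bool"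
  where "matrix_ok f g u V origin \<longleftrightarrow> (\<forall>x\<in>set V. point_ok f g x (add_columns x u origin) origin)"

definition combination_ok ::
    "prod_ring list \<Rightarrow> prod_ring list \<Rightarrow> prod_ring list list \<Rightarrow> prod_ring list \<Rightarrow> prod_ring list list
      \<Rightarrow> prod_ring list list \<Rightarrow> prod_ring list \<Rightarrow> bool" where
  "combination_ok f g V origin css bs acc
    \<longleftrightarrow> (\<exists>cs\<in>set css. matrix_ok f g (add_lincomb cs bs acc) V origin)"

text \<open>The number of unknowns is the length of the first equation. There is none if \<open>n = 0\<close>, and
  then \<^term>\<open>hd_val NIL = NIL\<close> gives the right number.\<close>

definition num_unknowns :: "prod_ring list list \<Rightarrow> nat" where
  "num_unknowns ls = (if ls = [] then 0 else length (hd ls))"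

definition system_ok ::
    "prod_ring list \<Rightarrow> prod_ring list \<Rightarrow> prod_ring list list \<Rightarrow> prod_ring list list \<Rightarrow> prod_ring list
      \<Rightarrow> prod_ring list list \<Rightarrow> bool" where
  "system_ok f g V css origin ls \<longleftrightarrow> combination_ok f g V origin css
     (kernel_basis is_zero ls (unit_vecs unit_elem (num_unknowns ls)))
     (replicate (num_unknowns ls) 0)"

definition images_ok ::
    "prod_ring list \<Rightarrow> prod_ring list \<Rightarrow> prod_ring list list \<Rightarrow> prod_ring list list
      \<Rightarrow> prod_ring list list \<Rightarrow> prod_ring list \<Rightarrow> prod_ring list list list \<Rightarrow> bool" where
  "images_ok f g Es V css origin ts
    \<longleftrightarrow> (\<exists>ws\<in>set ts. system_ok f g V css origin (equations f g Es ws Es))"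

definition iso_test :: "prod_ring list \<Rightarrow> prod_ring list \<Rightarrow> bool" where
  "iso_test f g \<longleftrightarrow> images_ok f g (unit_vecs unit_elem n) (List.n_lists n field_elems)
     (List.n_lists (rank_factor * n) field_elems) (replicate n 0)
     (List.n_lists num_images (List.n_lists n field_elems))"

lemma computes_test_point:
  assumes "length f < M" "length g < M" "length x = n" "length y \<le> n"
  shows "computes fn_test_point
    [field_env, enc_vec f, enc_vec g, enc_vec x, enc_vec y, enc_vec origin]
    (enc_bool (point_ok f g x y origin)) (M ^ 10)"
proof (rule straight_bound)
  note call = call_within[where d = 9]
  show "computes fn_test_point
      [field_env, enc_vec f, enc_vec g, enc_vec x, enc_vec y, enc_vec origin]
      (enc_bool (point_ok f g x y origin)) (900 * M ^ 9)"
    using M_power_ge[of 9] assms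
    by (intro computesI) (auto simp: nth_iso_program body_test_point_def point_ok_def
        intro!: call[OF computes_value] call[OF computes_equal_elem] call[OF computes_equal_vec])
qed simp

lemma computes_test_points:
  assumes "length f < M" "length g < M" "length u < M" "\<forall>x\<in>set V. length x = n" "length V < M"
    "length origin = n"
  shows "computes fn_test_points
    [field_env, enc_vec f, enc_vec g, enc_vec u, enc_vecs V, enc_vec origin]
    (enc_bool (matrix_ok f g u V origin)) (M ^ 12)"
proof (rule loop_bound)
  note call = call_within[where d = 10]
  show "computes fn_test_points
      [field_env, enc_vec f, enc_vec g, enc_vec u, enc_vecs V, enc_vec origin]
      (enc_bool (matrix_ok f g u V origin)) (loop_cost 10 (length V))"
    using assms(4)
  proof (induction V)
    case (Cons x V)
    show ?case
      using M_power_ge[of 10] assms(1-3,6) Cons.prems n_bounds(1) length_add_columns[of x u origin]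
      by (intro computesI) (auto simp: nth_iso_program body_test_points_def
          intro!: wp_callI[OF Cons.IH] call[OF computes_test_point] call[OF computes_apply],
          auto simp: matrix_ok_def)
  qed (use M_power_ge[of 10] in
      \<open>intro computesI; simp add: nth_iso_program body_test_points_def matrix_ok_def\<close>)
qed (use assms in simp_all)

lemma computes_test_combinations:
  assumes "length f < M" "length g < M" "\<forall>x\<in>set V. length x = n" "length V < M" "length origin = n"
    "\<forall>b\<in>set bs. length b < M" "length acc < M" "\<forall>cs\<in>set css. length cs < M" "length css < M"
  shows "computes fn_test_combinations
    [field_env, enc_vec f, enc_vec g, enc_vecs V, enc_vec origin,
     enc_vecs css, enc_vecs bs, enc_vec acc]
    (enc_bool (combination_ok f g V origin css bs acc)) (M ^ 14)"
proof (rule loop_bound)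
  note call = call_within[where d = 12]
  show "computes fn_test_combinations
      [field_env, enc_vec f, enc_vec g, enc_vecs V, enc_vec origin,
       enc_vecs css, enc_vecs bs, enc_vec acc]
      (enc_bool (combination_ok f g V origin css bs acc)) (loop_cost 12 (length css))"
    using assms(8)
  proof (induction css)
    case (Cons cs css)
    show ?case
      using M_power_ge[of 12] assms(1-7) Cons.prems le_less_trans[OF length_add_lincomb assms(7)]
      by (intro computesI) (auto simp: nth_iso_program body_test_combinations_def
          intro!: wp_callI[OF Cons.IH] call[OF computes_test_points] call[OF computes_lincomb],
          auto simp: combination_ok_def)
  qed (use M_power_ge[of 12] in
      \<open>intro computesI; simp add: nth_iso_program body_test_combinations_def combination_ok_def\<close>)
qed (use assms in simp_all)

lemma computes_test_system:
  assumes "length f < M" "length g < M" "\<forall>x\<in>set V. length x = n" "length V < M" "length origin = n"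
    "\<forall>cs\<in>set css. length cs < M" "length css < M" "\<forall>l\<in>set ls. length l < M" "length ls < M"
  shows "computes fn_test_system
    [field_env, enc_vec f, enc_vec g, enc_vecs V, enc_vecs css, enc_vec origin, enc_vecs ls]
    (enc_bool (system_ok f g V css origin ls)) (M ^ 15)"
proof (rule straight_bound)
  note call = call_within[where d = 14]
  let ?N = "num_unknowns ls"
  define first where "first = (if ls = [] then [] else hd ls)"
  have first: "hd_val (enc_vecs ls) = enc_vec first" "length first = ?N"
    by (cases ls) (simp_all add: first_def num_unknowns_def)
  have N_less: "?N < M" using assms(8) M_ge by (auto simp: num_unknowns_def)
  let ?bs = "kernel_basis is_zero ls (unit_vecs unit_elem ?N)"
  have kernel: "computes fn_kernel [field_env, enc_vecs ls, enc_vecs (unit_vecs unit_elem ?N)]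
     (enc_vecs ?bs) (M ^ 10)"
    using assms(8,9) N_less by (intro computes_kernel[of _ _ ?N]) (auto simp: length_unit_vec)
  have units: "computes fn_units [field_env, enc_vec first]
      (enc_vecs (unit_vecs unit_elem ?N)) (M ^ 4)"
    using computes_units[of first enc_elem] first(2) N_less by simp
  have zeros: "computes fn_zeros [field_env, enc_vec first] (enc_vec (replicate ?N 0)) (M ^ 2)"
    using computes_zeros[of first enc_elem] first(2) N_less by simp
  have "\<forall>b\<in>set ?bs. length b < M"
    using length_kernel_vec[OF length_unit_vec] N_less by metis
  then show "computes fn_test_system
      [field_env, enc_vec f, enc_vec g, enc_vecs V, enc_vecs css, enc_vec origin, enc_vecs ls]
      (enc_bool (system_ok f g V css origin ls)) (900 * M ^ 14)"
    using M_power_ge[of 14] assms N_less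
    by (intro computesI) (auto simp: nth_iso_program body_test_system_def system_ok_def first(1)
        intro!: call[OF computes_test_combinations] call[OF kernel] call[OF units] call[OF zeros])
qed simp

lemma computes_test_images:
  assumes "length f < M" "length g < M" "\<forall>x\<in>set V. length x = n" "length V < M" "length origin = n"
    "\<forall>cs\<in>set css. length cs < M" "length css < M" "\<forall>z\<in>set Es. length z = n" "length Es = n"
    "\<forall>ws\<in>set ts. length ws \<le> num_images \<and> (\<forall>z\<in>set ws. length z = n)" "length ts < M"
  shows "computes fn_test_images
    [field_env, enc_vec f, enc_vec g, enc_vecs Es, enc_vecs V, enc_vecs css, enc_vec origin,
      enc_map enc_vecs ts]
    (enc_bool (images_ok f g Es V css origin ts)) (M ^ 20)"
proof (rule loop_bound)
  note call = call_within[where d = 18]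
  show "computes fn_test_images
      [field_env, enc_vec f, enc_vec g, enc_vecs Es, enc_vecs V, enc_vecs css, enc_vec origin,
        enc_map enc_vecs ts]
      (enc_bool (images_ok f g Es V css origin ts)) (loop_cost 18 (length ts))"
    using assms(10)
  proof (induction ts)
    case (Cons ws ts)
    have "length (equations f g Es ws Es) \<le> length ws * (n * n)"
      using length_equations[of f g Es ws Es] assms(9) by simp
    also have "\<dots> \<le> num_images * (n * n)" using Cons.prems by (intro mult_right_mono) auto
    finally have "length (equations f g Es ws Es) < M" using n_bounds(5) by simp
    moreover have "\<forall>l\<in>set (equations f g Es ws Es). length l < M"
      using length_equation[of Es] assms(8,9) n_bounds(3) by metis
    ultimately show ?case using M_power_ge[of 18] assms(1-9) Cons.prems n_bounds(1)
      by (intro computesI) (auto simp: nth_iso_program body_test_images_def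
          intro!: wp_callI[OF Cons.IH] call[OF computes_test_system] call[OF computes_equations],
          auto simp: images_ok_def)
  qed (use M_power_ge[of 18] in
      \<open>intro computesI; simp add: nth_iso_program body_test_images_def images_ok_def\<close>)
qed (use assms in simp_all)

lemma computes_coeff_vectors:
  assumes "k < M" "q ^ k < M"
  shows "computes fn_tuples [enc_nat k, enc_vec field_elems]
    (enc_vecs (List.n_lists k field_elems)) (M ^ 6)"
  using assms two_le_q q_less_M
  by (intro computes_tuples) (auto simp: length_field_elems field_elems_def)

lemma computes_image_lists:
  "computes fn_tuples [enc_nat num_images, enc_vecs (List.n_lists n field_elems)]
    (enc_map enc_vecs (List.n_lists num_images (List.n_lists n field_elems))) (M ^ 6)"
proof (rule computes_tuples)
  let ?pts = "List.n_lists n field_elems"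
  have "q ^ n < M" "q ^ (n * num_images) < M"
    by (simp_all add: q_power_less_M num_images_def)
  then show "?pts \<noteq> []" "length ?pts < M" "length ?pts ^ num_images < M"
    using two_le_q
    by (auto simp: length_n_lists length_field_elems simp flip: power_mult length_greater_0_conv)
qed (use M_ge in \<open>simp add: num_images_def\<close>)

lemma computes_search:
  assumes "length f < M" "length g < M"
  shows "computes fn_search [field_env, enc_nat n, enc_vec f, enc_vec g]
      (enc_bool (iso_test f g)) (M ^ 21)"
proof (rule straight_bound)
  note call = call_within[where d = 20]
  let ?pts = "List.n_lists n field_elems" and ?css = "List.n_lists (rank_factor * n) field_elems"
  have powers: "q ^ n < M" "q ^ (rank_factor * n) < M" "q ^ (n * num_images) < M"
    by (simp_all add: q_power_less_M num_images_def rank_factor_def)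
  have units: "computes fn_units [field_env, enc_nat n] (enc_vecs (unit_vecs unit_elem n)) (M ^ 4)"
    using computes_units[of "replicate n ()" "\<lambda>_. NIL"] n_bounds(1)
    by (simp add: enc_nat_conv_enc_map)
  have zeros: "computes fn_zeros [field_env, enc_nat n] (enc_vec (replicate n 0)) (M ^ 2)"
    using computes_zeros[of "replicate n ()" "\<lambda>_. NIL"] n_bounds(1)
    by (simp add: enc_nat_conv_enc_map)
  note points = computes_coeff_vectors[OF n_bounds(1) powers(1)]
    and coeffs = computes_coeff_vectors[OF n_bounds(6) powers(2)]
  have times: "computes fn_times [enc_nat rank_factor, enc_nat n]
      (enc_nat (rank_factor * n)) (M ^ 4)"
    using M_ge n_bounds(1) by (intro computes_times) (auto simp: rank_factor_def)
  have test: "computes fn_test_images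
      [field_env, enc_vec f, enc_vec g, enc_vecs (unit_vecs unit_elem n), enc_vecs ?pts,
       enc_vecs ?css, enc_vec (replicate n 0), enc_map enc_vecs (List.n_lists num_images ?pts)]
      (enc_bool (iso_test f g)) (M ^ 20)"
    unfolding iso_test_def using assms powers n_bounds(6)
    by (intro computes_test_images)
      (auto simp: length_n_lists length_field_elems length_unit_vec set_n_lists
        simp flip: power_mult)
  show "computes fn_search [field_env, enc_nat n, enc_vec f, enc_vec g]
      (enc_bool (iso_test f g)) (900 * M ^ 20)"
    using M_power_ge[of 20]
    by (intro computesI) (auto simp: nth_iso_program body_search_def
        intro!: call[OF units] call[OF zeros] call[OF points] call[OF coeffs]
          call[OF computes_image_lists] call[OF times] call[OF test],
          simp add: rank_factor_def num_images_def)
qed simp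

lemma computes_zero_elem:
  "computes fn_find [enc_vec field_elems, enc_table q (add R), NIL, NIL] (enc_elem 0) (M ^ 4)"
proof -
  interpret cring R by (rule cring_R)
  have "computes fn_find [enc_vec field_elems, enc_table q (add R), enc_nat 0, enc_nat 0]
      (enc_nat (proj R 0)) (M ^ 4)"
  proof (rule computes_find)
    have zero: "0 \<in> carrier R" using two_le_q by (simp add: carrier_R)
    then show "proj R 0 \<oplus>\<^bsub>R\<^esub> 0 = 0" by (simp add: proj_hom[OF cring_R])
    fix s assume "s < q" "s \<oplus>\<^bsub>R\<^esub> 0 = 0"
    then have s_carrier: "s \<in> carrier R" "s \<oplus>\<^bsub>R\<^esub> 0 = 0" by (simp_all add: carrier_R)
    then have "s = s \<oplus>\<^bsub>R\<^esub> 0 \<oplus>\<^bsub>R\<^esub> (\<ominus>\<^bsub>R\<^esub> 0)" using zero by (simp add: a_assoc r_neg)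
    also have "\<dots> = \<zero>\<^bsub>R\<^esub>" using s_carrier zero by (simp add: r_neg)
    finally show "s = proj R 0" by (simp add: proj_hom[OF cring_R])
  qed (use two_le_q proj_less a_closed in \<open>auto simp: carrier_R\<close>)
  then show ?thesis by (simp add: enc_elem_def)
qed

lemma computes_unit_elem:
  assumes "x < q" "x \<noteq> \<zero>\<^bsub>R\<^esub>"
  shows "computes fn_find [enc_vec field_elems, enc_table q (monoid.mult R), enc_nat x, enc_nat x]
    (enc_elem unit_elem) (M ^ 4)"
proof -
  interpret field R by (rule field_R)
  have x_carrier: "x \<in> carrier R" using assms by (simp add: carrier_R)
  have "computes fn_find [enc_vec field_elems, enc_table q (monoid.mult R), enc_nat x, enc_nat x]
      (enc_nat \<one>\<^bsub>R\<^esub>) (M ^ 4)"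
  proof (rule computes_find)
    show "\<one>\<^bsub>R\<^esub> \<otimes>\<^bsub>R\<^esub> x = x" using x_carrier by simp
    fix s assume "s < q" "s \<otimes>\<^bsub>R\<^esub> x = x"
    then show "s = \<one>\<^bsub>R\<^esub>"
      using x_carrier assms(2) by (metis carrier_R lessThan_iff l_one m_rcancel one_closed)
  qed (use x_carrier m_closed one_closed in \<open>auto simp: carrier_R\<close>)
  then show ?thesis by (simp add: enc_elem_def cring_R)
qed

lemma computes_find_one:
  assumes "length f < M" "length g < M"
  shows "computes fn_find_one [enc_nat n, enc_vec field_elems, enc_table q (add R),
      enc_table q (monoid.mult R), enc_vec f, enc_vec g, enc_elem 0]
      (enc_bool (iso_test f g)) (M ^ 22)"
proof (rule straight_bound)
  note call = call_within[where d = 21]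
  define x :: nat where "x = (if \<zero>\<^bsub>R\<^esub> = 0 then 1 else 0)"
  have "x < q" "x \<noteq> \<zero>\<^bsub>R\<^esub>" using two_le_q by (auto simp: x_def)
  note unit = computes_unit_elem[OF this]
  have search: "computes fn_search [field_env, enc_nat n, enc_vec f, enc_vec g]
      (enc_bool (iso_test f g)) (M ^ 21)"
    using assms by (rule computes_search)
  have "enc_elem 0 = NIL \<longleftrightarrow> \<zero>\<^bsub>R\<^esub> = 0" by (simp add: enc_elem_def proj_hom[OF cring_R])
  moreover have "enc_nat x = (if \<zero>\<^bsub>R\<^esub> = 0 then CONS NIL NIL else NIL)" by (simp add: x_def)
  ultimately show "computes fn_find_one [enc_nat n, enc_vec field_elems, enc_table q (add R),
      enc_table q (monoid.mult R), enc_vec f, enc_vec g, enc_elem 0]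
      (enc_bool (iso_test f g)) (900 * M ^ 21)"
    using M_power_ge[of 21] unit search
    by (intro computesI) (auto simp: nth_iso_program body_find_one_def field_env_def
        intro!: call[of fn_find] call[of fn_search])
qed simp

lemma computes_find_zero:
  assumes "length f < M" "length g < M"
  shows "computes fn_find_zero [enc_nat n, enc_vec field_elems, enc_table q (add R),
      enc_table q (monoid.mult R), enc_vec f, enc_vec g] (enc_bool (iso_test f g)) (M ^ 23)"
proof (rule straight_bound)
  note call = call_within[where d = 22]
  show "computes fn_find_zero [enc_nat n, enc_vec field_elems, enc_table q (add R),
      enc_table q (monoid.mult R), enc_vec f, enc_vec g] (enc_bool (iso_test f g)) (900 * M ^ 22)"
    using M_power_ge[of 22] assms
    by (intro computesI) (auto simp: nth_iso_program body_find_zero_def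
        intro!: call[OF computes_zero_elem] call[OF computes_find_one])
qed simp

lemma computes_field_elems: "computes fn_elements [enc_nat q] (enc_vec field_elems) (M ^ 2)"
  unfolding enc_field_elems by (rule short_loop_bound[OF computes_elements q_less_M])

lemma enc_cubic_form_eq:
  assumes "\<And>m. h m \<in> carrier R"
  shows "enc_cubic_form n h = enc_vec (cubic_coeffs n (emb_form R h))"
proof -
  have "enc_vec (cubic_coeffs n (emb_form R h))
      = enc_list (cubic_coeffs n (\<lambda>m. enc_elem (emb_form R h m)))"
    by (simp add: enc_map_def map_cubic_coeffs)
  also have "(\<lambda>m. enc_elem (emb_form R h m)) = (\<lambda>m. enc_nat (h m))"
    using assms by (simp add: enc_elem_def emb_form_def cring_R)
  finally show ?thesis by (simp add: enc_cubic_form_def cubic_coeffs_def)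
qed

lemma computes_main:
  assumes fg: "\<And>m. f m \<in> carrier R" "\<And>m. g m \<in> carrier R"
  shows "computes fn_main (enc_input R q n f g)
    (enc_bool (iso_test (cubic_coeffs n (emb_form R f)) (cubic_coeffs n (emb_form R g)))) (M ^ 24)"
proof (rule straight_bound)
  note call = call_within[where d = 23]
  have "length (cubic_coeffs n h) < M" for h :: "nat multiset \<Rightarrow> prod_ring"
    using length_cubic_coeffs[of n h] n_bounds(4) by (simp add: mult.assoc)
  then show "computes fn_main (enc_input R q n f g)
      (enc_bool (iso_test (cubic_coeffs n (emb_form R f)) (cubic_coeffs n (emb_form R g))))
      (900 * M ^ 23)"
    using M_power_ge[of 23]
    by (intro computesI)
      (auto simp: nth_iso_program body_main_def enc_input_def enc_cubic_form_eq[OF fg(1)]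
        enc_cubic_form_eq[OF fg(2)] simp del: One_nat_def
        intro!: call[OF computes_field_elems] call[OF computes_find_zero])
qed simp

lemma iso_program_decides:
  assumes "\<And>m. f m \<in> carrier R" "\<And>m. g m \<in> carrier R"
  shows "halts_within iso_program (enc_input R q n f g) (M ^ 24)"
    "accepts iso_program (enc_input R q n f g) \<longleftrightarrow>
      iso_test (cubic_coeffs n (emb_form R f)) (cubic_coeffs n (emb_form R g))"
proof -
  let ?test = "iso_test (cubic_coeffs n (emb_form R f)) (cubic_coeffs n (emb_form R g))"
  have "computes fn_main (enc_input R q n f g) (enc_bool ?test) (M ^ 24)"
    by (rule computes_main[OF assms])
  then obtain k where run_k: "run iso_program (enc_input R q n f g) (enc_bool ?test) k" "k \<le> M ^ 24"
    by (auto simp: computes_def wp_call_def wp_def run_def)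
  then show "halts_within iso_program (enc_input R q n f g) (M ^ 24)"
    by (auto simp: halts_within_def)
  show "accepts iso_program (enc_input R q n f g) \<longleftrightarrow> ?test"
    using run_k(1) run_deterministic[OF run_k(1)] unfolding accepts_def by fastforce
qed

end

section \<open>Enumerating the kernel\<close>

lemma nth_vec_add [simp]: "i < length u \<Longrightarrow> i < length v \<Longrightarrow> vec_add u v ! i = u ! i + v ! i"
  by (simp add: vec_add_def)

lemma nth_vec_scale [simp]: "i < length v \<Longrightarrow> vec_scale c v ! i = c * v ! i"
  by (simp add: vec_scale_def)

lemma vec_dot_sum: "length l = N \<Longrightarrow> length v = N \<Longrightarrow> vec_dot l v = (\<Sum>i<N. l ! i * v ! i)"
  by (simp add: vec_dot_def sum_list_sum_nth atLeast0LessThan)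

lemma vec_dot_add:
  "length l = N \<Longrightarrow> length u = N \<Longrightarrow> length v = N \<Longrightarrow> vec_dot l (vec_add u v) = vec_dot l u + vec_dot l v"
  by (simp add: vec_dot_sum[of _ N] distrib_left sum.distrib)

lemma vec_dot_scale:
  "length l = N \<Longrightarrow> length v = N \<Longrightarrow> vec_dot l (vec_scale a v) = a * vec_dot l v"
  by (simp add: vec_dot_sum[of _ N] sum_distrib_left mult_ac)

definition lincomb :: "nat \<Rightarrow> 'u :: comm_ring_1 list \<Rightarrow> 'u list list \<Rightarrow> 'u list" where
  "lincomb N cs bs = map (\<lambda>i. \<Sum>k<length bs. cs ! k * bs ! k ! i) [0..<N]"

lemma length_lincomb [simp]: "length (lincomb N cs bs) = N"
  by (simp add: lincomb_def)

lemma nth_lincomb: "i < N \<Longrightarrow> lincomb N cs bs ! i = (\<Sum>k<length bs. cs ! k * bs ! k ! i)"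
  by (simp add: lincomb_def)

lemma nth_lincomb_Cons: "i < N \<Longrightarrow> lincomb N (a # cs) (c # bs) ! i = a * c ! i + lincomb N cs bs ! i"
  by (simp add: nth_lincomb sum.lessThan_Suc_shift del: sum.lessThan_Suc)

lemma add_lincomb_eq:
  "length bs \<le> length cs \<Longrightarrow> \<forall>b\<in>set bs. length b = N \<Longrightarrow> length acc = N \<Longrightarrow>
    add_lincomb cs bs acc = vec_add acc (lincomb N cs bs)"
proof (induction cs bs acc rule: add_lincomb.induct)
  case (1 c cs b bs acc)
  then show ?case by (intro nth_equalityI) (auto simp: nth_lincomb_Cons)
qed (auto intro!: nth_equalityI simp: nth_lincomb)

definition add_multiple :: "'u :: comm_ring_1 list \<Rightarrow> 'u \<times> 'u list \<Rightarrow> 'u list" where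
  "add_multiple c x = vec_add (vec_scale (fst x) c) (snd x)"

lemma lincomb_Cons:
  "length c = N \<Longrightarrow> lincomb N (a # cs) (c # bs) = add_multiple c (a, lincomb N cs bs)"
  by (intro nth_equalityI) (auto simp: nth_lincomb_Cons add_multiple_def)

lemma vec_dot_add_multiple:
  "length l = N \<Longrightarrow> length c = N \<Longrightarrow> length u = N \<Longrightarrow>
    vec_dot l (add_multiple c (a, u)) = a * vec_dot l c + vec_dot l u"
  by (simp add: vec_dot_add[of _ N] vec_dot_scale[of _ N] add_multiple_def)

context finite_subfield
begin

definition vecs :: "nat \<Rightarrow> 'u list set" where
  "vecs N = {v. set v \<subseteq> K \<and> length v = N}"



lemma card_vecs: "card (vecs N) = q ^ N"
  unfolding vecs_def q_def by (rule card_lists_length_eq) simp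

lemma vecsI: "length v = N \<Longrightarrow> (\<And>i. i < N \<Longrightarrow> v ! i \<in> K) \<Longrightarrow> v \<in> vecs N"
  by (auto simp: vecs_def in_set_conv_nth)

lemma vecsD: "v \<in> vecs N \<Longrightarrow> length v = N" "v \<in> vecs N \<Longrightarrow> i < N \<Longrightarrow> v ! i \<in> K"
  by (auto simp: vecs_def)

lemma vecs_0: "vecs 0 = {[]}"
  by (auto simp: vecs_def)

lemma vecs_Suc: "v \<in> vecs (Suc N) \<longleftrightarrow> (\<exists>a u. v = a # u \<and> a \<in> K \<and> u \<in> vecs N)"
  by (cases v) (auto simp: vecs_def)

lemma vec_add_vecs: "u \<in> vecs N \<Longrightarrow> v \<in> vecs N \<Longrightarrow> vec_add u v \<in> vecs N"
  by (intro vecsI) (auto simp: vecsD)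

lemma vec_scale_vecs: "c \<in> K \<Longrightarrow> v \<in> vecs N \<Longrightarrow> vec_scale c v \<in> vecs N"
  by (intro vecsI) (auto simp: vecsD)

lemma vec_dot_K: "l \<in> vecs N \<Longrightarrow> v \<in> vecs N \<Longrightarrow> vec_dot l v \<in> K"
  by (auto simp: vec_dot_sum[of _ N] vecsD intro!: sum_K mult_K)

lemma lincomb_vecs:
  assumes "cs \<in> vecs (length bs)" "set bs \<subseteq> vecs N"
  shows "lincomb N cs bs \<in> vecs N"
proof (rule vecsI)
  fix i assume i_less: "i < N"
  have "cs ! k * bs ! k ! i \<in> K" if k_less: "k < length bs" for k
  proof -
    have "bs ! k \<in> vecs N" using assms(2) nth_mem[OF k_less] by auto
    then show ?thesis using vecsD(2)[OF assms(1) k_less] vecsD(2) i_less by (intro mult_K) auto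
  qed
  then show "lincomb N cs bs ! i \<in> K" unfolding nth_lincomb[OF i_less] by (intro sum_K) simp
qed simp

lemma add_lincomb_vecs:
  "set cs \<subseteq> K \<Longrightarrow> set bs \<subseteq> vecs N \<Longrightarrow> acc \<in> vecs N \<Longrightarrow> add_lincomb cs bs acc \<in> vecs N"
  by (induction cs bs acc rule: add_lincomb.induct) (auto simp: vec_add_vecs vec_scale_vecs)

lemma vec_scale_inverse:
  assumes "s' * s = e" "u \<in> vecs N"
  shows "vec_scale s' (vec_scale s u) = u"
proof (rule nth_equalityI)
  fix i assume "i < length (vec_scale s' (vec_scale s u))"
  then have i_less: "i < length u" by simp
  then have "s' * s * u ! i = u ! i" using assms vecsD[OF assms(2)] e_mult by simp
  then show "vec_scale s' (vec_scale s u) ! i = u ! i" using i_less by (simp add: mult.assoc)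
qed simp



definition basis :: "nat \<Rightarrow> 'u list list \<Rightarrow> 'u list set \<Rightarrow> bool" where
  "basis N bs V \<longleftrightarrow> set bs \<subseteq> vecs N \<and> bij_betw (\<lambda>cs. lincomb N cs bs) (vecs (length bs)) V"

lemma card_basis: "basis N bs V \<Longrightarrow> card V = q ^ length bs"
  unfolding basis_def using bij_betw_same_card card_vecs by metis

lemma basis_vecs: "basis N bs V \<Longrightarrow> V \<subseteq> vecs N"
  by (auto simp: basis_def bij_betw_def lincomb_vecs)

lemma basis_Nil: "basis N [] V \<longleftrightarrow> V = {lincomb N [] []}"
  by (auto simp: basis_def bij_betw_def vecs_0)

lemma basis_scale:
  assumes "basis N bs V" "s \<in> K" "u \<in> V"
  shows "vec_scale s u \<in> V"
proof -
  obtain cs where cs_vecs: "cs \<in> vecs (length bs)" "u = lincomb N cs bs"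
    using assms(1,3) by (auto simp: basis_def bij_betw_def)
  have "vec_scale s u = lincomb N (vec_scale s cs) bs"
    unfolding cs_vecs(2) using vecsD(1)[OF cs_vecs(1)]
    by (intro nth_equalityI) (auto simp: nth_lincomb sum_distrib_left mult.assoc)
  then show ?thesis
    using assms(1) vec_scale_vecs[OF assms(2) cs_vecs(1)] by (auto simp: basis_def bij_betw_def)
qed

lemma bij_betw_Cons: "bij_betw (\<lambda>(a, u). a # u) (K \<times> vecs N) (vecs (Suc N))"
  by (auto simp: bij_betw_def inj_on_def vecs_Suc image_iff)

lemma basis_Cons:
  assumes c_vecs: "c \<in> vecs N"
  shows "basis N (c # bs) V \<longleftrightarrow> (\<exists>U. basis N bs U \<and> bij_betw (add_multiple c) (K \<times> U) V)"
proof -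
  let ?C = "vecs (length bs)"
  let ?f = "\<lambda>(a, cs). (a, lincomb N cs bs)"
  have "bij_betw (\<lambda>cs. lincomb N cs (c # bs)) (vecs (Suc (length bs))) V
      \<longleftrightarrow> bij_betw ((\<lambda>cs. lincomb N cs (c # bs)) \<circ> (\<lambda>(a, u). a # u)) (K \<times> ?C) V"
    using bij_betw_comp_iff[OF bij_betw_Cons] .
  also have "\<dots> \<longleftrightarrow> bij_betw (add_multiple c \<circ> ?f) (K \<times> ?C) V"
    by (intro bij_betw_cong) (auto simp: lincomb_Cons vecsD(1)[OF c_vecs])
  finally have Cons: "bij_betw (\<lambda>cs. lincomb N cs (c # bs)) (vecs (Suc (length bs))) V
      \<longleftrightarrow> bij_betw (add_multiple c \<circ> ?f) (K \<times> ?C) V" .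
  show ?thesis
  proof
    assume V_basis: "basis N (c # bs) V"
    then have comp: "bij_betw (add_multiple c \<circ> ?f) (K \<times> ?C) V" by (simp add: basis_def Cons)
    define U where "U = (\<lambda>cs. lincomb N cs bs) ` ?C"
    have inj: "inj_on ?f (K \<times> ?C)" using comp inj_on_imageI2 by (auto simp: bij_betw_def)
    have "inj_on (\<lambda>cs. lincomb N cs bs) ?C"
      using inj_onD[OF inj, of "(0, _)" "(0, _)"] by (auto intro!: inj_onI)
    then have U_basis: "basis N bs U" using V_basis by (auto simp: basis_def U_def bij_betw_def)
    have image_f: "?f ` (K \<times> ?C) = K \<times> U" by (auto simp: U_def)
    from comp have "bij_betw (add_multiple c) (K \<times> U) V"
      unfolding bij_betw_def image_f[symmetric] by (auto simp: image_comp intro: inj_on_imageI)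
    with U_basis show "\<exists>U. basis N bs U \<and> bij_betw (add_multiple c) (K \<times> U) V" by blast
  next
    assume "\<exists>U. basis N bs U \<and> bij_betw (add_multiple c) (K \<times> U) V"
    then obtain U where U_basis: "basis N bs U" "bij_betw (add_multiple c) (K \<times> U) V" by blast
    from U_basis(1) have "bij_betw ?f (K \<times> ?C) (K \<times> U)"
      by (auto simp: basis_def bij_betw_def inj_on_def)
    from bij_betw_trans[OF this U_basis(2)] show "basis N (c # bs) V"
      using U_basis(1) c_vecs by (simp add: basis_def Cons)
  qed
qed

lemma vec_dot_lincomb:
  assumes "length l = N" "set bs \<subseteq> vecs N"
  shows "vec_dot l (lincomb N cs bs) = (\<Sum>k<length bs. cs ! k * vec_dot l (bs ! k))"
proof -
  have "vec_dot l (lincomb N cs bs) = (\<Sum>i<N. \<Sum>k<length bs. cs ! k * (l ! i * bs ! k ! i))"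
    using assms by (simp add: vec_dot_sum[of _ N] nth_lincomb sum_distrib_left mult_ac)
  also have "\<dots> = (\<Sum>k<length bs. cs ! k * vec_dot l (bs ! k))"
    unfolding sum_distrib_left
    by (subst sum.swap, intro sum.cong refl)
      (use assms in \<open>auto simp: vec_dot_sum[of _ N] vecsD(1)[of _ N] subset_iff sum_distrib_left\<close>)
  finally show ?thesis .
qed

lemma lincomb_eliminate:
  assumes "length l = N" "set bs \<subseteq> vecs N" "length c = N"
  shows "lincomb N d (eliminate l c s bs)
    = add_multiple c (- vec_dot l (lincomb N d bs), vec_scale s (lincomb N d bs))"
proof (rule nth_equalityI)
  fix i assume "i < length (lincomb N d (eliminate l c s bs))"
  then have i_less: "i < N" by simp
  have len: "length (bs ! k) = N" if "k < length bs" for k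
    using assms(2) that nth_mem vecsD(1) by blast
  have "lincomb N d (eliminate l c s bs) ! i
      = (\<Sum>k<length bs. d ! k * (s * bs ! k ! i + - vec_dot l (bs ! k) * c ! i))"
    using i_less assms(3) len by (simp add: nth_lincomb eliminate_def)
  also have "\<dots> = s * lincomb N d bs ! i + - vec_dot l (lincomb N d bs) * c ! i"
    using i_less
    by (simp add: nth_lincomb vec_dot_lincomb[OF assms(1,2)] sum_distrib_left sum_distrib_right
        sum_subtractf algebra_simps)
  finally show "lincomb N d (eliminate l c s bs) ! i
      = add_multiple c (- vec_dot l (lincomb N d bs), vec_scale s (lincomb N d bs)) ! i"
    using i_less assms(3) by (simp add: add.commute add_multiple_def)
qed (use assms in \<open>simp add: add_multiple_def\<close>)

context
  fixes N l c U V
  assumes l_vecs: "l \<in> vecs N" and c_vecs: "c \<in> vecs N" and U_vecs: "U \<subseteq> vecs N"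
    and bij: "bij_betw (add_multiple c) (K \<times> U) V"
begin

lemma dot_add_multiple: "u \<in> U \<Longrightarrow> vec_dot l (add_multiple c (a, u)) = a * vec_dot l c + vec_dot l u"
  using vecsD(1) l_vecs c_vecs U_vecs by (intro vec_dot_add_multiple[of _ N]) auto

lemma bij_betw_kernel:
  "bij_betw (add_multiple c) {(a, u) \<in> K \<times> U. a * vec_dot l c + vec_dot l u = 0}
    {v \<in> V. vec_dot l v = 0}"
proof (rule bij_betw_subset[OF bij])
  show "add_multiple c ` {(a, u) \<in> K \<times> U. a * vec_dot l c + vec_dot l u = 0}
      = {v \<in> V. vec_dot l v = 0}"
  proof (intro equalityI subsetI)
    fix v assume "v \<in> {v \<in> V. vec_dot l v = 0}"
    then obtain a u where "a \<in> K" "u \<in> U" "v = add_multiple c (a, u)" "vec_dot l v = 0"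
      using bij by (auto simp: bij_betw_def)
    then show "v \<in> add_multiple c ` {(a, u) \<in> K \<times> U. a * vec_dot l c + vec_dot l u = 0}"
      by (auto simp: dot_add_multiple)
  next
    fix v assume "v \<in> add_multiple c ` {(a, u) \<in> K \<times> U. a * vec_dot l c + vec_dot l u = 0}"
    then obtain a u where "a \<in> K" "u \<in> U" "v = add_multiple c (a, u)"
      "a * vec_dot l c + vec_dot l u = 0"
      by blast
    moreover from this have "v \<in> V" using bij by (auto simp: bij_betw_def)
    ultimately show "v \<in> {v \<in> V. vec_dot l v = 0}"
      by (simp add: dot_add_multiple)
  qed
qed auto

lemma bij_betw_kernel_zero:
  assumes "vec_dot l c = 0"
  shows "bij_betw (add_multiple c) (K \<times> {u \<in> U. vec_dot l u = 0}) {v \<in> V. vec_dot l v = 0}"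
proof -
  have "{(a, u) \<in> K \<times> U. a * vec_dot l c + vec_dot l u = 0} = K \<times> {u \<in> U. vec_dot l u = 0}"
    using assms by auto
  then show ?thesis using bij_betw_kernel by simp
qed

lemma bij_betw_kernel_eliminate:
  assumes dot_nonzero: "vec_dot l c \<noteq> 0" and scale: "\<And>a u. a \<in> K \<Longrightarrow> u \<in> U \<Longrightarrow> vec_scale a u \<in> U"
  shows "bij_betw (\<lambda>u. add_multiple c (- vec_dot l u, vec_scale (vec_dot l c) u)) U
    {v \<in> V. vec_dot l v = 0}"
proof -
  let ?s = "vec_dot l c"
  let ?g = "\<lambda>u. (- vec_dot l u, vec_scale ?s u)"
  have s_K: "?s \<in> K" by (rule vec_dot_K[OF l_vecs c_vecs])
  obtain s' where s'_K: "s' \<in> K" "s' * ?s = e" using inverse_ex[OF s_K dot_nonzero] by blast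
  have dot_scale: "vec_dot l (vec_scale a u) = a * vec_dot l u" if "u \<in> U" for a u
    using that vecsD(1) l_vecs U_vecs by (intro vec_dot_scale[of _ N]) auto
  have "bij_betw ?g U {(a, u) \<in> K \<times> U. a * ?s + vec_dot l u = 0}"
  proof (rule bij_betw_byWitness[where f' = "\<lambda>(a, u). vec_scale s' u"])
    show "\<forall>u\<in>U. (case ?g u of (a, u) \<Rightarrow> vec_scale s' u) = u"
      using vec_scale_inverse[OF s'_K(2)] U_vecs by auto
    show "?g ` U \<subseteq> {(a, u) \<in> K \<times> U. a * ?s + vec_dot l u = 0}"
      using vec_dot_K[OF l_vecs] U_vecs scale[OF s_K]
      by (auto simp: dot_scale mult.commute subset_iff)
    show "(\<lambda>(a, u). vec_scale s' u) ` {(a, u) \<in> K \<times> U. a * ?s + vec_dot l u = 0} \<subseteq> U"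
      using scale[OF s'_K(1)] by auto
    show "\<forall>x\<in>{(a, u) \<in> K \<times> U. a * ?s + vec_dot l u = 0}. ?g (case x of (a, u) \<Rightarrow> vec_scale s' u) = x"
    proof
      fix x assume "x \<in> {(a, u) \<in> K \<times> U. a * ?s + vec_dot l u = 0}"
      then obtain a u where x_eq: "x = (a, u)" and au: "a \<in> K" "u \<in> U" "a * ?s + vec_dot l u = 0"
        by auto
      then have "vec_dot l u = - (a * ?s)" by (simp add: eq_neg_iff_add_eq_0 add.commute)
      then have "- vec_dot l (vec_scale s' u) = a * (s' * ?s)"
        using au(2) by (simp add: dot_scale mult_ac)
      moreover have "vec_scale ?s (vec_scale s' u) = u"
        using s'_K(2) au(2) U_vecs
        by (intro vec_scale_inverse[of _ _ _ N]) (auto simp: mult.commute)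
      ultimately show "?g (case x of (a, u) \<Rightarrow> vec_scale s' u) = x"
        using s'_K(2) mult_e[OF au(1)] by (simp add: x_eq)
    qed
  qed
  from bij_betw_trans[OF this bij_betw_kernel] show ?thesis by (simp add: comp_def)
qed

end

lemma basis_restrict:
  assumes zero_test: "\<And>a. a \<in> K \<Longrightarrow> Z a \<longleftrightarrow> a = 0" and l_vecs: "l \<in> vecs N"
  shows "basis N bs V \<Longrightarrow> basis N (restrict_basis Z l bs) {v \<in> V. vec_dot l v = 0}"
proof (induction bs arbitrary: V)
  case Nil
  moreover have "vec_dot l (lincomb N [] []) = 0"
    using vecsD(1)[OF l_vecs] by (simp add: vec_dot_sum[of _ N] nth_lincomb)
  ultimately show ?case by (auto simp: basis_Nil)
next
  case (Cons c bs)
  then have c_vecs: "c \<in> vecs N" by (simp add: basis_def)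
  with Cons.prems obtain U where U_basis: "basis N bs U"
    and bij: "bij_betw (add_multiple c) (K \<times> U) V"
    by (auto simp: basis_Cons)
  note U_vecs = basis_vecs[OF U_basis]
  have Z_dot: "Z (vec_dot l c) \<longleftrightarrow> vec_dot l c = 0"
    using zero_test vec_dot_K[OF l_vecs c_vecs] by blast
  show ?case
  proof (cases "vec_dot l c = 0")
    case True
    with Z_dot have "restrict_basis Z l (c # bs) = c # restrict_basis Z l bs" by simp
    then show ?thesis
      using Cons.IH[OF U_basis] bij_betw_kernel_zero[OF l_vecs c_vecs U_vecs bij True]
      by (auto simp: basis_Cons[OF c_vecs])
  next
    case False
    let ?bs = "eliminate l c (vec_dot l c) bs"
    have bs_vecs: "set bs \<subseteq> vecs N" "bij_betw (\<lambda>d. lincomb N d bs) (vecs (length bs)) U"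
      using U_basis by (auto simp: basis_def)
    have "set ?bs \<subseteq> vecs N"
      using bs_vecs(1) c_vecs l_vecs
      by (auto simp: eliminate_def intro!: vec_add_vecs vec_scale_vecs uminus_K vec_dot_K)
    moreover have "bij_betw (\<lambda>d. lincomb N d ?bs) (vecs (length ?bs)) {v \<in> V. vec_dot l v = 0}"
      using bij_betw_trans[OF bs_vecs(2)
          bij_betw_kernel_eliminate[OF l_vecs c_vecs U_vecs bij False basis_scale[OF U_basis]]]
      by (simp add: comp_def lincomb_eliminate[OF vecsD(1)[OF l_vecs]
          bs_vecs(1) vecsD(1)[OF c_vecs]])
    ultimately show ?thesis using False by (simp add: Z_dot basis_def)
  qed
qed

lemma basis_kernel:
  assumes "\<And>a. a \<in> K \<Longrightarrow> Z a \<longleftrightarrow> a = 0" "set ls \<subseteq> vecs N" "basis N bs V"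
  shows "basis N (kernel_basis Z ls bs) {v \<in> V. \<forall>l\<in>set ls. vec_dot l v = 0}"
  using assms(2,3)
proof (induction ls arbitrary: bs V)
  case (Cons l ls)
  then have "basis N (restrict_basis Z l bs) {v \<in> V. vec_dot l v = 0}"
    by (intro basis_restrict assms(1)) auto
  from Cons.IH[OF _ this] Cons.prems(1) show ?case by simp
qed simp

lemma basis_unit_vecs: "basis N (unit_vecs e N) (vecs N)"
proof -
  have "lincomb N cs (unit_vecs e N) = cs" if cs_vecs: "cs \<in> vecs N" for cs
  proof (rule nth_equalityI)
    fix i assume "i < length (lincomb N cs (unit_vecs e N))"
    then have i_less: "i < N" by simp
    have "lincomb N cs (unit_vecs e N) ! i = (\<Sum>k<N. cs ! k * (if i = k then e else 0))"
      using i_less by (simp add: nth_lincomb unit_vecs_def)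
    also have "\<dots> = (\<Sum>k<N. if i = k then cs ! k * e else 0)" by (intro sum.cong) auto
    also have "\<dots> = cs ! i" using i_less vecsD(2)[OF cs_vecs i_less] mult_e by simp
    finally show "lincomb N cs (unit_vecs e N) ! i = cs ! i" .
  qed (simp add: vecsD(1)[OF cs_vecs])
  then have "bij_betw (\<lambda>cs. lincomb N cs (unit_vecs e N)) (vecs N) (vecs N)"
    by (auto simp: bij_betw_def inj_on_def image_iff)
  moreover have "set (unit_vecs e N) \<subseteq> vecs N" by (auto simp: unit_vecs_def vecs_def)
  ultimately show ?thesis by (simp add: basis_def)
qed

lemma basis_kernel_unit_vecs:
  assumes "\<And>a. a \<in> K \<Longrightarrow> Z a \<longleftrightarrow> a = 0" "set ls \<subseteq> vecs N"
  shows "basis N (kernel_basis Z ls (unit_vecs e N)) {v \<in> vecs N. \<forall>l\<in>set ls. vec_dot l v = 0}"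
  using assms basis_unit_vecs by (rule basis_kernel)

lemma kernel_enumeration:
  assumes zero_test: "\<And>a. a \<in> K \<Longrightarrow> Z a \<longleftrightarrow> a = 0" and ls_vecs: "set ls \<subseteq> vecs N"
    and v_vecs: "v \<in> vecs N" "\<forall>l\<in>set ls. vec_dot l v = 0"
    and card: "card {v \<in> vecs N. \<forall>l\<in>set ls. vec_dot l v = 0} \<le> q ^ m"
  shows "\<exists>cs\<in>vecs m. add_lincomb cs (kernel_basis Z ls (unit_vecs e N)) (replicate N 0) = v"
proof -
  define bs where "bs = kernel_basis Z ls (unit_vecs e N)"
  have bs_basis: "basis N bs {v \<in> vecs N. \<forall>l\<in>set ls. vec_dot l v = 0}"
    unfolding bs_def using zero_test ls_vecs by (rule basis_kernel_unit_vecs)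
  have "q ^ length bs \<le> q ^ m" using card card_basis[OF bs_basis] by simp
  then have length_le: "length bs \<le> m" using q_ge_2 by simp
  have "v \<in> (\<lambda>cs. lincomb N cs bs) ` vecs (length bs)"
    using bs_basis v_vecs by (simp add: basis_def bij_betw_def)
  then obtain cs where cs_vecs: "cs \<in> vecs (length bs)" "v = lincomb N cs bs" by blast
  let ?cs = "cs @ replicate (m - length bs) 0"
  have "add_lincomb ?cs bs (replicate N 0) = vec_add (replicate N 0) (lincomb N ?cs bs)"
    using bs_basis vecsD(1)[OF cs_vecs(1)] by (intro add_lincomb_eq) (auto simp: basis_def vecs_def)
  also have "\<dots> = lincomb N cs bs"
    using vecsD(1)[OF cs_vecs(1)] by (intro nth_equalityI) (auto simp: nth_lincomb nth_append)
  finally have "add_lincomb ?cs bs (replicate N 0) = v" using cs_vecs(2) by simp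
  moreover have "?cs \<in> vecs m" using cs_vecs(1) length_le by (auto simp: vecs_def)
  ultimately show ?thesis unfolding bs_def by blast
qed

end

section \<open>Cubic forms as functions\<close>

lemma cubic_monomialsE:
  assumes "m \<in> cubic_monomials n"
  obtains i j k where "m = {#i, j, k#}" "i \<le> j" "j \<le> k" "k < n"
proof -
  define xs where "xs = sorted_list_of_multiset m"
  have sorted_xs: "sorted xs" "mset xs = m" by (simp_all add: xs_def)
  then have "length xs = 3" using assms by (auto simp: cubic_monomials_def)
  then obtain i j k where ijk: "xs = [i, j, k]" by (auto simp: numeral_3_eq_3 length_Suc_conv)
  with sorted_xs assms show thesis by (intro that[of i j k]) (auto simp: cubic_monomials_def)
qed

lemma bij_betw_cubic_monomials:
  "bij_betw (\<lambda>(i, j, k). {#i, j, k#}) {(i, j, k). i \<le> j \<and> j \<le> k \<and> k < n} (cubic_monomials n)"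
  (is "bij_betw ?h ?T _")
proof (rule bij_betw_imageI)
  have "sorted_list_of_multiset (?h t) = (case t of (i, j, k) \<Rightarrow> [i, j, k])" if "t \<in> ?T" for t
    using that by auto
  then show "inj_on ?h ?T"
    by (intro inj_onI) (fastforce dest: arg_cong[where f = sorted_list_of_multiset])
  show "?h ` ?T = cubic_monomials n"
  proof (intro equalityI subsetI)
    fix m assume "m \<in> cubic_monomials n"
    then obtain i j k where "m = {#i, j, k#}" "i \<le> j" "j \<le> k" "k < n" by (rule cubic_monomialsE)
    then show "m \<in> ?h ` ?T" by (intro image_eqI[of _ _ "(i, j, k)"]) auto
  qed (auto simp: cubic_monomials_def)
qed

definition sorted_coeff :: "(nat multiset \<Rightarrow> 'u) \<Rightarrow> nat \<Rightarrow> nat \<Rightarrow> nat \<Rightarrow> 'u :: comm_ring_1" where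
  "sorted_coeff c i j k = (if i \<le> j \<and> j \<le> k then c {#i, j, k#} else 0)"

definition cubic_value :: "nat \<Rightarrow> (nat multiset \<Rightarrow> 'u) \<Rightarrow> (nat \<Rightarrow> 'u) \<Rightarrow> 'u :: comm_ring_1" where
  "cubic_value n c x = (\<Sum>i<n. \<Sum>j<n. \<Sum>k<n. sorted_coeff c i j k * (x i * x j * x k))"

definition polar ::
    "nat \<Rightarrow> (nat multiset \<Rightarrow> 'u) \<Rightarrow> (nat \<Rightarrow> 'u) \<Rightarrow> (nat \<Rightarrow> 'u) \<Rightarrow> (nat \<Rightarrow> 'u) \<Rightarrow> 'u :: comm_ring_1" where
  "polar n c x y z = (\<Sum>i<n. \<Sum>j<n. \<Sum>k<n. sorted_coeff c i j k *
     (x i * y j * z k + x i * z j * y k + y i * x j * z k + y i * z j * x k + z i * x j * y k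
       + z i * y j * x k))"

lemma cubic_value_cong: "(\<And>i. i < n \<Longrightarrow> x i = x' i) \<Longrightarrow> cubic_value n c x = cubic_value n c x'"
  unfolding cubic_value_def by (intro sum.cong refl) simp

lemma polar_cong:
  assumes "\<And>i. i < n \<Longrightarrow> x i = x' i" "\<And>i. i < n \<Longrightarrow> y i = y' i" "\<And>i. i < n \<Longrightarrow> z i = z' i"
  shows "polar n c x y z = polar n c x' y' z'"
  unfolding polar_def using assms by (intro sum.cong refl) simp

lemma polar_eq:
  "polar n c x y z =
    cubic_value n c (\<lambda>i. x i + y i + z i) + cubic_value n c x
      + (cubic_value n c y + cubic_value n c z)
    + - (cubic_value n c (\<lambda>i. x i + y i) + cubic_value n c (\<lambda>i. x i + z i)
      + cubic_value n c (\<lambda>i. y i + z i))"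
  unfolding polar_def cubic_value_def sum.distrib[symmetric] sum_negf[symmetric]
  by (intro sum.cong refl) (simp add: algebra_simps)

lemma polar_commute: "polar n c x y z = polar n c x z y"
  unfolding polar_def by (intro sum.cong refl arg_cong2[where f = "(*)"]) (simp add: algebra_simps)

lemma polar_sum_right:
  "polar n c x y (\<lambda>i. \<Sum>p\<in>S. a p * w p i) = (\<Sum>p\<in>S. a p * polar n c x y (w p))"
proof (induction S rule: infinite_finite_induct)
  case (insert p S)
  have "polar n c x y (\<lambda>i. b * z i + z' i) = b * polar n c x y z + polar n c x y z'" for b z z'
    unfolding polar_def sum_distrib_left sum.distrib[symmetric]
    by (intro sum.cong refl) (simp add: algebra_simps)
  then show ?case using insert by simp
qed (simp_all add: polar_def)

lemma polar_uminus_right: "polar n c x y (\<lambda>i. - z i) = - polar n c x y z"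
  using polar_sum_right[where S = "{0 :: nat}" and a = "\<lambda>_. - 1" and w = "\<lambda>_. z"] by simp

lemma pair_products_map:
  "pair_products (map x [a..<n]) = concat (map (\<lambda>j. map (\<lambda>k. x j * x k) [j..<n]) [a..<n])"
proof (induction "n - a" arbitrary: a)
  case (Suc d)
  then have "a < n" "d = n - Suc a" by auto
  then show ?case using Suc.hyps(1)[of "Suc a"] by (simp add: upt_conv_Cons vec_scale_def comp_def)
qed simp

lemma triple_products_map:
  "triple_products (map x [a..<n]) =
    concat (map (\<lambda>i. concat (map (\<lambda>j. map (\<lambda>k. x i * (x j * x k)) [j..<n]) [i..<n])) [a..<n])"
proof (induction "n - a" arbitrary: a)
  case (Suc d)
  then have a_less: "a < n" "d = n - Suc a" by auto
  have "triple_products (map x [a..<n])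
      = vec_scale (x a) (pair_products (map x [a..<n])) @ triple_products (map x [Suc a..<n])"
    using a_less by (simp add: upt_conv_Cons)
  also have "vec_scale (x a) (pair_products (map x [a..<n]))
      = concat (map (\<lambda>j. map (\<lambda>k. x a * (x j * x k)) [j..<n]) [a..<n])"
    unfolding pair_products_map vec_scale_def by (simp add: map_concat comp_def)
  finally show ?case using Suc.hyps(1)[OF a_less(2)] a_less by (simp add: upt_conv_Cons)
qed simp

lemma vec_dot_append:
  "length u = length v \<Longrightarrow> vec_dot (u @ u') (v @ v') = vec_dot u v + vec_dot u' v'"
  by (simp add: vec_dot_def)

lemma vec_dot_concat:
  "(\<And>i. i \<in> set is \<Longrightarrow> length (f i) = length (g i)) \<Longrightarrow>
    vec_dot (concat (map f is)) (concat (map g is)) = (\<Sum>i\<leftarrow>is. vec_dot (f i) (g i))"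
  by (induction "is") (simp_all add: vec_dot_append)

lemma vec_dot_map: "vec_dot (map f is) (map g is) = (\<Sum>i\<leftarrow>is. f i * g i)"
  by (induction "is") simp_all

lemma vec_add_map: "vec_add (map x xs) (map y xs) = map (\<lambda>i. x i + y i) xs"
  by (induction xs) simp_all

lemma sum_list_upt_if:
  fixes h :: "nat \<Rightarrow> 'u :: comm_monoid_add"
  shows "(\<Sum>j\<leftarrow>[i..<n]. h j) = (\<Sum>j<n. if i \<le> j then h j else 0)"
proof -
  have "(\<Sum>j\<leftarrow>[i..<n]. h j) = sum h {i..<n}" by (simp add: sum_list_distinct_conv_sum_set)
  also have "{i..<n} = {j \<in> {..<n}. i \<le> j}" by auto
  also have "sum h {j \<in> {..<n}. i \<le> j} = (\<Sum>j<n. if i \<le> j then h j else 0)"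
    by (rule sum.inter_filter) simp
  finally show ?thesis .
qed

lemma form_value_eq: "form_value (cubic_coeffs n c) (map x [0..<n]) = cubic_value n c x"
proof -
  have len: "length (concat (map (\<lambda>j. map (\<lambda>k. p j k) [j..<n]) js))
      = length (concat (map (\<lambda>j. map (\<lambda>k. p' j k) [j..<n]) js))"
    for p p' :: "nat \<Rightarrow> nat \<Rightarrow> 'a" and js
    by (simp add: length_concat comp_def)
  have "form_value (cubic_coeffs n c) (map x [0..<n])
      = (\<Sum>i\<leftarrow>[0..<n]. \<Sum>j\<leftarrow>[i..<n]. \<Sum>k\<leftarrow>[j..<n]. c {#i, j, k#} * (x i * (x j * x k)))"
    unfolding form_value_def cubic_coeffs_def triple_products_map
    by (subst vec_dot_concat, rule len, subst vec_dot_concat, simp, subst vec_dot_map, rule refl)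
  also have "\<dots> = cubic_value n c x"
    unfolding sum_list_upt_if cubic_value_def sorted_coeff_def
    by (intro sum.cong refl) (auto intro!: sum.cong sum.neutral simp: mult.assoc)
  finally show ?thesis .
qed

lemma polar_value_eq:
  "polar_value (cubic_coeffs n c) (map x [0..<n]) (map y [0..<n]) (map z [0..<n]) = polar n c x y z"
  unfolding polar_value_def vec_add_map form_value_eq polar_eq ..

context finite_subfield
begin

definition points :: "nat \<Rightarrow> (nat \<Rightarrow> 'u) set" where
  "points n = {x. \<forall>i<n. x i \<in> K}"

lemma pointsI: "(\<And>i. i < n \<Longrightarrow> x i \<in> K) \<Longrightarrow> x \<in> points n"
  by (simp add: points_def)

lemma pointsD: "x \<in> points n \<Longrightarrow> i < n \<Longrightarrow> x i \<in> K"
  by (simp add: points_def)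

lemma points_add: "x \<in> points n \<Longrightarrow> y \<in> points n \<Longrightarrow> (\<lambda>i. x i + y i) \<in> points n"
  by (simp add: points_def)

definition unitv :: "nat \<Rightarrow> nat \<Rightarrow> 'u" where
  "unitv i = (\<lambda>j. if j = i then e else 0)"

lemma unitv_points [simp]: "unitv i \<in> points n"
  by (simp add: unitv_def points_def)

lemma sum_unitv:
  assumes "i < n" "x i \<in> K"
  shows "(\<Sum>j<n. unitv j i * x j) = x i"
proof -
  have "(\<Sum>j<n. unitv j i * x j) = (\<Sum>j<n. if i = j then e * x j else 0)"
    by (intro sum.cong) (auto simp: unitv_def)
  also have "\<dots> = e * x i" using assms(1) by (subst sum.delta') auto
  finally show ?thesis using assms(2) by (simp add: e_mult)
qed

lemma unit_vecs_unitv: "unit_vecs e n = map (\<lambda>i. map (unitv i) [0..<n]) [0..<n]"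
  by (simp add: unit_vecs_def unitv_def)

lemma sorted_coeff_K: "c \<in> cubics n \<Longrightarrow> sorted_coeff c i j k \<in> K"
  by (simp add: sorted_coeff_def cubics_def)

lemma cubic_value_K: "c \<in> cubics n \<Longrightarrow> x \<in> points n \<Longrightarrow> cubic_value n c x \<in> K"
  unfolding cubic_value_def
  by (intro sum_K mult_K sorted_coeff_K) (auto simp: pointsD)

lemma polar_K:
  "c \<in> cubics n \<Longrightarrow> x \<in> points n \<Longrightarrow> y \<in> points n \<Longrightarrow> z \<in> points n \<Longrightarrow> polar n c x y z \<in> K"
  unfolding polar_def by (intro sum_K mult_K add_K sorted_coeff_K) (auto simp: pointsD)

lemma polar_expand_right:
  assumes "z \<in> points n"
  shows "polar n c x y z = (\<Sum>p<n. z p * polar n c x y (unitv p))"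
proof -
  have "polar n c x y z = polar n c x y (\<lambda>i. \<Sum>p<n. z p * unitv p i)"
    using sum_unitv[of _ n z] pointsD[OF assms] by (intro polar_cong) (auto simp: mult.commute)
  then show ?thesis by (simp add: polar_sum_right)
qed

lemma sum_sorted_coeff_unitv:
  assumes c_cubics: "c \<in> cubics n" and "i < n" "j < n" "k < n"
  shows "(\<Sum>a<n. \<Sum>b<n. \<Sum>d<n. sorted_coeff c a b d * (unitv i a * unitv j b * unitv k d))
    = sorted_coeff c i j k"
proof -
  have "(\<Sum>a<n. \<Sum>b<n. \<Sum>d<n. sorted_coeff c a b d * (unitv i a * unitv j b * unitv k d))
      = (\<Sum>a<n. \<Sum>b<n. \<Sum>d<n. if i = a \<and> j = b \<and> k = d then sorted_coeff c a b d else 0)"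
  proof (intro sum.cong refl)
    fix a b d
    have "sorted_coeff c a b d * (e * e * e) = sorted_coeff c a b d"
      using sorted_coeff_K[OF c_cubics] e_mult by (simp add: mult_e)
    then show "sorted_coeff c a b d * (unitv i a * unitv j b * unitv k d)
        = (if i = a \<and> j = b \<and> k = d then sorted_coeff c a b d else 0)"
      by (auto simp: unitv_def)
  qed
  also have "\<dots> = sorted_coeff c i j k" using assms(2-4) by (intro sum_delta3) auto
  finally show ?thesis .
qed

lemma cubic_value_unitv: "c \<in> cubics n \<Longrightarrow> i < n \<Longrightarrow> cubic_value n c (unitv i) = c {#i, i, i#}"
  by (simp only: cubic_value_def sum_sorted_coeff_unitv) (simp add: sorted_coeff_def)

lemma polar_unitv:
  assumes "c \<in> cubics n" "i < n" "j < n" "k < n"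
  shows "polar n c (unitv i) (unitv j) (unitv k) = polar_coeff c i j k"
proof -
  have "polar n c (unitv i) (unitv j) (unitv k) = sorted_coeff c i j k + sorted_coeff c i k j
      + sorted_coeff c j i k + sorted_coeff c j k i + sorted_coeff c k i j + sorted_coeff c k j i"
    unfolding polar_def distrib_left sum.distrib using assms by (simp add: sum_sorted_coeff_unitv)
  also have "\<dots> = polar_coeff c i j k"
  proof -
    have perms: "{#i, k, j#} = {#i, j, k#}" "{#j, i, k#} = {#i, j, k#}" "{#j, k, i#} = {#i, j, k#}"
      "{#k, i, j#} = {#i, j, k#}" "{#k, j, i#} = {#i, j, k#}"
      by (simp_all add: add_mset_commute)
    show ?thesis unfolding sorted_coeff_def polar_coeff_def perm_factor_def perms
      by (cases "i \<le> j"; cases "j \<le> k"; cases "i \<le> k"; auto)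
  qed
  finally show ?thesis .
qed

end

context odd_subfield
begin

lemma coeff_eq_if_polar_coeff_eq:
  assumes c_cubics: "c \<in> cubics n" and d_cubics: "d \<in> cubics n"
    and "\<not> (i = j \<and> j = k)" "polar_coeff c i j k = polar_coeff d i j k"
  shows "c {#i, j, k#} = d {#i, j, k#}"
proof (cases "i = j \<or> j = k \<or> i = k")
  case True
  let ?d = "c {#i, j, k#} - d {#i, j, k#}"
  have factor: "perm_factor i j k = (2 :: 'a)" using True assms(3) by (auto simp: perm_factor_def)
  have "?d + ?d = 2 * c {#i, j, k#} - 2 * d {#i, j, k#}" by (simp add: algebra_simps)
  also have "\<dots> = 0" using assms(4) by (simp add: polar_coeff_def factor)
  finally have double: "?d + ?d = 0" .
  have "?d \<in> K" using c_cubics d_cubics by (simp add: cubics_def)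
  from double_eq_0[OF this double] show ?thesis by simp
next
  case False
  then show ?thesis using assms(4) by (simp add: polar_coeff_def perm_factor_def)
qed

text \<open>The values at the unit vectors are needed only in characteristic 3, where the polarisation
  does not determine the coefficients of the cubes.\<close>

lemma cubic_value_inject:
  assumes c_cubics: "c \<in> cubics n" and d_cubics: "d \<in> cubics n"
    and eq: "\<And>x. x \<in> points n \<Longrightarrow> cubic_value n c x = cubic_value n d x"
  shows "c = d"
proof
  fix m
  show "c m = d m"
  proof (cases "m \<in> cubic_monomials n")
    case True
    then obtain i j k where m_eq: "m = {#i, j, k#}" and "i \<le> j" "j \<le> k" "k < n"
      by (rule cubic_monomialsE)
    then have ijk: "i < n" "j < n" "k < n" by auto
    show ?thesis
    proof (cases "i = j \<and> j = k")
      case True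
      then show ?thesis using eq[of "unitv i"] cubic_value_unitv c_cubics d_cubics ijk m_eq by simp
    next
      case False
      have "polar n c (unitv i) (unitv j) (unitv k) = polar n d (unitv i) (unitv j) (unitv k)"
        unfolding polar_eq by (simp add: eq points_add)
      then have "polar_coeff c i j k = polar_coeff d i j k"
        using polar_unitv c_cubics d_cubics ijk by simp
      with False show ?thesis
        unfolding m_eq by (intro coeff_eq_if_polar_coeff_eq[OF c_cubics d_cubics])
    qed
  qed (use c_cubics d_cubics in \<open>simp add: cubics_def\<close>)
qed

end

section \<open>Evaluation of polynomials\<close>

lemma prod_power_count:
  fixes y :: "'a \<Rightarrow> 'u :: comm_monoid_mult"
  assumes "finite S" "set_mset m \<subseteq> S"
  shows "(\<Prod>i\<in>S. y i ^ count m i) = prod_mset (image_mset y m)"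
  using assms(2)
proof (induction m)
  case (add a m)
  have "(\<Prod>i\<in>S. y i ^ count (add_mset a m) i) = (\<Prod>i\<in>S. (if i = a then y i else 1) * y i ^ count m i)"
    by (intro prod.cong) auto
  also have "\<dots> = y a * (\<Prod>i\<in>S. y i ^ count m i)"
    using add.prems assms(1) by (simp add: prod.distrib)
  finally show ?case using add by simp
qed simp

lemma sum_count:
  assumes "finite S" "set_mset m \<subseteq> S"
  shows "(\<Sum>i\<in>S. count m i) = size m"
  unfolding size_multiset_overloaded_eq
  using assms by (intro sum.mono_neutral_right) (auto simp: not_in_iff)

locale nat_cring = cring R for R :: "nat ring" (structure)
begin

lemma cring_R': "cring R"
  by unfold_locales

abbreviation mpolys :: "nat \<Rightarrow> (nat multiset \<Rightarrow> nat) set" where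
  "mpolys n \<equiv> carrier (mpoly_ring R n)"

lemma mpoly_ring_ops:
  "P \<otimes>\<^bsub>mpoly_ring R n\<^esub> Q = mpoly_mult R P Q" "P \<oplus>\<^bsub>mpoly_ring R n\<^esub> Q = indexed_padd P Q"
  "\<one>\<^bsub>mpoly_ring R n\<^esub> = indexed_const \<one>" "\<zero>\<^bsub>mpoly_ring R n\<^esub> = indexed_const \<zero>"
  by (simp_all add: mpoly_ring_def)

lemma indexed_const_mpoly [simp]: "k \<in> carrier R \<Longrightarrow> indexed_const k \<in> mpolys n"
  by (simp add: mpoly_ring_def indexed_pset.indexed_const)

lemma indexed_var_mpoly [simp]: "j < n \<Longrightarrow> indexed_var j \<in> mpolys n"
  by (simp add: mpoly_ring_def indexed_var_def indexed_pset.indexed_const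
      indexed_pset.indexed_pmult)

lemma indexed_padd_mpoly: "P \<in> mpolys n \<Longrightarrow> Q \<in> mpolys n \<Longrightarrow> indexed_padd P Q \<in> mpolys n"
  by (simp add: mpoly_ring_def indexed_pset.indexed_padd)

lemma indexed_pmult_mpoly: "P \<in> mpolys n \<Longrightarrow> i < n \<Longrightarrow> indexed_pmult P i \<in> mpolys n"
  by (simp add: mpoly_ring_def indexed_pset.indexed_pmult)

lemma mpoly_induct [consumes 1, case_names const padd pmult]:
  assumes "P \<in> mpolys n"
    and "\<And>k. k \<in> carrier R \<Longrightarrow> Q (indexed_const k)"
    and "\<And>P P'. P \<in> mpolys n \<Longrightarrow> Q P \<Longrightarrow> P' \<in> mpolys n \<Longrightarrow> Q P' \<Longrightarrow> Q (indexed_padd P P')"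
    and "\<And>P i. P \<in> mpolys n \<Longrightarrow> Q P \<Longrightarrow> i < n \<Longrightarrow> Q (indexed_pmult P i)"
  shows "Q P"
proof -
  have "P \<in> indexed_pset {..<n} (carrier R)" using assms(1) by (simp add: mpoly_ring_def)
  then show ?thesis
    by induction (use assms(2-4) in \<open>auto simp: mpoly_ring_def\<close>)
qed

lemma mpoly_closed [simp]: "P \<in> mpolys n \<Longrightarrow> P m \<in> carrier R"
  using mpoly_carrier_coeff by (simp add: carrier_coeff_def)

lemma indexed_pmult_support: "{m. indexed_pmult P i m \<noteq> \<zero>} \<subseteq> add_mset i ` {m. P m \<noteq> \<zero>}"
proof
  fix m assume "m \<in> {m. indexed_pmult P i m \<noteq> \<zero>}"
  then have "i \<in># m" "P (m - {#i#}) \<noteq> \<zero>" by (auto simp: indexed_pmult_def split: if_splits)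
  then show "m \<in> add_mset i ` {m. P m \<noteq> \<zero>}" by (intro image_eqI[of _ _ "m - {#i#}"]) auto
qed

lemma mpoly_finite_support:
  assumes "P \<in> mpolys n"
  shows "finite {m. P m \<noteq> \<zero>}"
  using assms
proof (induction rule: mpoly_induct)
  case (const k)
  have "{m. (indexed_const k :: nat multiset \<Rightarrow> nat) m \<noteq> \<zero>} \<subseteq> {{#}}"
    by (auto simp: indexed_const_def)
  then show ?case by (rule finite_subset) simp
next
  case (padd P P')
  have "{m. indexed_padd P P' m \<noteq> \<zero>} \<subseteq> {m. P m \<noteq> \<zero>} \<union> {m. P' m \<noteq> \<zero>}"
    by (auto simp: indexed_padd_def)
  then show ?case using padd by (auto dest: finite_subset)
next
  case (pmult P i)
  then show ?case using indexed_pmult_support[of P i] by (auto dest: finite_subset)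
qed

lemma mpoly_support_vars:
  assumes "P \<in> mpolys n" "P m \<noteq> \<zero>"
  shows "set_mset m \<subseteq> {..<n}"
  using assms
proof (induction arbitrary: m rule: mpoly_induct)
  case (const k)
  then show ?case by (auto simp: indexed_const_def split: if_splits)
next
  case (padd P P')
  then have "P m \<noteq> \<zero> \<or> P' m \<noteq> \<zero>" by (auto simp: indexed_padd_def)
  then show ?case using padd.IH by blast
next
  case (pmult P i)
  then obtain m' where "m = add_mset i m'" "P m' \<noteq> \<zero>" using indexed_pmult_support[of P i] by blast
  then show ?case using pmult by auto
qed

definition peval :: "(nat multiset \<Rightarrow> nat) \<Rightarrow> (nat \<Rightarrow> prod_ring) \<Rightarrow> prod_ring" where
  "peval P x = (\<Sum>m | P m \<noteq> \<zero>. emb R (P m) * prod_mset (image_mset x m))"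

lemma peval_superset:
  "finite S \<Longrightarrow> {m. P m \<noteq> \<zero>} \<subseteq> S \<Longrightarrow> peval P x = (\<Sum>m\<in>S. emb R (P m) * prod_mset (image_mset x m))"
  unfolding peval_def by (rule sum.mono_neutral_left) (auto simp: emb_zero[OF cring_R'])

lemma peval_const: "k \<in> carrier R \<Longrightarrow> peval (indexed_const k) x = emb R k"
  by (subst peval_superset[of "{{#}}"]) (auto simp: indexed_const_def)

lemma peval_padd:
  assumes "P \<in> mpolys n" "Q \<in> mpolys n"
  shows "peval (indexed_padd P Q) x = peval P x + peval Q x"
proof -
  let ?S = "{m. P m \<noteq> \<zero>} \<union> {m. Q m \<noteq> \<zero>}" and ?x = "\<lambda>m. prod_mset (image_mset x m)"
  have fin: "finite ?S" using mpoly_finite_support assms by auto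
  have "peval (indexed_padd P Q) x = (\<Sum>m\<in>?S. emb R (P m \<oplus> Q m) * ?x m)"
    using fin by (subst peval_superset[of ?S]) (auto simp: indexed_padd_def)
  also have "\<dots> = (\<Sum>m\<in>?S. emb R (P m) * ?x m) + (\<Sum>m\<in>?S. emb R (Q m) * ?x m)"
    using assms by (simp add: emb_hom(1)[OF cring_R'] distrib_right sum.distrib)
  also have "\<dots> = peval P x + peval Q x"
    using fin by (subst (1 2) peval_superset[of ?S]) auto
  finally show ?thesis .
qed

lemma peval_pmult:
  assumes "P \<in> mpolys n"
  shows "peval (indexed_pmult P i) x = peval P x * x i"
proof -
  have "peval (indexed_pmult P i) x = (\<Sum>m\<in>add_mset i ` {m. P m \<noteq> \<zero>}.
      emb R (indexed_pmult P i m) * prod_mset (image_mset x m))"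
    using mpoly_finite_support[OF assms] by (intro peval_superset indexed_pmult_support) simp
  also have "\<dots> = (\<Sum>m | P m \<noteq> \<zero>. emb R (P m) * (x i * prod_mset (image_mset x m)))"
    by (subst sum.reindex) (auto simp: inj_on_def indexed_pmult_def)
  also have "\<dots> = peval P x * x i"
    unfolding peval_def sum_distrib_right by (intro sum.cong refl) (simp add: mult_ac)
  finally show ?thesis .
qed

lemma peval_mult:
  assumes P_mpoly: "P \<in> mpolys n" and Q_mpoly: "Q \<in> mpolys n"
  shows "peval (mpoly_mult R P Q) x = peval P x * peval Q x"
  using Q_mpoly
proof (induction rule: mpoly_induct)
  case (const k)
  have "peval (mpoly_mult R P (indexed_const k)) x
      = (\<Sum>m | P m \<noteq> \<zero>. emb R (P m \<otimes> k) * prod_mset (image_mset x m))"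
    unfolding mpoly_mult_const[OF mpoly_carrier_coeff[OF P_mpoly] const]
    using mpoly_finite_support[OF P_mpoly] const by (intro peval_superset) auto
  also have "\<dots> = peval P x * emb R k"
    unfolding peval_def sum_distrib_right
    using P_mpoly const by (intro sum.cong refl) (simp add: emb_hom(2)[OF cring_R'] mult_ac)
  finally show ?case using const by (simp add: peval_const)
next
  case (padd Q Q')
  note coeff = mpoly_carrier_coeff[OF P_mpoly] mpoly_carrier_coeff[OF padd.hyps(1)]
    mpoly_carrier_coeff[OF padd.hyps(2)]
  show ?case
    using padd mpoly_mult_closed[OF P_mpoly]
    by (simp add: mpoly_mult_add[OF coeff] peval_padd[of _ n] distrib_left)
next
  case (pmult Q i)
  note coeff = mpoly_carrier_coeff[OF P_mpoly] mpoly_carrier_coeff[OF pmult.hyps(1)]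
  show ?case
    using pmult mpoly_mult_closed[OF P_mpoly]
    by (simp add: mpoly_mult_pmult[OF coeff] peval_pmult[of _ n] mult.assoc)
qed

lemma peval_finsum:
  assumes "finite S" "\<And>s. s \<in> S \<Longrightarrow> P s \<in> mpolys n"
  shows "peval (\<Oplus>\<^bsub>mpoly_ring R n\<^esub>s\<in>S. P s) x = (\<Sum>s\<in>S. peval (P s) x)"
proof -
  interpret MP: cring "mpoly_ring R n" by (rule cring_mpoly_ring)
  show ?thesis using assms
  proof (induction S)
    case empty
    then show ?case by (simp add: mpoly_ring_ops peval_const emb_zero[OF cring_R'])
  next
    case (insert s S)
    then have "(\<Oplus>\<^bsub>mpoly_ring R n\<^esub>s\<in>S. P s) \<in> mpolys n" by (intro MP.finsum_closed) auto
    then show ?case using insert by (simp add: Pi_def mpoly_ring_ops(2) peval_padd[of _ n])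
  qed
qed

lemma emb_one_mult:
  "a \<in> carrier R \<Longrightarrow> emb R \<one> * emb R a = emb R a" "a \<in> carrier R \<Longrightarrow> emb R a * emb R \<one> = emb R a"
  using emb_hom(2)[OF cring_R', symmetric] by simp_all

lemma emb_one_mult_prod:
  "emb R \<one> * (\<Prod>i\<in>S. emb R \<one> * z i) = emb R \<one> * (\<Prod>i\<in>S. z i)"
proof (induction S rule: infinite_finite_induct)
  case (insert s S)
  have "emb R \<one> * (\<Prod>i\<in>insert s S. emb R \<one> * z i)
      = emb R \<one> * z s * (emb R \<one> * (\<Prod>i\<in>S. emb R \<one> * z i))"
    using insert by (simp add: mult_ac)
  also have "\<dots> = (emb R \<one> * emb R \<one>) * (z s * (\<Prod>i\<in>S. z i))"
    unfolding insert.IH by (simp only: mult_ac)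
  finally show ?case using insert by (simp add: emb_one_mult)
qed auto

lemma peval_finprod:
  assumes "finite S" "\<And>s. s \<in> S \<Longrightarrow> P s \<in> mpolys n"
  shows "peval (\<Otimes>\<^bsub>mpoly_ring R n\<^esub>s\<in>S. P s) x = emb R \<one> * (\<Prod>s\<in>S. peval (P s) x)"
proof -
  interpret MP: cring "mpoly_ring R n" by (rule cring_mpoly_ring)
  show ?thesis using assms
  proof (induction S)
    case empty
    then show ?case by (simp add: mpoly_ring_ops peval_const)
  next
    case (insert s S)
    then have "(\<Otimes>\<^bsub>mpoly_ring R n\<^esub>s\<in>S. P s) \<in> mpolys n" by (intro MP.finprod_closed) auto
    then show ?case using insert by (simp add: Pi_def mpoly_ring_ops(1) peval_mult[of _ n] mult_ac)
  qed
qed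

lemma peval_pow:
  assumes "P \<in> mpolys n"
  shows "peval (P [^]\<^bsub>mpoly_ring R n\<^esub> (k :: nat)) x = emb R \<one> * peval P x ^ k"
proof -
  interpret MP: cring "mpoly_ring R n" by (rule cring_mpoly_ring)
  show ?thesis
  proof (induction k)
    case (Suc k)
    then show ?case using assms by (simp add: mpoly_ring_ops(1) peval_mult[of _ n] mult_ac)
  qed (simp add: mpoly_ring_ops peval_const)
qed

lemma linear_form_mpoly: "(\<And>j. j < n \<Longrightarrow> a j \<in> carrier R) \<Longrightarrow> linear_form R n a \<in> mpolys n"
proof -
  interpret MP: cring "mpoly_ring R n" by (rule cring_mpoly_ring)
  show "(\<And>j. j < n \<Longrightarrow> a j \<in> carrier R) \<Longrightarrow> ?thesis"
    unfolding linear_form_def by (intro MP.finsum_closed) auto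
qed

lemma peval_linear_form:
  assumes "\<And>j. j < n \<Longrightarrow> a j \<in> carrier R"
  shows "peval (linear_form R n a) x = (\<Sum>j<n. emb R (a j) * x j)"
proof -
  interpret MP: cring "mpoly_ring R n" by (rule cring_mpoly_ring)
  have var: "peval (indexed_var j) x = emb R \<one> * x j" for j
    unfolding indexed_var_def by (simp add: peval_pmult[of _ n] peval_const)
  have "peval (linear_form R n a) x
      = (\<Sum>j<n. peval (indexed_const (a j) \<otimes>\<^bsub>mpoly_ring R n\<^esub> indexed_var j) x)"
    unfolding linear_form_def using assms by (intro peval_finsum) auto
  also have "\<dots> = (\<Sum>j<n. emb R (a j) * x j)"
    using assms by (intro sum.cong refl)
      (simp add: mpoly_ring_ops(1) peval_mult[of _ n] peval_const var emb_one_mult flip: mult.assoc)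
  finally show ?thesis .
qed

definition row_product :: "nat \<Rightarrow> (nat \<Rightarrow> nat \<Rightarrow> nat) \<Rightarrow> nat multiset \<Rightarrow> nat multiset \<Rightarrow> nat" where
  "row_product n A m
    = (\<Otimes>\<^bsub>mpoly_ring R n\<^esub>i\<in>{..<n}. linear_form R n (A i) [^]\<^bsub>mpoly_ring R n\<^esub> count m i)"

lemma subst_matrix_row_product:
  "subst_matrix R n g A =
    (\<Oplus>\<^bsub>mpoly_ring R n\<^esub>m\<in>{m. g m \<noteq> \<zero>}. indexed_const (g m) \<otimes>\<^bsub>mpoly_ring R n\<^esub> row_product n A m)"
  by (simp add: subst_matrix_def row_product_def)

context
  fixes n and A :: "nat \<Rightarrow> nat \<Rightarrow> nat"
  assumes A_carrier: "\<forall>i<n. \<forall>j<n. A i j \<in> carrier R"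
begin

lemma row_pow_mpoly: "i < n \<Longrightarrow> linear_form R n (A i) [^]\<^bsub>mpoly_ring R n\<^esub> (k :: nat) \<in> mpolys n"
proof -
  interpret MP: cring "mpoly_ring R n" by (rule cring_mpoly_ring)
  show "i < n \<Longrightarrow> ?thesis" using A_carrier by (intro MP.nat_pow_closed linear_form_mpoly) auto
qed

lemma row_product_mpoly: "row_product n A m \<in> mpolys n"
proof -
  interpret MP: cring "mpoly_ring R n" by (rule cring_mpoly_ring)
  show ?thesis unfolding row_product_def using row_pow_mpoly by (intro MP.finprod_closed) auto
qed

lemma subst_term_mpoly:
  "k \<in> carrier R \<Longrightarrow> indexed_const k \<otimes>\<^bsub>mpoly_ring R n\<^esub> row_product n A m \<in> mpolys n"
  using mpoly_mult_closed row_product_mpoly by (simp add: mpoly_ring_ops(1))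

lemma subst_matrix_mpoly: "g \<in> mpolys n \<Longrightarrow> subst_matrix R n g A \<in> mpolys n"
proof -
  interpret MP: cring "mpoly_ring R n" by (rule cring_mpoly_ring)
  show "g \<in> mpolys n \<Longrightarrow> ?thesis"
    unfolding subst_matrix_row_product using subst_term_mpoly by (intro MP.finsum_closed) auto
qed

lemma peval_row_product:
  assumes "set_mset m \<subseteq> {..<n}"
  shows "peval (row_product n A m) x
    = emb R \<one> * prod_mset (image_mset (\<lambda>i. \<Sum>j<n. emb R (A i j) * x j) m)"
proof -
  let ?y = "\<lambda>i. \<Sum>j<n. emb R (A i j) * x j"
  have "peval (row_product n A m) x
      = emb R \<one> * (\<Prod>i<n. peval (linear_form R n (A i) [^]\<^bsub>mpoly_ring R n\<^esub> count m i) x)"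
    unfolding row_product_def using row_pow_mpoly by (intro peval_finprod) auto
  also have "\<dots> = emb R \<one> * (\<Prod>i<n. emb R \<one> * ?y i ^ count m i)"
    using A_carrier by (intro arg_cong[where f = "(*) _"] prod.cong refl)
      (simp add: peval_pow[OF linear_form_mpoly] peval_linear_form)
  also have "\<dots> = emb R \<one> * prod_mset (image_mset ?y m)"
    unfolding emb_one_mult_prod using assms by (simp add: prod_power_count)
  finally show ?thesis .
qed

lemma peval_subst_matrix:
  assumes g_mpoly: "g \<in> mpolys n"
  shows "peval (subst_matrix R n g A) x = peval g (\<lambda>i. \<Sum>j<n. emb R (A i j) * x j)"
proof -
  have "peval (subst_matrix R n g A) x
      = (\<Sum>m | g m \<noteq> \<zero>. peval (indexed_const (g m) \<otimes>\<^bsub>mpoly_ring R n\<^esub> row_product n A m) x)"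
    unfolding subst_matrix_row_product
    using g_mpoly mpoly_finite_support[OF g_mpoly] subst_term_mpoly by (intro peval_finsum) auto
  also have "\<dots>
      = (\<Sum>m | g m \<noteq> \<zero>. emb R (g m) * prod_mset (image_mset (\<lambda>i. \<Sum>j<n. emb R (A i j) * x j) m))"
    using g_mpoly mpoly_support_vars[OF g_mpoly] row_product_mpoly
    by (intro sum.cong refl) (simp add: mpoly_ring_ops(1) peval_mult[of _ n] peval_const
        peval_row_product emb_one_mult flip: mult.assoc)
  finally show ?thesis by (simp add: peval_def)
qed

end

definition homogeneous :: "nat \<Rightarrow> (nat multiset \<Rightarrow> nat) \<Rightarrow> bool" where
  "homogeneous d P \<longleftrightarrow> (\<forall>m. P m \<noteq> \<zero> \<longrightarrow> size m = d)"

lemma homogeneous_mult: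
  assumes "P \<in> mpolys n" "Q \<in> mpolys n" "homogeneous d P" "homogeneous d' Q"
  shows "homogeneous (d + d') (mpoly_mult R P Q)"
  unfolding homogeneous_def
proof (intro allI impI, rule ccontr)
  fix m assume coeff_nonzero: "mpoly_mult R P Q m \<noteq> \<zero>" "size m \<noteq> d + d'"
  have "P a \<otimes> Q (m - a) = \<zero>" if "a \<subseteq># m" for a
  proof -
    have "size m = size a + size (m - a)"
      using that by (metis size_union subset_mset.add_diff_inverse)
    then have "P a = \<zero> \<or> Q (m - a) = \<zero>"
      using assms(3,4) coeff_nonzero(2) by (auto simp: homogeneous_def)
    then show ?thesis using assms(1,2) by auto
  qed
  then have "mpoly_mult R P Q m = (\<Oplus>a\<in>{a. a \<subseteq># m}. \<zero>)"
    unfolding mpoly_mult_def by (intro finsum_cong') auto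
  with coeff_nonzero(1) show False by simp
qed

lemma homogeneous_const: "homogeneous 0 (indexed_const k)"
  by (auto simp: homogeneous_def indexed_const_def)

lemma homogeneous_const_mult:
  assumes "k \<in> carrier R" "P \<in> mpolys n" "homogeneous d P"
  shows "homogeneous d (indexed_const k \<otimes>\<^bsub>mpoly_ring R n\<^esub> P)"
  using homogeneous_mult[OF indexed_const_mpoly[OF assms(1)] assms(2) homogeneous_const assms(3)]
  by (simp add: mpoly_ring_ops(1))

lemma homogeneous_var: "homogeneous 1 (indexed_var j)"
  unfolding homogeneous_def
proof (intro allI impI)
  fix m assume "indexed_var j m \<noteq> \<zero>"
  then have "j \<in># m" "m - {#j#} = {#}"
    by (auto simp: indexed_var_def indexed_pmult_def indexed_const_def split: if_splits)
  then have "m = {#j#}" by (metis insert_DiffM)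
  then show "size m = 1" by simp
qed

lemma homogeneous_finsum:
  assumes "finite S" "\<And>s. s \<in> S \<Longrightarrow> P s \<in> mpolys n" "\<And>s. s \<in> S \<Longrightarrow> homogeneous d (P s)"
  shows "homogeneous d (\<Oplus>\<^bsub>mpoly_ring R n\<^esub>s\<in>S. P s)"
proof -
  interpret MP: cring "mpoly_ring R n" by (rule cring_mpoly_ring)
  show ?thesis using assms
  proof (induction S)
    case empty
    then show ?case by (simp add: mpoly_ring_ops homogeneous_def indexed_const_def)
  next
    case (insert s S)
    have "(\<Oplus>\<^bsub>mpoly_ring R n\<^esub>s\<in>insert s S. P s) = indexed_padd (P s) (\<Oplus>\<^bsub>mpoly_ring R n\<^esub>s\<in>S. P s)"
      using insert by (subst MP.finsum_insert) (auto simp: mpoly_ring_ops(2))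
    moreover have "homogeneous d (P s)" "homogeneous d (\<Oplus>\<^bsub>mpoly_ring R n\<^esub>s\<in>S. P s)"
      using insert by auto
    ultimately show ?case unfolding homogeneous_def indexed_padd_def by (metis l_zero zero_closed)
  qed
qed

lemma homogeneous_pow:
  assumes "P \<in> mpolys n" "homogeneous 1 P"
  shows "homogeneous k (P [^]\<^bsub>mpoly_ring R n\<^esub> (k :: nat))"
proof -
  interpret MP: cring "mpoly_ring R n" by (rule cring_mpoly_ring)
  show ?thesis
  proof (induction k)
    case 0
    then show ?case by (simp add: mpoly_ring_ops homogeneous_const)
  next
    case (Suc k)
    then show ?case using homogeneous_mult[of "P [^]\<^bsub>mpoly_ring R n\<^esub> k" n P k 1] assms
      by (simp add: mpoly_ring_ops)
  qed
qed

lemma homogeneous_finprod: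
  assumes "finite S" "\<And>s. s \<in> S \<Longrightarrow> P s \<in> mpolys n" "\<And>s. s \<in> S \<Longrightarrow> homogeneous (d s) (P s)"
  shows "homogeneous (sum d S) (\<Otimes>\<^bsub>mpoly_ring R n\<^esub>s\<in>S. P s)"
proof -
  interpret MP: cring "mpoly_ring R n" by (rule cring_mpoly_ring)
  show ?thesis using assms
  proof (induction S)
    case empty
    then show ?case by (simp add: mpoly_ring_ops homogeneous_const)
  next
    case (insert s S)
    then have "(\<Otimes>\<^bsub>mpoly_ring R n\<^esub>s\<in>S. P s) \<in> mpolys n" by (intro MP.finprod_closed) auto
    then show ?case
      using insert homogeneous_mult[of "P s" n] by (simp add: Pi_def mpoly_ring_ops(1))
  qed
qed

lemma homogeneous_linear_form:
  assumes "\<And>j. j < n \<Longrightarrow> a j \<in> carrier R"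
  shows "homogeneous 1 (linear_form R n a)"
  unfolding linear_form_def
  using assms mpoly_mult_closed homogeneous_var
  by (intro homogeneous_finsum homogeneous_const_mult) (auto simp: mpoly_ring_ops(1))

lemma homogeneous_row_product:
  assumes A_carrier: "\<forall>i<n. \<forall>j<n. A i j \<in> carrier R" and "set_mset m \<subseteq> {..<n}"
  shows "homogeneous (size m) (row_product n A m)"
proof -
  have "homogeneous (\<Sum>i<n. count m i) (row_product n A m)"
    unfolding row_product_def using A_carrier
    by (intro homogeneous_finprod row_pow_mpoly homogeneous_pow
        linear_form_mpoly homogeneous_linear_form)
      auto
  then show ?thesis using assms(2) by (simp add: sum_count)
qed

lemma subst_matrix_cubic_forms:
  assumes g_form: "g \<in> cubic_forms R n" and A_carrier: "\<forall>i<n. \<forall>j<n. A i j \<in> carrier R"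
  shows "subst_matrix R n g A \<in> cubic_forms R n"
proof -
  have g_mpoly: "g \<in> mpolys n" using g_form by (simp add: cubic_forms_def)
  have "homogeneous 3 (subst_matrix R n g A)"
    unfolding subst_matrix_row_product
  proof (rule homogeneous_finsum)
    show "finite {m. g m \<noteq> \<zero>}" by (rule mpoly_finite_support[OF g_mpoly])
    fix m assume "m \<in> {m. g m \<noteq> \<zero>}"
    then have size_m: "size m = 3" "set_mset m \<subseteq> {..<n}"
      using g_form mpoly_support_vars[OF g_mpoly] by (auto simp: cubic_forms_def)
    show "indexed_const (g m) \<otimes>\<^bsub>mpoly_ring R n\<^esub> row_product n A m \<in> mpolys n"
      using g_mpoly A_carrier by (intro subst_term_mpoly) auto
    show "homogeneous 3 (indexed_const (g m) \<otimes>\<^bsub>mpoly_ring R n\<^esub> row_product n A m)"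
      using homogeneous_row_product[OF A_carrier size_m(2)] size_m(1) g_mpoly A_carrier
      by (intro homogeneous_const_mult row_product_mpoly) auto
  qed
  then show ?thesis
    using subst_matrix_mpoly[OF A_carrier g_mpoly] by (auto simp: cubic_forms_def homogeneous_def)
qed

lemma monomial_mpoly:
  assumes "a \<in> carrier R" "set_mset m0 \<subseteq> {..<n}"
  shows "(\<lambda>m. if m = m0 then a else \<zero>) \<in> mpolys n"
  using assms(2)
proof (induction m0)
  case empty
  have "(\<lambda>m :: nat multiset. if m = {#} then a else \<zero>) = indexed_const a"
    by (simp add: indexed_const_def)
  then show ?case using assms(1) by simp
next
  case (add i m0)
  have "(\<lambda>m. if m = add_mset i m0 then a else \<zero>) = indexed_pmult (\<lambda>m. if m = m0 then a else \<zero>) i"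
    by (auto simp: indexed_pmult_def fun_eq_iff dest: insert_DiffM)
  then show ?case using add by (simp add: indexed_pmult_mpoly)
qed

lemma finite_support_mpoly:
  assumes "finite S" "\<And>m. m \<notin> S \<Longrightarrow> P m = \<zero>" "\<And>m. P m \<in> carrier R" "\<And>m. m \<in> S \<Longrightarrow> set_mset m \<subseteq> {..<n}"
  shows "P \<in> mpolys n"
  using assms
proof (induction S arbitrary: P)
  case empty
  then have "P = indexed_const \<zero>" by (auto simp: indexed_const_def)
  then show ?case by simp
next
  case (insert m0 S)
  have "P = indexed_padd (P(m0 := \<zero>)) (\<lambda>m. if m = m0 then P m0 else \<zero>)"
    using insert.prems by (auto simp: indexed_padd_def fun_eq_iff)
  moreover have "P(m0 := \<zero>) \<in> mpolys n" using insert.prems insert.hyps by (intro insert.IH) auto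
  moreover have "(\<lambda>m. if m = m0 then P m0 else \<zero>) \<in> mpolys n"
    using insert.prems by (intro monomial_mpoly) auto
  ultimately show ?case using indexed_padd_mpoly by metis
qed

lemma cubic_forms_iff:
  "f \<in> cubic_forms R n \<longleftrightarrow> (\<forall>m. f m \<in> carrier R) \<and> (\<forall>m. m \<notin> cubic_monomials n \<longrightarrow> f m = \<zero>)"
proof
  assume f_form: "f \<in> cubic_forms R n"
  then have f_mpoly: "f \<in> mpolys n" by (simp add: cubic_forms_def)
  show "(\<forall>m. f m \<in> carrier R) \<and> (\<forall>m. m \<notin> cubic_monomials n \<longrightarrow> f m = \<zero>)"
    using f_form f_mpoly mpoly_support_vars[OF f_mpoly]
    unfolding cubic_forms_def cubic_monomials_def by auto
next
  assume coeffs: "(\<forall>m. f m \<in> carrier R) \<and> (\<forall>m. m \<notin> cubic_monomials n \<longrightarrow> f m = \<zero>)"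
  then have "f \<in> mpolys n"
    by (intro finite_support_mpoly[OF finite_cubic_monomials[of n]])
      (auto simp: cubic_monomials_def)
  then show "f \<in> cubic_forms R n" using coeffs unfolding cubic_forms_def cubic_monomials_def by auto
qed

lemma peval_cubic_form:
  assumes "f \<in> cubic_forms R n"
  shows "peval f x = cubic_value n (emb_form R f) x"
proof -
  let ?T = "{(i, j, k). i \<le> j \<and> j \<le> k \<and> k < n}"
  have "peval f x = (\<Sum>m\<in>cubic_monomials n. emb R (f m) * prod_mset (image_mset x m))"
    using assms by (intro peval_superset) (auto simp: cubic_forms_iff)
  also have "\<dots> = (\<Sum>t\<in>?T. emb R (f (case t of (i, j, k) \<Rightarrow> {#i, j, k#}))
      * prod_mset (image_mset x (case t of (i, j, k) \<Rightarrow> {#i, j, k#})))"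
    by (rule sum.reindex_bij_betw[OF bij_betw_cubic_monomials, symmetric])
  also have "\<dots> = (\<Sum>(i, j, k)\<in>{..<n} \<times> {..<n} \<times> {..<n}.
      sorted_coeff (emb_form R f) i j k * (x i * x j * x k))"
    by (intro sum.mono_neutral_cong_left)
      (auto simp: sorted_coeff_def emb_form_def mult.assoc split: if_splits)
  also have "\<dots> = cubic_value n (emb_form R f) x"
    by (simp add: cubic_value_def sum.cartesian_product)
  finally show ?thesis .
qed

end

section \<open>The linear system of an isomorphism\<close>

definition mat_vec :: "nat \<Rightarrow> (nat \<Rightarrow> nat \<Rightarrow> 'u) \<Rightarrow> (nat \<Rightarrow> 'u) \<Rightarrow> nat \<Rightarrow> 'u :: comm_ring_1" where
  "mat_vec n A x = (\<lambda>i. \<Sum>j<n. A i j * x j)"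

lemma mat_vec_cong: "(\<And>i. i < n \<Longrightarrow> x i = y i) \<Longrightarrow> mat_vec n A x = mat_vec n A y"
  by (simp add: mat_vec_def)

lemma mat_vec_cong_mat: "(\<And>j. j < n \<Longrightarrow> A i j = B i j) \<Longrightarrow> mat_vec n A x i = mat_vec n B x i"
  by (simp add: mat_vec_def)

lemma mat_vec_add: "mat_vec n A (\<lambda>i. x i + y i) = (\<lambda>i. mat_vec n A x i + mat_vec n A y i)"
  by (simp add: mat_vec_def distrib_left sum.distrib)

lemma mat_vec_mat_vec: "mat_vec n A (mat_vec n B x) i = (\<Sum>j<n. (\<Sum>k<n. A i k * B k j) * x j)"
proof -
  have "mat_vec n A (mat_vec n B x) i = (\<Sum>k<n. \<Sum>j<n. A i k * B k j * x j)"
    by (simp add: mat_vec_def sum_distrib_left mult.assoc)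
  also have "\<dots> = (\<Sum>j<n. (\<Sum>k<n. A i k * B k j) * x j)"
    by (subst sum.swap) (simp add: sum_distrib_right)
  finally show ?thesis .
qed

text \<open>The vector \<open>k\<close> of a list of vectors of length \<open>n\<close> that are stored consecutively.\<close>

definition block :: "nat \<Rightarrow> 'u list \<Rightarrow> nat \<Rightarrow> nat \<Rightarrow> 'u" where
  "block n v k p = v ! (k * n + p)"

lemma block_index_less:
  fixes k m n p :: nat
  assumes "k < m" "p < n"
  shows "k * n + p < m * n"
proof -
  have "k * n + p < (k + 1) * n" using assms by simp
  also have "\<dots> \<le> m * n" using assms by (intro mult_right_mono) auto
  finally show ?thesis .
qed

lemma block_eqI:
  assumes "length u = n * n" "length v = n * n"
    and "\<And>k p. k < n \<Longrightarrow> p < n \<Longrightarrow> block n u k p = block n v k p"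
  shows "u = v"
proof (rule nth_equalityI)
  fix i assume "i < length u"
  then have "i div n < n" "i mod n < n"
    using assms(1) by (cases "n = 0"; simp add: less_mult_imp_div_less)+
  then show "u ! i = v ! i" using assms(3)[of "i div n" "i mod n"] by (simp add: block_def)
qed (use assms in simp)

lemma block_take: "k < n \<Longrightarrow> p < n \<Longrightarrow> block n (take (n * n) v) k p = block n v k p"
  using block_index_less[of k n p n] by (simp add: block_def)

lemma vec_dot_append_left:
  "length v = length a + length b \<Longrightarrow>
    vec_dot (a @ b) v = vec_dot a (take (length a) v) + vec_dot b (drop (length a) v)"
  using vec_dot_append[of a "take (length a) v" b "drop (length a) v"] by simp

lemma vec_dot_outer_product:
  assumes "length v = m * n"
  shows "vec_dot (outer_product (map x [0..<m]) (map y [0..<n])) v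
    = (\<Sum>k<m. \<Sum>p<n. x k * y p * block n v k p)"
  using assms
proof (induction m arbitrary: v)
  case (Suc m)
  have outer: "outer_product (map x [0..<Suc m]) (map y [0..<n])
      = outer_product (map x [0..<m]) (map y [0..<n]) @ vec_scale (x m) (map y [0..<n])"
    by (simp add: outer_product_def)
  have "vec_dot (vec_scale (x m) (map y [0..<n])) (drop (m * n) v)
      = (\<Sum>p<n. x m * y p * block n v m p)"
    using Suc.prems by (subst vec_dot_sum[of _ n]) (auto simp: block_def algebra_simps)
  moreover have "vec_dot (outer_product (map x [0..<m]) (map y [0..<n])) (take (m * n) v)
      = (\<Sum>k<m. \<Sum>p<n. x k * y p * block n v k p)"
    using Suc.prems block_index_less[of _ m _ n]
    by (subst Suc.IH) (auto simp: block_def intro!: sum.cong)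
  ultimately show ?case
    unfolding outer using Suc.prems by (subst vec_dot_append_left) (auto simp: add.commute)
qed (simp add: outer_product_def)

lemma add_columns_eq:
  "length acc = n \<Longrightarrow> length xs * n \<le> length u \<Longrightarrow>
    add_columns xs u acc = map (\<lambda>p. acc ! p + (\<Sum>k<length xs. xs ! k * block n u k p)) [0..<n]"
proof (induction xs arbitrary: u acc)
  case Nil
  then show ?case by (auto intro: nth_equalityI)
next
  case (Cons x xs)
  let ?acc = "vec_add acc (vec_scale x u)"
  have len: "length ?acc = n" using Cons.prems by simp
  have "add_columns (x # xs) u acc
      = map (\<lambda>p. ?acc ! p + (\<Sum>k<length xs. xs ! k * block n (drop n u) k p)) [0..<n]"
    using Cons.prems Cons.IH[OF len, of "drop n u"] by simp
  also have "\<dots> = map (\<lambda>p. acc ! p + (\<Sum>k<length (x # xs). (x # xs) ! k * block n u k p)) [0..<n]"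
  proof (rule map_cong)
    fix p assume "p \<in> set [0..<n]"
    then have "?acc ! p = acc ! p + x * block n u 0 p" using Cons.prems by (simp add: block_def)
    moreover have "block n (drop n u) k p = block n u (Suc k) p" for k
      using Cons.prems by (simp add: block_def add.assoc)
    ultimately show "?acc ! p + (\<Sum>k<length xs. xs ! k * block n (drop n u) k p)
        = acc ! p + (\<Sum>k<length (x # xs). (x # xs) ! k * block n u k p)"
      by (simp add: sum.lessThan_Suc_shift add.assoc del: sum.lessThan_Suc)
  qed simp
  finally show ?case .
qed

definition column_mat :: "nat \<Rightarrow> 'u list \<Rightarrow> nat \<Rightarrow> nat \<Rightarrow> 'u" where
  "column_mat n u p k = block n u k p"

lemma add_columns_mat_vec:
  assumes "n * n \<le> length u"
  shows "add_columns (map x [0..<n]) u (replicate n 0) = map (mat_vec n (column_mat n u) x) [0..<n]"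
  using assms by (subst add_columns_eq[of _ n]) (auto simp: mat_vec_def column_mat_def mult.commute)

context finite_subfield
begin

subsection \<open>Invertible matrices\<close>

definition matrices :: "nat \<Rightarrow> (nat \<Rightarrow> nat \<Rightarrow> 'u) set" where
  "matrices n = {A. \<forall>i<n. \<forall>j<n. A i j \<in> K}"

lemma matricesD: "A \<in> matrices n \<Longrightarrow> i < n \<Longrightarrow> j < n \<Longrightarrow> A i j \<in> K"
  by (simp add: matrices_def)

lemma mat_vec_points: "A \<in> matrices n \<Longrightarrow> x \<in> points n \<Longrightarrow> mat_vec n A x \<in> points n"
  unfolding mat_vec_def by (intro pointsI sum_K mult_K) (auto dest: matricesD pointsD)

lemma mat_vec_unitv: "A \<in> matrices n \<Longrightarrow> i < n \<Longrightarrow> j < n \<Longrightarrow> mat_vec n A (unitv j) i = A i j"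
proof -
  assume A_matrices: "A \<in> matrices n" "i < n" "j < n"
  have "mat_vec n A (unitv j) i = (\<Sum>k<n. if k = j then A i k * e else 0)"
    unfolding mat_vec_def unitv_def by (intro sum.cong) auto
  then show ?thesis using A_matrices by (simp add: mult_e matricesD)
qed

definition inverse_mats :: "nat \<Rightarrow> (nat \<Rightarrow> nat \<Rightarrow> 'u) \<Rightarrow> (nat \<Rightarrow> nat \<Rightarrow> 'u) \<Rightarrow> bool" where
  "inverse_mats n A B \<longleftrightarrow> A \<in> matrices n \<and> B \<in> matrices n \<and> (\<forall>i<n. \<forall>j<n.
     (\<Sum>k<n. A i k * B k j) = (if i = j then e else 0)
       \<and> (\<Sum>k<n. B i k * A k j) = (if i = j then e else 0))"

lemma inverse_mats_matrices:
  "inverse_mats n A B \<Longrightarrow> A \<in> matrices n" "inverse_mats n A B \<Longrightarrow> B \<in> matrices n"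
  by (simp_all add: inverse_mats_def)

lemma inverse_mats_sym: "inverse_mats n A B \<Longrightarrow> inverse_mats n B A"
  by (auto simp: inverse_mats_def)

lemma inverse_mats_transpose: "inverse_mats n A B \<Longrightarrow> inverse_mats n (\<lambda>i j. A j i) (\<lambda>i j. B j i)"
  by (auto simp: inverse_mats_def matrices_def mult.commute)

lemma mat_vec_inverse:
  assumes "inverse_mats n A B" "x \<in> points n" "i < n"
  shows "mat_vec n A (mat_vec n B x) i = x i"
proof -
  have "mat_vec n A (mat_vec n B x) i = (\<Sum>j<n. unitv j i * x j)"
    unfolding mat_vec_mat_vec
    using assms by (intro sum.cong refl) (simp add: inverse_mats_def unitv_def)
  then show ?thesis using sum_unitv[OF assms(3)] pointsD[OF assms(2,3)] by simp
qed

lemma mat_vec_cancel: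
  assumes inverse_AB: "inverse_mats n A B" and xy: "x \<in> points n" "y \<in> points n"
    and eq: "\<And>i. i < n \<Longrightarrow> mat_vec n A x i = mat_vec n A y i" and "i < n"
  shows "x i = y i"
proof -
  have "mat_vec n B (mat_vec n A x) = mat_vec n B (mat_vec n A y)" using eq by (rule mat_vec_cong)
  then show ?thesis
    using mat_vec_inverse[OF inverse_mats_sym[OF inverse_AB] _ \<open>i < n\<close>] xy by metis
qed

definition trivial_kernel :: "nat \<Rightarrow> (nat \<Rightarrow> nat \<Rightarrow> 'u) \<Rightarrow> bool" where
  "trivial_kernel n A \<longleftrightarrow> (\<forall>x\<in>points n. (\<forall>i<n. mat_vec n A x i = 0) \<longrightarrow> (\<forall>i<n. x i = 0))"

lemma trivial_kernel_cong:
  assumes "\<And>i j. i < n \<Longrightarrow> j < n \<Longrightarrow> A i j = B i j"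
  shows "trivial_kernel n A \<longleftrightarrow> trivial_kernel n B"
  using mat_vec_cong_mat[of n A _ B] assms by (simp add: trivial_kernel_def)

lemma inverse_mats_trivial_kernel:
  assumes "inverse_mats n A B"
  shows "trivial_kernel n A"
  using mat_vec_cancel[OF assms, of _ "\<lambda>_. 0"]
  by (simp add: trivial_kernel_def points_def mat_vec_def)

lemma trivial_kernel_inj:
  assumes "trivial_kernel n A" "x \<in> points n" "y \<in> points n"
    and eq: "\<And>i. i < n \<Longrightarrow> mat_vec n A x i = mat_vec n A y i" and "i < n"
  shows "x i = y i"
proof -
  have "mat_vec n A (\<lambda>i. x i - y i) i = 0" if "i < n" for i
    using eq[OF that] by (simp add: mat_vec_def right_diff_distrib sum_subtractf)
  moreover have "(\<lambda>i. x i - y i) \<in> points n" using assms(2,3) by (simp add: points_def)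
  ultimately have "x i - y i = 0" using assms(1,5) by (auto simp: trivial_kernel_def)
  then show ?thesis by simp
qed

lemma trivial_kernel_surj:
  assumes A_matrices: "A \<in> matrices n" "trivial_kernel n A" and y_points: "y \<in> points n"
  shows "\<exists>x\<in>points n. \<forall>i<n. mat_vec n A x i = y i"
proof -
  let ?V = "{..<n} \<rightarrow>\<^sub>E K" and ?h = "\<lambda>x. restrict (mat_vec n A x) {..<n}"
  have points: "x \<in> points n" if "x \<in> ?V" for x using that by (auto simp: points_def)
  have "?h ` ?V \<subseteq> ?V"
    using pointsD[OF mat_vec_points[OF A_matrices(1) points]] by auto
  moreover have "inj_on ?h ?V"
  proof (rule inj_onI)
    fix x x' assume x_mem: "x \<in> ?V" "x' \<in> ?V" and eq: "?h x = ?h x'"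
    have "mat_vec n A x i = mat_vec n A x' i" if "i < n" for i
      using fun_cong[OF eq, of i] that by simp
    then have "x i = x' i" if "i < n" for i
      using trivial_kernel_inj[OF A_matrices(2) points[OF x_mem(1)] points[OF x_mem(2)]] that
      by blast
    then show "x = x'" by (intro PiE_ext[OF x_mem]) simp
  qed
  ultimately have "?h ` ?V = ?V" by (intro endo_inj_surj) (auto intro: finite_PiE)
  moreover have "restrict y {..<n} \<in> ?V" using pointsD[OF y_points] by simp
  ultimately have "restrict y {..<n} \<in> ?h ` ?V" by simp
  then obtain x where x_mem: "x \<in> ?V" "restrict y {..<n} = ?h x" by (elim imageE)
  have "mat_vec n A x i = y i" if "i < n" for i using fun_cong[OF x_mem(2), of i] that by simp
  then show ?thesis using points[OF x_mem(1)] by blast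
qed

lemma trivial_kernel_invertible:
  assumes A_matrices: "A \<in> matrices n" "trivial_kernel n A"
  shows "\<exists>B. inverse_mats n A B"
proof -
  obtain b where b_points: "\<And>j. b j \<in> points n" "\<And>i j. i < n \<Longrightarrow> mat_vec n A (b j) i = unitv j i"
    using trivial_kernel_surj[OF A_matrices unitv_points] by metis
  define B where "B i j = b j i" for i j
  have B_matrices: "B \<in> matrices n"
    unfolding matrices_def B_def using b_points(1) by (blast dest: pointsD)
  have AB_unit: "(\<Sum>k<n. A i k * B k j) = unitv j i" if "i < n" for i j
    using b_points(2)[OF that, of j] by (simp add: mat_vec_def B_def)
  have BA_unit: "(\<Sum>k<n. B i k * A k j) = unitv j i" if ij: "i < n" "j < n" for i j
  proof -
    have col: "(\<lambda>k. A k j) \<in> points n" using A_matrices(1) ij by (auto simp: points_def matricesD)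
    have "mat_vec n A (mat_vec n B (\<lambda>k. A k j)) s = mat_vec n A (unitv j) s"
      if s_less: "s < n" for s
    proof -
      have "mat_vec n A (mat_vec n B (\<lambda>k. A k j)) s = (\<Sum>k<n. unitv k s * A k j)"
        unfolding mat_vec_mat_vec using AB_unit[OF s_less] by simp
      also have "\<dots> = A s j" using s_less pointsD[OF col s_less] by (rule sum_unitv)
      finally show ?thesis using mat_vec_unitv[OF A_matrices(1) s_less ij(2)] by simp
    qed
    then have "mat_vec n B (\<lambda>k. A k j) i = unitv j i"
      using trivial_kernel_inj[OF A_matrices(2) mat_vec_points[OF B_matrices col] unitv_points]
        ij(1) by blast
    then show ?thesis by (simp add: mat_vec_def)
  qed
  have "inverse_mats n A B"
    using A_matrices(1) B_matrices AB_unit BA_unit by (auto simp: inverse_mats_def unitv_def)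
  then show ?thesis by blast
qed

subsection \<open>Solutions and adjoints\<close>

definition is_pullback ::
    "nat \<Rightarrow> (nat multiset \<Rightarrow> 'u) \<Rightarrow> (nat multiset \<Rightarrow> 'u) \<Rightarrow> (nat \<Rightarrow> nat \<Rightarrow> 'u) \<Rightarrow> bool" where
  "is_pullback n c d A \<longleftrightarrow> (\<forall>x\<in>points n. cubic_value n c x = cubic_value n d (mat_vec n A x))"

lemma is_pullback_cong:
  assumes "\<And>i j. i < n \<Longrightarrow> j < n \<Longrightarrow> A i j = B i j"
  shows "is_pullback n c d A \<longleftrightarrow> is_pullback n c d B"
proof -
  have "cubic_value n d (mat_vec n A x) = cubic_value n d (mat_vec n B x)" for x
    using assms by (intro cubic_value_cong mat_vec_cong_mat) auto
  then show ?thesis by (simp add: is_pullback_def)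
qed

lemma polar_pullback:
  assumes "is_pullback n c d A" "x \<in> points n" "y \<in> points n" "z \<in> points n"
  shows "polar n c x y z = polar n d (mat_vec n A x) (mat_vec n A y) (mat_vec n A z)"
  using assms unfolding polar_eq
  by (simp add: is_pullback_def points_add mat_vec_add)

definition solves ::
    "nat \<Rightarrow> nat \<Rightarrow> (nat multiset \<Rightarrow> 'u) \<Rightarrow> (nat multiset \<Rightarrow> 'u) \<Rightarrow> (nat \<Rightarrow> nat \<Rightarrow> 'u)
      \<Rightarrow> (nat \<Rightarrow> nat \<Rightarrow> 'u) \<Rightarrow> (nat \<Rightarrow> nat \<Rightarrow> 'u) \<Rightarrow> bool" where
  "solves n r c d w a b \<longleftrightarrow> (\<forall>i<r. \<forall>j<n. \<forall>k<n.
     polar n d (w i) (unitv j) (a k) + polar n c (unitv i) (unitv k) (b j) = 0)"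

lemma solves_cong:
  assumes "\<And>k p. k < n \<Longrightarrow> p < n \<Longrightarrow> a k p = a' k p" "\<And>j p. j < n \<Longrightarrow> p < n \<Longrightarrow> b j p = b' j p"
  shows "solves n r c d w a b \<longleftrightarrow> solves n r c d w a' b'"
proof -
  have "polar n d (w i) (unitv j) (a k) = polar n d (w i) (unitv j) (a' k)" if "k < n" for i j k
    using assms(1)[OF that] by (intro polar_cong) auto
  moreover have "polar n c (unitv i) (unitv k) (b j) = polar n c (unitv i) (unitv k) (b' j)"
    if "j < n" for i j k
    using assms(2)[OF that] by (intro polar_cong) auto
  ultimately show ?thesis by (simp add: solves_def)
qed

lemma sum_polar_coeff_transpose:
  assumes A_matrices: "A \<in> matrices n" and c_cubics: "c \<in> cubics n"
    and b_points: "\<And>p. p < n \<Longrightarrow> (\<lambda>j. b j p) \<in> points n"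
    and "i < n" "k < n" "l < n"
  shows "(\<Sum>p<n. mat_vec n (\<lambda>l j. A j l) (\<lambda>j. b j p) l * polar_coeff c i p k)
    = (\<Sum>j<n. A j l * polar n c (unitv i) (unitv k) (b j))"
proof -
  let ?y = "\<lambda>p. \<Sum>j<n. A j l * b j p"
  have "?y \<in> points n"
    using b_points matricesD[OF A_matrices] \<open>l < n\<close> by (auto simp: points_def intro!: sum_K mult_K)
  then have "polar n c (unitv i) (unitv k) ?y
      = (\<Sum>p<n. ?y p * polar n c (unitv i) (unitv k) (unitv p))"
    by (rule polar_expand_right)
  also have "\<dots> = (\<Sum>p<n. mat_vec n (\<lambda>l j. A j l) (\<lambda>j. b j p) l * polar_coeff c i p k)"
    using \<open>i < n\<close> \<open>k < n\<close> c_cubics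
    by (simp add: polar_unitv polar_coeff_commute[of c i k] mat_vec_def)
  finally show ?thesis by (simp add: polar_sum_right)
qed

definition adjoint_of ::
    "nat \<Rightarrow> (nat \<Rightarrow> nat \<Rightarrow> 'u) \<Rightarrow> (nat \<Rightarrow> nat \<Rightarrow> 'u) \<Rightarrow> (nat \<Rightarrow> nat \<Rightarrow> 'u) \<Rightarrow> (nat \<Rightarrow> nat \<Rightarrow> 'u)
      \<Rightarrow> (nat \<times> nat \<Rightarrow> 'u) \<times> (nat \<times> nat \<Rightarrow> 'u)" where
  "adjoint_of n A B a b = (restrict (\<lambda>(p, k). mat_vec n B (a k) p) ({..<n} \<times> {..<n}),
    restrict (\<lambda>(l, p). mat_vec n (\<lambda>l j. A j l) (\<lambda>j. b j p) l) ({..<n} \<times> {..<n}))"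

lemma adjoint_of_inject:
  assumes inverse_AB: "inverse_mats n A B"
    and a_points: "\<And>k. k < n \<Longrightarrow> a k \<in> points n" "\<And>k. k < n \<Longrightarrow> a' k \<in> points n"
    and b_points: "\<And>p. p < n \<Longrightarrow> (\<lambda>j. b j p) \<in> points n" "\<And>p. p < n \<Longrightarrow> (\<lambda>j. b' j p) \<in> points n"
    and eq: "adjoint_of n A B a b = adjoint_of n A B a' b'" and kp: "k < n" "p < n"
  shows "a k p = a' k p" "b k p = b' k p"
proof -
  have "mat_vec n B (a k) s = mat_vec n B (a' k) s" if "s < n" for s
    using arg_cong[OF eq, of "\<lambda>h. fst h (s, k)"] that kp by (simp add: adjoint_of_def)
  then show "a k p = a' k p"
    by (intro mat_vec_cancel[OF inverse_mats_sym[OF inverse_AB] a_points(1) a_points(2)] kp)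
  have "mat_vec n (\<lambda>l j. A j l) (\<lambda>j. b j p) l = mat_vec n (\<lambda>l j. A j l) (\<lambda>j. b' j p) l"
    if "l < n" for l
    using arg_cong[OF eq, of "\<lambda>h. snd h (l, p)"] that kp by (simp add: adjoint_of_def)
  from mat_vec_cancel[OF inverse_mats_transpose[OF inverse_AB] b_points(1)[OF kp(2)]
      b_points(2)[OF kp(2)] this kp(1)]
  show "b k p = b' k p" .
qed

context
  fixes n r c d A B
  assumes c_cubics: "c \<in> cubics n" and inverse_AB: "inverse_mats n A B"
    and r_le_n: "r \<le> n" and pullback: "is_pullback n c d A"
begin

lemma solves_inverse: "solves n r c d (\<lambda>i. mat_vec n A (unitv i)) (\<lambda>k p. A p k) (\<lambda>j p. - B p j)"
  unfolding solves_def
proof (intro allI impI)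
  fix i j k assume ijk: "i < r" "j < n" "k < n"
  note AB_matrices = inverse_mats_matrices[OF inverse_AB]
  have "polar n d (mat_vec n A (unitv i)) (unitv j) (\<lambda>p. A p k)
      = polar n d (mat_vec n A (unitv i)) (mat_vec n A (mat_vec n B (unitv j)))
          (mat_vec n A (unitv k))"
    using ijk mat_vec_inverse[OF inverse_AB unitv_points] AB_matrices
    by (intro polar_cong) (auto simp: mat_vec_unitv)
  also have "\<dots> = polar n c (unitv i) (mat_vec n B (unitv j)) (unitv k)"
    using AB_matrices by (intro polar_pullback[OF pullback, symmetric] mat_vec_points) auto
  also have "\<dots> = polar n c (unitv i) (unitv k) (\<lambda>p. B p j)"
    using ijk AB_matrices by (subst polar_commute, intro polar_cong) (auto simp: mat_vec_unitv)
  finally show "polar n d (mat_vec n A (unitv i)) (unitv j) (\<lambda>p. A p k)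
      + polar n c (unitv i) (unitv k) (\<lambda>p. - B p j) = 0"
    by (simp add: polar_uminus_right)
qed

lemma sum_polar_coeff_mat_vec:
  assumes "a \<in> points n" "i < n" "l < n"
  shows "(\<Sum>p<n. mat_vec n B a p * polar_coeff c i l p)
    = (\<Sum>j<n. A j l * polar n d (mat_vec n A (unitv i)) (unitv j) a)"
proof -
  have Ba_points: "mat_vec n B a \<in> points n"
    using assms(1) inverse_mats_matrices(2)[OF inverse_AB] by (intro mat_vec_points)
  have "(\<Sum>p<n. mat_vec n B a p * polar_coeff c i l p)
      = polar n c (unitv i) (unitv l) (mat_vec n B a)"
    unfolding polar_expand_right[OF Ba_points, of c "unitv i" "unitv l"]
    using assms c_cubics by (simp add: polar_unitv)
  also have "\<dots>
      = polar n d (mat_vec n A (unitv i)) (mat_vec n A (unitv l)) (mat_vec n A (mat_vec n B a))"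
    using Ba_points by (intro polar_pullback[OF pullback]) auto
  also have "\<dots> = polar n d (mat_vec n A (unitv i)) (\<lambda>s. \<Sum>j<n. A j l * unitv j s) a"
  proof (rule polar_cong)
    fix s assume s_less: "s < n"
    have "(\<Sum>j<n. A j l * unitv j s) = (\<Sum>j<n. unitv j s * A j l)" by (simp add: mult.commute)
    also have "\<dots> = A s l"
      using s_less assms(3) inverse_mats_matrices(1)[OF inverse_AB]
      by (intro sum_unitv) (auto simp: matricesD)
    finally show "mat_vec n A (unitv l) s = (\<Sum>j<n. A j l * unitv j s)"
      using s_less assms(3) inverse_mats_matrices(1)[OF inverse_AB] by (simp add: mat_vec_unitv)
    show "mat_vec n A (mat_vec n B a) s = a s"
      using assms(1) s_less by (intro mat_vec_inverse[OF inverse_AB])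
  qed simp
  also have "\<dots> = (\<Sum>j<n. A j l * polar n d (mat_vec n A (unitv i)) (unitv j) a)"
    by (subst (1 2) polar_commute) (rule polar_sum_right)
  finally show ?thesis .
qed

lemma adjoint_of_adjoints:
  assumes a_points: "\<And>k. k < n \<Longrightarrow> a k \<in> points n" and b_points: "\<And>p. p < n \<Longrightarrow> (\<lambda>j. b j p) \<in> points n"
    and sol: "solves n r c d (\<lambda>i. mat_vec n A (unitv i)) a b"
  shows "adjoint_of n A B a b \<in> adjoints n r c"
proof -
  let ?T = "\<lambda>l j. A j l"
  have "?T \<in> matrices n" "B \<in> matrices n"
    using inverse_AB by (auto simp: inverse_mats_def matrices_def)
  then have "fst (adjoint_of n A B a b) \<in> mats n" "snd (adjoint_of n A B a b) \<in> mats n"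
    using a_points b_points by (auto simp: adjoint_of_def mats_def intro!: pointsD mat_vec_points)
  moreover have "adjoint_residual n c (fst (adjoint_of n A B a b)) (snd (adjoint_of n A B a b))
      i l k = 0" if "i < r" "l < n" "k < n" for i l k
  proof -
    have "adjoint_residual n c (fst (adjoint_of n A B a b)) (snd (adjoint_of n A B a b)) i l k
        = (\<Sum>p<n. mat_vec n B (a k) p * polar_coeff c i l p)
          + (\<Sum>p<n. mat_vec n ?T (\<lambda>j. b j p) l * polar_coeff c i p k)"
      using that by (simp add: adjoint_residual_def adjoint_of_def)
    also have "\<dots> = (\<Sum>j<n. A j l * polar n d (mat_vec n A (unitv i)) (unitv j) (a k))
          + (\<Sum>j<n. A j l * polar n c (unitv i) (unitv k) (b j))"
      using that r_le_n a_points b_points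
      by (simp add: sum_polar_coeff_mat_vec
          sum_polar_coeff_transpose[OF inverse_mats_matrices(1)[OF inverse_AB] c_cubics])
    also have "\<dots> = (\<Sum>j<n. A j l * (polar n d (mat_vec n A (unitv i)) (unitv j) (a k)
        + polar n c (unitv i) (unitv k) (b j)))"
      by (simp add: distrib_left sum.distrib)
    also have "\<dots> = 0" using sol that by (intro sum.neutral) (simp add: solves_def)
    finally show ?thesis .
  qed
  ultimately show ?thesis by (simp add: adjoints_def case_prod_unfold)
qed

end

definition solutions ::
    "nat \<Rightarrow> nat \<Rightarrow> (nat multiset \<Rightarrow> 'u) \<Rightarrow> (nat multiset \<Rightarrow> 'u) \<Rightarrow> (nat \<Rightarrow> nat \<Rightarrow> 'u) \<Rightarrow> 'u list set" where
  "solutions n r c d w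
    = {v \<in> vecs (2 * (n * n)). solves n r c d w (block n v) (block n (drop (n * n) v))}"

lemma block_K:
  assumes "v \<in> vecs (2 * (n * n))" "k < n" "p < n"
  shows "block n v k p \<in> K" "block n (drop (n * n) v) k p \<in> K"
  using assms block_index_less[of k n p n] vecsD[OF assms(1)] by (auto simp: block_def)

lemma column_mat_matrices: "v \<in> vecs (2 * (n * n)) \<Longrightarrow> column_mat n v \<in> matrices n"
  using block_K(1) by (simp add: matrices_def column_mat_def)

lemma append_vecs: "u \<in> vecs N \<Longrightarrow> v \<in> vecs N \<Longrightarrow> u @ v \<in> vecs (2 * N)"
  by (auto simp: vecs_def)

lemma vec_of_blocks:
  assumes "\<And>k. k < n \<Longrightarrow> a k \<in> points n" "\<And>k. k < n \<Longrightarrow> b k \<in> points n"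
  obtains v where "v \<in> vecs (2 * (n * n))" "\<And>k p. k < n \<Longrightarrow> p < n \<Longrightarrow> block n v k p = a k p"
    "\<And>k p. k < n \<Longrightarrow> p < n \<Longrightarrow> block n (drop (n * n) v) k p = b k p"
proof
  let ?l = "\<lambda>h. map (\<lambda>t. h (t div n) (t mod n)) [0..<n * n]"
  have l_vecs: "?l h \<in> vecs (n * n)" if "\<And>k. k < n \<Longrightarrow> h k \<in> points n" for h
  proof (rule vecsI)
    fix t assume "t < n * n"
    then have "t div n < n" "t mod n < n" by (cases "n = 0"; simp add: less_mult_imp_div_less)+
    from pointsD[OF that[OF this(1)] this(2)] show "?l h ! t \<in> K" using \<open>t < n * n\<close> by simp
  qed simp
  have "?l a \<in> vecs (n * n)" "?l b \<in> vecs (n * n)" using assms by (intro l_vecs; simp)+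
  then show "?l a @ ?l b \<in> vecs (2 * (n * n))" by (rule append_vecs)
  fix k p assume "k < n" "p < n"
  then show "block n (?l a @ ?l b) k p = a k p" "block n (drop (n * n) (?l a @ ?l b)) k p = b k p"
    using block_index_less[of k n p n] by (simp_all add: block_def nth_append)
qed

lemma card_solutions:
  assumes c_cubics: "c \<in> cubics n" and inverse_AB: "inverse_mats n A B"
    and r_le_n: "r \<le> n" and pullback: "is_pullback n c d A"
  shows "card (solutions n r c d (\<lambda>i. mat_vec n A (unitv i))) \<le> card (adjoints n r c)"
proof (rule card_inj_on_le)
  let ?S = "solutions n r c d (\<lambda>i. mat_vec n A (unitv i))"
  let ?h = "\<lambda>v. adjoint_of n A B (block n v) (block n (drop (n * n) v))"
  have points: "block n v k \<in> points n" "(\<lambda>j. block n (drop (n * n) v) j k) \<in> points n"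
    if "v \<in> ?S" "k < n" for v k
    using that block_K by (auto simp: solutions_def points_def)
  show "?h ` ?S \<subseteq> adjoints n r c"
    using points
    by (auto simp: solutions_def
        intro!: adjoint_of_adjoints[OF c_cubics inverse_AB r_le_n pullback])
  show "inj_on ?h ?S"
  proof (rule inj_onI)
    fix u v assume uv: "u \<in> ?S" "v \<in> ?S" and eq: "?h u = ?h v"
    note inject = adjoint_of_inject[OF inverse_AB points(1)[OF uv(1)] points(1)[OF uv(2)]
      points(2)[OF uv(1)] points(2)[OF uv(2)] eq]
    have len: "length u = 2 * (n * n)" "length v = 2 * (n * n)"
      using uv by (auto simp: solutions_def vecs_def)
    have "take (n * n) u = take (n * n) v"
      using len inject(1) by (intro block_eqI[of _ n]) (auto simp: block_take)
    moreover have "drop (n * n) u = drop (n * n) v"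
      using len inject(2) by (intro block_eqI[of _ n]) auto
    ultimately show "u = v" by (metis append_take_drop_id)
  qed
qed simp

lemma inverse_mats_solution:
  assumes c_cubics: "c \<in> cubics n" and inverse_AB: "inverse_mats n A B"
    and r_le_n: "r \<le> n" and pullback: "is_pullback n c d A"
  obtains v where "v \<in> solutions n r c d (\<lambda>i. mat_vec n A (unitv i))"
    "\<And>i j. i < n \<Longrightarrow> j < n \<Longrightarrow> column_mat n v i j = A i j"
proof -
  have "(\<lambda>p. A p k) \<in> points n" "(\<lambda>p. - B p k) \<in> points n" if "k < n" for k
    using inverse_mats_matrices[OF inverse_AB] that uminus_K by (auto simp: points_def matricesD)
  then obtain v where v_vecs: "v \<in> vecs (2 * (n * n))"
    and blocks: "\<And>k p. k < n \<Longrightarrow> p < n \<Longrightarrow> block n v k p = A p k"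
      "\<And>k p. k < n \<Longrightarrow> p < n \<Longrightarrow> block n (drop (n * n) v) k p = - B p k"
    using vec_of_blocks[of n "\<lambda>k p. A p k" "\<lambda>k p. - B p k"] by metis
  have "v \<in> solutions n r c d (\<lambda>i. mat_vec n A (unitv i))"
    using v_vecs solves_inverse[OF c_cubics inverse_AB r_le_n pullback]
      solves_cong[of n "block n v" "\<lambda>k p. A p k"
        "block n (drop (n * n) v)" "\<lambda>j p. - B p j"] blocks
    by (simp add: solutions_def)
  moreover have "column_mat n v i j = A i j" if "i < n" "j < n" for i j
    using blocks(1) that by (simp add: column_mat_def)
  ultimately show thesis by (rule that)
qed

subsection \<open>The equations\<close>

lemma polar_unitv_points:
  "c \<in> cubics n \<Longrightarrow> x \<in> points n \<Longrightarrow> y \<in> points n \<Longrightarrow> (\<lambda>p. polar n c x y (unitv p)) \<in> points n"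
  by (rule pointsI) (rule polar_K; simp)

definition equation ::
    "nat \<Rightarrow> (nat multiset \<Rightarrow> 'u) \<Rightarrow> (nat multiset \<Rightarrow> 'u) \<Rightarrow> (nat \<Rightarrow> nat \<Rightarrow> 'u) \<Rightarrow> nat \<Rightarrow> nat \<Rightarrow> nat
      \<Rightarrow> 'u list" where
  "equation n c d w i j k =
    outer_product (map (unitv k) [0..<n]) (map (\<lambda>p. polar n d (w i) (unitv j) (unitv p)) [0..<n]) @
    outer_product (map (unitv j) [0..<n])
      (map (\<lambda>p. polar n c (unitv i) (unitv k) (unitv p)) [0..<n])"

definition iso_equations ::
    "nat \<Rightarrow> nat \<Rightarrow> (nat multiset \<Rightarrow> 'u) \<Rightarrow> (nat multiset \<Rightarrow> 'u) \<Rightarrow> (nat \<Rightarrow> nat \<Rightarrow> 'u) \<Rightarrow> 'u list list" where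
  "iso_equations n r c d w = equations (cubic_coeffs n c) (cubic_coeffs n d) (unit_vecs e n)
     (map (\<lambda>i. map (w i) [0..<n]) [0..<r]) (unit_vecs e n)"

lemma set_iso_equations:
  assumes "r \<le> n"
  shows "set (iso_equations n r c d w) = (\<Union>i<r. \<Union>j<n. equation n c d w i j ` {..<n})"
proof -
  have zip: "zip (map f [0..<n]) (map g [0..<r]) = map (\<lambda>i. (f i, g i)) [0..<r]"
    for f :: "nat \<Rightarrow> 'u list" and g :: "nat \<Rightarrow> 'u list"
    using assms by (intro nth_equalityI) auto
  show ?thesis
    unfolding iso_equations_def equations_def unit_vecs_unitv zip equation_def[abs_def]
    by (simp add: image_equations_def row_equations_def polar_value_eq comp_def
        image_image atLeast0LessThan)
qed

lemma map_vecs: "x \<in> points n \<Longrightarrow> map x [0..<n] \<in> vecs n"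
  by (auto simp: vecs_def points_def)

lemma outer_product_vecs:
  assumes "u \<in> vecs m" "v \<in> vecs n"
  shows "outer_product u v \<in> vecs (m * n)"
proof -
  have "set (outer_product u v) \<subseteq> K"
    using assms by (auto simp: outer_product_def vecs_def vec_scale_def subset_iff)
  then show ?thesis using assms by (simp add: vecs_def)
qed

lemma vec_dot_outer_product_unitv:
  assumes "k < n" "length u = n * n" "y \<in> points n"
  shows "vec_dot (outer_product (map (unitv k) [0..<n]) (map y [0..<n])) u
      = (\<Sum>p<n. block n u k p * y p)"
proof -
  have "vec_dot (outer_product (map (unitv k) [0..<n]) (map y [0..<n])) u
      = (\<Sum>b<n. \<Sum>p<n. unitv k b * y p * block n u b p)"
    by (rule vec_dot_outer_product[OF assms(2)])
  also have "\<dots> = (\<Sum>b<n. if b = k then \<Sum>p<n. e * y p * block n u b p else 0)"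
    by (intro sum.cong refl) (auto simp: unitv_def intro!: sum.neutral)
  also have "\<dots> = (\<Sum>p<n. block n u k p * y p)"
    using assms(1,3) by (simp add: e_mult pointsD mult.commute)
  finally show ?thesis .
qed

context
  fixes n r c d w
  assumes r_le_n: "r \<le> n" and c_cubics: "c \<in> cubics n"
    and d_cubics: "d \<in> cubics n" and w_points: "\<And>i. i < r \<Longrightarrow> w i \<in> points n"
begin

lemma iso_equations_vecs: "set (iso_equations n r c d w) \<subseteq> vecs (2 * (n * n))"
  unfolding set_iso_equations[OF r_le_n] using c_cubics d_cubics w_points
  by (auto simp: equation_def intro!: append_vecs outer_product_vecs map_vecs polar_unitv_points)

lemma vec_dot_equation:
  assumes v_vecs: "v \<in> vecs (2 * (n * n))" and ijk: "i < r" "j < n" "k < n"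
  shows "vec_dot (equation n c d w i j k) v
    = polar n d (w i) (unitv j) (block n v k)
      + polar n c (unitv i) (unitv k) (block n (drop (n * n) v) j)"
proof -
  let ?y = "\<lambda>p. polar n d (w i) (unitv j) (unitv p)"
    and ?z = "\<lambda>p. polar n c (unitv i) (unitv k) (unitv p)"
  have len: "length v = n * n + n * n" using vecsD(1)[OF v_vecs] by simp
  have yz: "?y \<in> points n" "?z \<in> points n"
    using c_cubics d_cubics w_points ijk by (auto intro!: polar_unitv_points)
  have "block n v k \<in> points n" "block n (drop (n * n) v) j \<in> points n"
    using block_K[OF v_vecs] ijk by (auto simp: points_def)
  note expand = this[THEN polar_expand_right]
  have "vec_dot (equation n c d w i j k) v
      = (\<Sum>p<n. block n (take (n * n) v) k p * ?y p) + (\<Sum>p<n. block n (drop (n * n) v) j p * ?z p)"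
    unfolding equation_def using len ijk yz
    by (subst vec_dot_append_left) (simp_all add: vec_dot_outer_product_unitv)
  also have "(\<Sum>p<n. block n (take (n * n) v) k p * ?y p) = (\<Sum>p<n. block n v k p * ?y p)"
    using ijk by (simp add: block_take)
  finally show ?thesis by (simp only: expand)
qed

lemma solutions_iso_equations:
  "{v \<in> vecs (2 * (n * n)). \<forall>l\<in>set (iso_equations n r c d w). vec_dot l v = 0}
    = solutions n r c d w"
  unfolding set_iso_equations[OF r_le_n] solutions_def solves_def
  by (intro Collect_cong conj_cong refl) (auto simp: vec_dot_equation)

end

end

section \<open>Isomorphic forms\<close>

locale odd_nat_field =
  fixes R :: "nat ring" (structure)
  assumes field_R: "field R" and odd_card_R: "odd (card (carrier R))"
begin

sublocale field R
  by (rule field_R)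

sublocale nat_cring R ..

abbreviation emb_field :: "prod_ring set" where
  "emb_field \<equiv> emb R ` carrier R"

sublocale F: odd_subfield emb_field "emb R \<one>"
  using field_R odd_card_R by (rule odd_subfield_emb)

lemma F_q: "F.q = card (carrier R)"
  by (simp add: F.q_def card_emb cring_R')

lemma emb_form_cubics: "f \<in> cubic_forms R n \<Longrightarrow> emb_form R f \<in> F.cubics n"
  by (auto simp: F.cubics_def cubic_forms_iff emb_form_def emb_zero[OF cring_R'])

lemma bij_betw_emb_form: "bij_betw (emb_form R) (cubic_forms R n) (F.cubics n)"
proof (rule bij_betw_byWitness[where f' = "\<lambda>c m. proj R (c m)"])
  show "\<forall>f\<in>cubic_forms R n. (\<lambda>m. proj R (emb_form R f m)) = f"
    by (auto simp: cubic_forms_iff cring_R' emb_form_def)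
  show "\<forall>c\<in>F.cubics n. emb_form R (\<lambda>m. proj R (c m)) = c"
    by (auto simp: F.cubics_def emb_form_def fun_eq_iff intro!: emb_proj[OF cring_R'])
  show "emb_form R ` cubic_forms R n \<subseteq> F.cubics n" using emb_form_cubics by auto
  show "(\<lambda>c m. proj R (c m)) ` F.cubics n \<subseteq> cubic_forms R n"
    by (auto simp: F.cubics_def cubic_forms_iff proj_closed[OF cring_R'] proj_hom(1)[OF cring_R'])
qed

lemma finite_cubic_forms: "finite (cubic_forms R n)"
  using bij_betw_emb_form bij_betw_finite F.finite_cubics by blast

lemma emb_row_mult:
  fixes a b :: "nat \<Rightarrow> nat"
  assumes "\<And>k. k < n \<Longrightarrow> a k \<in> carrier R" "\<And>k. k < n \<Longrightarrow> b k \<in> carrier R"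
  shows "(\<Sum>k<n. emb R (a k) * emb R (b k)) = emb R (\<Oplus>k\<in>{..<n}. a k \<otimes> b k)"
proof -
  have "(\<Sum>k<n. emb R (a k) * emb R (b k)) = (\<Sum>k<n. emb R (a k \<otimes> b k))"
    using assms by (intro sum.cong refl) (simp add: emb_hom(2)[OF cring_R'])
  also have "\<dots> = emb R (\<Oplus>k\<in>{..<n}. a k \<otimes> b k)"
    using assms by (intro emb_finsum[OF cring_R', symmetric]) auto
  finally show ?thesis .
qed

lemma general_linear_inverse_mats:
  assumes "A \<in> general_linear R n"
  shows "\<exists>B. F.inverse_mats n (\<lambda>i j. emb R (A i j)) B"
proof -
  obtain B where AB_carrier: "\<forall>i<n. \<forall>j<n. A i j \<in> carrier R" "\<forall>i<n. \<forall>j<n. B i j \<in> carrier R"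
    "\<forall>i<n. \<forall>j<n. (\<Oplus>k\<in>{..<n}. A i k \<otimes> B k j) = (if i = j then \<one> else \<zero>)"
    "\<forall>i<n. \<forall>j<n. (\<Oplus>k\<in>{..<n}. B i k \<otimes> A k j) = (if i = j then \<one> else \<zero>)"
    using assms by (auto simp: general_linear_def)
  then have "F.inverse_mats n (\<lambda>i j. emb R (A i j)) (\<lambda>i j. emb R (B i j))"
    by (auto simp: F.inverse_mats_def F.matrices_def emb_row_mult emb_zero[OF cring_R'])
  then show ?thesis by blast
qed

lemma inverse_mats_general_linear:
  assumes "F.inverse_mats n A B"
  shows "(\<lambda>i j. proj R (A i j)) \<in> general_linear R n"
proof -
  have "(\<Oplus>k\<in>{..<n}. proj R (C i k) \<otimes> proj R (D k j)) = proj R (\<Sum>k<n. C i k * D k j)"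
    for C D :: "nat \<Rightarrow> nat \<Rightarrow> prod_ring" and i j
    by (simp add: proj_sum[OF cring_R'] proj_hom(4)[OF cring_R'])
  moreover have "proj R (emb R \<one>) = \<one>" "proj R 0 = \<zero>" by (simp_all add: cring_R' proj_hom)
  ultimately show ?thesis
    using assms proj_closed[OF cring_R']
    by (auto simp: general_linear_def F.inverse_mats_def intro!: exI[of _ "\<lambda>i j. proj R (B i j)"])
qed

lemma is_pullback_subst_matrix:
  assumes g_form: "g \<in> cubic_forms R n" and A_carrier: "\<forall>i<n. \<forall>j<n. A i j \<in> carrier R"
  shows "F.is_pullback n (emb_form R (subst_matrix R n g A)) (emb_form R g) (\<lambda>i j. emb R (A i j))"
  unfolding F.is_pullback_def
proof
  fix x
  have "g \<in> mpolys n" using g_form by (simp add: cubic_forms_def)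
  then have "peval (subst_matrix R n g A) x = peval g (\<lambda>i. \<Sum>j<n. emb R (A i j) * x j)"
    by (rule peval_subst_matrix[OF A_carrier])
  then show "cubic_value n (emb_form R (subst_matrix R n g A)) x
      = cubic_value n (emb_form R g) (mat_vec n (\<lambda>i j. emb R (A i j)) x)"
    unfolding peval_cubic_form[OF g_form]
      peval_cubic_form[OF subst_matrix_cubic_forms[OF g_form A_carrier]] mat_vec_def .
qed

lemma isomorphic_forms_iff:
  assumes f_form: "f \<in> cubic_forms R n" and g_form: "g \<in> cubic_forms R n"
  shows "isomorphic_forms R n f g \<longleftrightarrow>
    (\<exists>A B. F.inverse_mats n A B \<and> F.is_pullback n (emb_form R f) (emb_form R g) A)"
proof
  assume "isomorphic_forms R n f g"
  then obtain A where A_general_linear: "A \<in> general_linear R n" "f = subst_matrix R n g A"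
    by (auto simp: isomorphic_forms_def)
  then have "\<forall>i<n. \<forall>j<n. A i j \<in> carrier R" by (simp add: general_linear_def)
  from is_pullback_subst_matrix[OF g_form this] general_linear_inverse_mats[OF A_general_linear(1)]
  show "\<exists>A B. F.inverse_mats n A B \<and> F.is_pullback n (emb_form R f) (emb_form R g) A"
    unfolding A_general_linear(2)[symmetric] by blast
next
  assume "\<exists>A B. F.inverse_mats n A B \<and> F.is_pullback n (emb_form R f) (emb_form R g) A"
  then obtain A B where inverse_AB: "F.inverse_mats n A B"
    and pullback: "F.is_pullback n (emb_form R f) (emb_form R g) A" by blast
  let ?A = "\<lambda>i j. proj R (A i j)"
  have A_carrier: "\<forall>i<n. \<forall>j<n. ?A i j \<in> carrier R" using proj_closed[OF cring_R'] by auto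
  note subst_form = subst_matrix_cubic_forms[OF g_form A_carrier]
  have "F.is_pullback n (emb_form R (subst_matrix R n g ?A)) (emb_form R g) A"
    using is_pullback_subst_matrix[OF g_form A_carrier]
      F.matricesD[OF F.inverse_mats_matrices(1)[OF inverse_AB]]
    by (subst F.is_pullback_cong[of n A "\<lambda>i j. emb R (?A i j)"])
      (simp_all add: emb_proj[OF cring_R'])
  with pullback have "emb_form R f = emb_form R (subst_matrix R n g ?A)"
    by (intro F.cubic_value_inject[OF emb_form_cubics[OF f_form] emb_form_cubics[OF subst_form]])
      (simp add: F.is_pullback_def)
  then have "f = subst_matrix R n g ?A"
    using bij_betw_emb_form f_form subst_form by (auto simp: bij_betw_def inj_on_def)
  then show "isomorphic_forms R n f g"
    using inverse_mats_general_linear[OF inverse_AB] by (auto simp: isomorphic_forms_def)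
qed

end

section \<open>Correctness of the algorithm\<close>

locale odd_iso_run = iso_run +
  assumes odd_q: "odd q"
begin

sublocale odd_nat_field R
  by (rule odd_nat_field.intro) (use field_R odd_q in \<open>simp_all add: carrier_R\<close>)

lemma F_q_eq: "F.q = q"
  using F_q by (simp only: carrier_R card_lessThan)

lemma enc_elem_inject: "a \<in> emb_field \<Longrightarrow> b \<in> emb_field \<Longrightarrow> enc_elem a = enc_elem b \<longleftrightarrow> a = b"
  by (auto simp: enc_elem_def cring_R)

lemma is_zero_iff: "a \<in> emb_field \<Longrightarrow> is_zero a \<longleftrightarrow> a = 0"
  using enc_elem_inject F.zero_K by simp

lemma enc_vec_inject:
  assumes "u \<in> F.vecs n" "v \<in> F.vecs n"
  shows "enc_vec u = enc_vec v \<longleftrightarrow> u = v"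
proof (rule enc_map_inject)
  have "inj_on enc_elem emb_field" by (simp add: inj_on_def enc_elem_inject)
  then show "inj_on enc_elem (set u \<union> set v)"
    using assms by (elim inj_on_subset) (auto simp: F.vecs_def)
qed

lemma set_field_elems: "set field_elems = emb_field"
  by (auto simp: field_elems_def carrier_R)

lemma set_coeff_vectors: "set (List.n_lists m field_elems) = F.vecs m"
  by (auto simp: set_n_lists set_field_elems F.vecs_def)

lemma vecs_points: "F.vecs n = (\<lambda>x. map x [0..<n]) ` F.points n"
proof (intro equalityI subsetI)
  fix v assume v_vecs: "v \<in> F.vecs n"
  then have "v = map (\<lambda>i. v ! i) [0..<n]" using F.vecsD(1)[OF v_vecs] by (metis map_nth)
  then show "v \<in> (\<lambda>x. map x [0..<n]) ` F.points n"
    using F.vecsD(2)[OF v_vecs] by (intro image_eqI[of _ _ "\<lambda>i. v ! i"] F.pointsI)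
qed (auto intro: F.map_vecs)

lemma image_lists:
  assumes "ws \<in> set (List.n_lists r (List.n_lists n field_elems))"
  obtains w where "ws = map (\<lambda>i. map (w i) [0..<n]) [0..<r]" "\<And>i. i < r \<Longrightarrow> w i \<in> F.points n"
proof
  have len: "length ws = r" and mem: "\<And>i. i < r \<Longrightarrow> ws ! i \<in> F.vecs n"
    using assms set_coeff_vectors[of n] by (auto simp: set_n_lists)
  show "ws = map (\<lambda>i. map (\<lambda>p. ws ! i ! p) [0..<n]) [0..<r]"
    using F.vecsD(1)[OF mem] len by (intro nth_equalityI) (auto intro!: nth_equalityI)
  show "(\<lambda>p. ws ! i ! p) \<in> F.points n" if "i < r" for i
    using F.vecsD(2)[OF mem[OF that]] by (rule F.pointsI)
qed

lemma point_ok_iff: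
  assumes c_cubics: "c \<in> F.cubics n" and d_cubics: "d \<in> F.cubics n"
    and x_points: "x \<in> F.points n" and y_points: "y \<in> F.points n"
  shows "point_ok (cubic_coeffs n c) (cubic_coeffs n d) (map x [0..<n]) (map y [0..<n])
      (replicate n 0)
    \<longleftrightarrow> cubic_value n c x = cubic_value n d y \<and> ((\<forall>i<n. y i = 0) \<longrightarrow> (\<forall>i<n. x i = 0))"
proof -
  have "enc_vec (map z [0..<n]) = enc_vec (replicate n 0) \<longleftrightarrow> (\<forall>i<n. z i = 0)"
    if "z \<in> F.points n" for z
  proof -
    have "replicate n 0 \<in> F.vecs n" using F.zero_K by (auto simp: F.vecs_def)
    then have "enc_vec (map z [0..<n]) = enc_vec (replicate n 0) \<longleftrightarrow> map z [0..<n] = replicate n 0"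
      by (intro enc_vec_inject F.map_vecs that)
    then show ?thesis by (auto simp: list_eq_iff_nth_eq)
  qed
  then show ?thesis
    using F.cubic_value_K[OF c_cubics x_points] F.cubic_value_K[OF d_cubics y_points]
      x_points y_points
    by (simp add: point_ok_def form_value_eq enc_elem_inject)
qed

lemma matrix_ok_iff:
  assumes c_cubics: "c \<in> F.cubics n"
    and d_cubics: "d \<in> F.cubics n" and u_vecs: "u \<in> F.vecs (2 * (n * n))"
  shows "matrix_ok (cubic_coeffs n c) (cubic_coeffs n d) u (List.n_lists n field_elems)
      (replicate n 0)
    \<longleftrightarrow> F.is_pullback n c d (column_mat n u) \<and> F.trivial_kernel n (column_mat n u)"
proof -
  have "point_ok (cubic_coeffs n c) (cubic_coeffs n d) (map x [0..<n])
        (add_columns (map x [0..<n]) u (replicate n 0)) (replicate n 0)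
      \<longleftrightarrow> cubic_value n c x = cubic_value n d (mat_vec n (column_mat n u) x)
        \<and> ((\<forall>i<n. mat_vec n (column_mat n u) x i = 0) \<longrightarrow> (\<forall>i<n. x i = 0))"
    if x_points: "x \<in> F.points n" for x
    using F.vecsD(1)[OF u_vecs] x_points
      F.mat_vec_points[OF F.column_mat_matrices[OF u_vecs] x_points]
    by (simp add: add_columns_mat_vec point_ok_iff[OF c_cubics d_cubics])
  then show ?thesis
    by (auto simp: matrix_ok_def set_coeff_vectors vecs_points F.is_pullback_def
        F.trivial_kernel_def)
qed

lemma num_unknowns_equations:
  assumes "length ws = num_images"
  shows "num_unknowns (equations f g (unit_vecs unit_elem n) ws (unit_vecs unit_elem n))
      = 2 * (n * n)"
proof (cases "n = 0")
  case True
  then show ?thesis by (simp add: num_unknowns_def equations_def)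
next
  case False
  let ?E = "unit_vecs unit_elem n"
  obtain x xs w ws' where "?E = x # xs" "ws = w # ws'"
    using False assms by (cases ?E; cases ws) (auto simp: unit_vecs_def num_images_def)
  moreover have "length (image_equations f g x w ?E ?E) \<noteq> 0"
    using False by (simp add: length_image_equations)
  ultimately have "equations f g ?E ws ?E \<noteq> []" by (auto simp: equations_def)
  then show ?thesis
    using length_equation[of ?E _ f g ws] by (simp add: num_unknowns_def length_unit_vec)
qed

lemma equations_eq_iso_equations:
  "equations (cubic_coeffs n c) (cubic_coeffs n d) (unit_vecs unit_elem n)
     (map (\<lambda>i. map (w i) [0..<n]) [0..<num_images]) (unit_vecs unit_elem n)
    = F.iso_equations n (min n num_images) c d w"
proof -
  have "take n (map (\<lambda>i. map (w i) [0..<n]) [0..<num_images])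
      = map (\<lambda>i. map (w i) [0..<n]) [0..<min n num_images]"
    by (simp add: take_map min_def)
  then show ?thesis
    unfolding F.iso_equations_def
    using equations_take[of _ _ "unit_vecs unit_elem n"
        "map (\<lambda>i. map (w i) [0..<n]) [0..<num_images]"]
    by simp
qed

definition candidate ::
    "(nat multiset \<Rightarrow> prod_ring) \<Rightarrow> (nat multiset \<Rightarrow> prod_ring) \<Rightarrow> (nat \<Rightarrow> nat \<Rightarrow> prod_ring)
      \<Rightarrow> prod_ring list \<Rightarrow> prod_ring list" where
  "candidate c d w cs =
    add_lincomb cs (kernel_basis is_zero (F.iso_equations n (min n num_images) c d w)
      (unit_vecs unit_elem (2 * (n * n)))) (replicate (2 * (n * n)) 0)"

lemma candidate_vecs:
  assumes "c \<in> F.cubics n" "d \<in> F.cubics n" "\<And>i. i < num_images \<Longrightarrow> w i \<in> F.points n" "cs \<in> F.vecs m"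
  shows "candidate c d w cs \<in> F.vecs (2 * (n * n))"
proof -
  have "set (F.iso_equations n (min n num_images) c d w) \<subseteq> F.vecs (2 * (n * n))"
    using assms(1-3) by (intro F.iso_equations_vecs) auto
  from F.basis_kernel_unit_vecs[OF is_zero_iff this]
  show ?thesis
    unfolding candidate_def using assms(4) F.zero_K
    by (intro F.add_lincomb_vecs) (auto simp: F.basis_def F.vecs_def)
qed

lemma system_ok_iff:
  assumes c_cubics: "c \<in> F.cubics n" and d_cubics: "d \<in> F.cubics n"
    and w_points: "\<And>i. i < num_images \<Longrightarrow> w i \<in> F.points n"
  shows "system_ok (cubic_coeffs n c) (cubic_coeffs n d) (List.n_lists n field_elems)
      (List.n_lists (rank_factor * n) field_elems) (replicate n 0)
      (equations (cubic_coeffs n c) (cubic_coeffs n d) (unit_vecs unit_elem n)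
        (map (\<lambda>i. map (w i) [0..<n]) [0..<num_images]) (unit_vecs unit_elem n))
    \<longleftrightarrow> (\<exists>cs\<in>F.vecs (rank_factor * n). F.is_pullback n c d (column_mat n (candidate c d w cs)) \<and>
      F.trivial_kernel n (column_mat n (candidate c d w cs)))"
proof -
  have "num_unknowns (F.iso_equations n (min n num_images) c d w) = 2 * (n * n)"
    unfolding equations_eq_iso_equations[symmetric] by (rule num_unknowns_equations) simp
  then show ?thesis
    using matrix_ok_iff[OF c_cubics d_cubics candidate_vecs[OF c_cubics d_cubics w_points]]
    by (simp add: system_ok_def combination_ok_def equations_eq_iso_equations
        candidate_def[symmetric] set_coeff_vectors)
qed

lemma iso_test_iff:
  assumes c_cubics: "c \<in> F.cubics n" and d_cubics: "d \<in> F.cubics n"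
  shows "iso_test (cubic_coeffs n c) (cubic_coeffs n d) \<longleftrightarrow>
    (\<exists>w. (\<forall>i<num_images. w i \<in> F.points n) \<and> (\<exists>cs\<in>F.vecs (rank_factor * n).
      F.is_pullback n c d (column_mat n (candidate c d w cs)) \<and>
      F.trivial_kernel n (column_mat n (candidate c d w cs))))"
    (is "_ \<longleftrightarrow> (\<exists>w. ?P w \<and> ?Q w)")
proof
  assume "iso_test (cubic_coeffs n c) (cubic_coeffs n d)"
  then obtain ws where ws_mem: "ws \<in> set (List.n_lists num_images (List.n_lists n field_elems))"
    and system: "system_ok (cubic_coeffs n c) (cubic_coeffs n d) (List.n_lists n field_elems)
      (List.n_lists (rank_factor * n) field_elems) (replicate n 0)
      (equations (cubic_coeffs n c) (cubic_coeffs n d) (unit_vecs unit_elem n) ws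
        (unit_vecs unit_elem n))"
    by (auto simp: iso_test_def images_ok_def)
  from ws_mem obtain w where "ws = map (\<lambda>i. map (w i) [0..<n]) [0..<num_images]"
    and "\<And>i. i < num_images \<Longrightarrow> w i \<in> F.points n" by (rule image_lists) blast
  with system show "\<exists>w. ?P w \<and> ?Q w" using system_ok_iff[OF c_cubics d_cubics, of w] by auto
next
  assume "\<exists>w. ?P w \<and> ?Q w"
  then obtain w where w_points: "\<And>i. i < num_images \<Longrightarrow> w i \<in> F.points n" and "?Q w" by auto
  moreover have "map (\<lambda>i. map (w i) [0..<n]) [0..<num_images]
      \<in> set (List.n_lists num_images (List.n_lists n field_elems))"
    using w_points by (auto simp: set_n_lists[of num_images] set_coeff_vectors intro!: F.map_vecs)
  ultimately show "iso_test (cubic_coeffs n c) (cubic_coeffs n d)"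
    unfolding iso_test_def images_ok_def using system_ok_iff[OF c_cubics d_cubics, of w] by blast
qed

lemma iso_test_sound:
  assumes f_form: "f \<in> cubic_forms R n" and g_form: "g \<in> cubic_forms R n"
    and test: "iso_test (cubic_coeffs n (emb_form R f)) (cubic_coeffs n (emb_form R g))"
  shows "isomorphic_forms R n f g"
proof -
  note cubics = emb_form_cubics[OF f_form] emb_form_cubics[OF g_form]
  obtain w cs where w_points: "\<forall>i<num_images. w i \<in> F.points n"
    and cs_vecs: "cs \<in> F.vecs (rank_factor * n)"
    and ok: "F.is_pullback n (emb_form R f) (emb_form R g)
        (column_mat n (candidate (emb_form R f) (emb_form R g) w cs))"
      "F.trivial_kernel n (column_mat n (candidate (emb_form R f) (emb_form R g) w cs))"
    using test unfolding iso_test_iff[OF cubics] by blast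
  have "candidate (emb_form R f) (emb_form R g) w cs \<in> F.vecs (2 * (n * n))"
    using w_points cs_vecs by (intro candidate_vecs cubics) auto
  from F.trivial_kernel_invertible[OF F.column_mat_matrices[OF this] ok(2)] ok(1)
  show ?thesis unfolding isomorphic_forms_iff[OF f_form g_form] by blast
qed

lemma iso_test_complete:
  assumes c_cubics: "c \<in> F.cubics n"
    and d_cubics: "d \<in> F.cubics n" and inverse_AB: "F.inverse_mats n A B"
    and pullback: "F.is_pullback n c d A" and n_ge: "num_images \<le> n"
    and adjoints: "card (F.adjoints n num_images c) \<le> q ^ (rank_factor * n)"
  shows "iso_test (cubic_coeffs n c) (cubic_coeffs n d)"
proof -
  define w where "w = (\<lambda>i. mat_vec n A (F.unitv i))"
  have w_points: "w i \<in> F.points n" for i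
    unfolding w_def using F.inverse_mats_matrices(1)[OF inverse_AB]
    by (intro F.mat_vec_points F.unitv_points)
  let ?eqs = "F.iso_equations n num_images c d w"
  note solutions = F.solutions_iso_equations[OF n_ge c_cubics d_cubics w_points]
  obtain v where v_solution: "v \<in> F.solutions n num_images c d w"
    and column_mat: "\<And>i j. i < n \<Longrightarrow> j < n \<Longrightarrow> column_mat n v i j = A i j"
    unfolding w_def by (rule F.inverse_mats_solution[OF c_cubics inverse_AB n_ge pullback]) blast
  then have "v \<in> F.vecs (2 * (n * n))" "\<forall>l\<in>set ?eqs. vec_dot l v = 0"
    unfolding solutions[symmetric] by auto
  moreover have "card {v \<in> F.vecs (2 * (n * n)). \<forall>l\<in>set ?eqs. vec_dot l v = 0}
      \<le> F.q ^ (rank_factor * n)"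
    unfolding solutions
    using F.card_solutions[OF c_cubics inverse_AB n_ge pullback] adjoints
    by (simp add: w_def F_q_eq)
  moreover have "set ?eqs \<subseteq> F.vecs (2 * (n * n))"
    by (rule F.iso_equations_vecs[OF n_ge c_cubics d_cubics w_points])
  ultimately obtain cs where cs_vecs: "cs \<in> F.vecs (rank_factor * n)" "candidate c d w cs = v"
    using F.kernel_enumeration[OF is_zero_iff] unfolding candidate_def min.absorb2[OF n_ge] by blast
  have "F.is_pullback n c d (column_mat n v)" "F.trivial_kernel n (column_mat n v)"
    using column_mat pullback F.inverse_mats_trivial_kernel[OF inverse_AB]
      F.is_pullback_cong[of n "column_mat n v" A] F.trivial_kernel_cong[of n "column_mat n v" A]
    by blast+
  then show ?thesis unfolding iso_test_iff[OF c_cubics d_cubics] using w_points cs_vecs by blast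
qed

lemma card_misjudged_forms:
  assumes n_ge: "2 * num_images \<le> n"
  shows "card {f \<in> cubic_forms R n. \<exists>g\<in>cubic_forms R n.
      \<not> (iso_test (cubic_coeffs n (emb_form R f)) (cubic_coeffs n (emb_form R g)) \<longleftrightarrow>
          isomorphic_forms R n f g)} * q ^ n
    \<le> card (cubic_forms R n)"
    (is "card ?bad * _ \<le> _")
proof -
  let ?C = "{c \<in> F.cubics n. card (F.adjoints n num_images c) > F.q ^ (rank_factor * n)}"
  have bij: "inj_on (emb_form R) (cubic_forms R n)" "emb_form R ` cubic_forms R n = F.cubics n"
    using bij_betw_emb_form by (auto simp: bij_betw_def)
  have "emb_form R ` ?bad \<subseteq> ?C"
  proof (rule image_subsetI, rule ccontr)
    fix f assume "f \<in> ?bad" and "emb_form R f \<notin> ?C"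
    then obtain g where f_form: "f \<in> cubic_forms R n" and g_form: "g \<in> cubic_forms R n"
      and wrong: "iso_test (cubic_coeffs n (emb_form R f)) (cubic_coeffs n (emb_form R g))
        \<noteq> isomorphic_forms R n f g"
      and "card (F.adjoints n num_images (emb_form R f)) \<le> q ^ (rank_factor * n)"
      using emb_form_cubics by (auto simp: F_q_eq not_less)
    then have "iso_test (cubic_coeffs n (emb_form R f)) (cubic_coeffs n (emb_form R g))"
      if "isomorphic_forms R n f g"
      using that n_ge emb_form_cubics iso_test_complete
      unfolding isomorphic_forms_iff[OF f_form g_form] by auto
    with wrong show False using iso_test_sound[OF f_form g_form] by blast
  qed
  moreover have "inj_on (emb_form R) ?bad" using bij(1) by (rule inj_on_subset) auto
  ultimately have "card ?bad \<le> card ?C" by (intro card_inj_on_le[of "emb_form R"]) auto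
  then have "card ?bad * q ^ n \<le> card ?C * q ^ n" by (rule mult_right_mono) simp
  also have "\<dots> \<le> card (F.cubics n)"
    using F.card_many_adjoints[of num_images n] n_ge
    by (simp add: F_q_eq num_images_def rank_factor_def)
  also have "\<dots> = card (cubic_forms R n)" using bij card_image by metis
  finally show ?thesis .
qed

lemma cubic_forms_closed: "f \<in> cubic_forms R n \<Longrightarrow> f m \<in> carrier R"
  by (simp add: cubic_forms_iff)

lemma halts_within_iso_program:
  assumes "f \<in> cubic_forms R n" "g \<in> cubic_forms R n"
  shows "halts_within iso_program (enc_input R q n f g) (q ^ (4800 * (n + 1)))"
proof -
  have "q ^ (4800 * (n + 1)) = M ^ 24" unfolding M_def by (simp flip: power_mult)
  then show ?thesis using iso_program_decides(1) assms cubic_forms_closed by simp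
qed

lemma error_fraction:
  "real (card {f \<in> cubic_forms R n. \<exists>g\<in>cubic_forms R n.
      \<not> (accepts iso_program (enc_input R q n f g) \<longleftrightarrow> isomorphic_forms R n f g)})
    / real (card (cubic_forms R n)) \<le> 1 / real q ^ (if 2 * num_images \<le> n then n else 0)"
    (is "real (card ?bad) / _ \<le> _")
proof (cases "2 * num_images \<le> n")
  case True
  have "?bad = {f \<in> cubic_forms R n. \<exists>g\<in>cubic_forms R n.
      \<not> (iso_test (cubic_coeffs n (emb_form R f)) (cubic_coeffs n (emb_form R g)) \<longleftrightarrow>
          isomorphic_forms R n f g)}"
    using iso_program_decides(2) cubic_forms_closed by auto
  then have "card ?bad * q ^ n \<le> card (cubic_forms R n)" using card_misjudged_forms[OF True] by simp
  then have "real (card ?bad * q ^ n) \<le> real (card (cubic_forms R n))" by (rule of_nat_mono)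
  then have "real (card ?bad) * real q ^ n \<le> real (card (cubic_forms R n))" by simp
  then show ?thesis
    using True two_le_q by (cases "card (cubic_forms R n) = 0") (auto simp: field_simps)
next
  case False
  have "card ?bad \<le> card (cubic_forms R n)" using finite_cubic_forms by (intro card_mono) auto
  then show ?thesis using False by (cases "card (cubic_forms R n) = 0") (auto simp: field_simps)
qed

end

theorem theorem3p1:
  shows "\<exists>(P :: program) (t :: nat \<Rightarrow> nat) (e :: nat \<Rightarrow> nat).
    (\<lambda>n. real (t n)) \<in> O(\<lambda>n. real n) \<and>
    (\<lambda>n. real (e n)) \<in> \<Omega>(\<lambda>n. real n) \<and>
    (\<forall>(R :: nat ring) (q :: nat) (n :: nat).
       field R \<and> carrier R = {..<q} \<and> odd q \<longrightarrow>
         (\<forall>f\<in>cubic_forms R n. \<forall>g\<in>cubic_forms R n.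
            halts_within P (enc_input R q n f g) (q ^ t n)) \<and>
         real (card {f \<in> cubic_forms R n. \<exists>g\<in>cubic_forms R n.
            \<not> (accepts P (enc_input R q n f g) \<longleftrightarrow> isomorphic_forms R n f g)})
           / real (card (cubic_forms R n)) \<le> 1 / real q ^ e n)"
proof (rule exI[of _ iso_program], rule exI[of _ "\<lambda>n. 4800 * (n + 1)"],
    rule exI[of _ "\<lambda>n. if 2 * num_images \<le> n then n else 0"], intro conjI allI impI)
  show "(\<lambda>n. real (4800 * (n + 1))) \<in> O(\<lambda>n. real n)"
    by (rule bigoI[of _ 9600]) (auto intro!: eventually_sequentiallyI[of 1])
  show "(\<lambda>n. real (if 2 * num_images \<le> n then n else 0)) \<in> \<Omega>(\<lambda>n. real n)"
    by (rule landau_omega.bigI[of 1]) (auto intro!: eventually_sequentiallyI[of "2 * num_images"])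
next
  fix R :: "nat ring" and q n :: nat
  assume odd_field: "field R \<and> carrier R = {..<q} \<and> odd q"
  then interpret odd_iso_run R q n
    by (intro odd_iso_run.intro iso_run.intro odd_iso_run_axioms.intro) simp_all
  show "\<forall>f\<in>cubic_forms R n. \<forall>g\<in>cubic_forms R n.
      halts_within iso_program (enc_input R q n f g) (q ^ (4800 * (n + 1)))"
    using halts_within_iso_program by blast
  show "real (card {f \<in> cubic_forms R n. \<exists>g\<in>cubic_forms R n.
      \<not> (accepts iso_program (enc_input R q n f g) \<longleftrightarrow> isomorphic_forms R n f g)})
    / real (card (cubic_forms R n)) \<le> 1 / real q ^ (if 2 * num_images \<le> n then n else 0)"
    by (rule error_fraction)
qed

end
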